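(* Let $\Omega\subset\widehat{\mathbb{C}}$ be a domain such that $\partial\Omega$ is a Peano compactum and such that the diameters of the non-degenerate components of $\partial\Omega$ have a finite sum. Let $D\subset\widehat{\mathbb{C}}$ be a circle domain such that the point components of $\partial D$ form a set of $\sigma$-finite linear measure. Then any conformal homeomorphism $\varphi: D\rightarrow\Omega$ (of $D$ onto $\Omega$) has a continuous extension $\overline{\varphi}:\overline{D}\rightarrow\overline{\Omega}$.
   Context: A domain is a connected open subset of the extended complex plane $\widehat{\mathbb{C}}$; diameters, closures and boundaries are taken in $\widehat{\mathbb{C}}$ with the spherical metric. A circle domain is a domain in $\widehat{\mathbb{C}}$ each of whose complementary components is a point or a closed geometric disk. A component of a set is non-degenerate if it contains more than one point; a point component is a component that is a singleton. A Peano continuum is the image of $[0,1]$ under a continuous map. A Peano compactum is a compact metrisable space each of whose components is a Peano continuum (possibly a single point), such that for any $C>0$ at most finitely many of the components have diameter $>C$. Linear measure is one-dimensional Hausdorff measure. *)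

theory Defs
  imports "HOL-Analysis.Analysis"
begin
datatype ext_complex = Fin complex | Infty

fun stereo :: "ext_complex \<Rightarrow> complex \<times> real" where
  "stereo (Fin z) = ((2 / (1 + (cmod z)\<^sup>2)) *\<^sub>R z, ((cmod z)\<^sup>2 - 1) / ((cmod z)\<^sup>2 + 1))"
| "stereo Infty = (0, 1)"

lemma norm_stereo [simp]: "norm (stereo p) = 1"
proof (cases p)
  case (Fin z)
  define r where "r = (cmod z)\<^sup>2"
  have pos: "1 + r > 0" by (simp add: r_def add_pos_nonneg)
  have "(norm (stereo p))\<^sup>2 = (2 / (1 + r))\<^sup>2 * r + ((r - 1) / (r + 1))\<^sup>2"
    unfolding Fin stereo.simps norm_Pair r_def
    by (simp add: power_mult_distrib power_divide)
  also have "\<dots> = (4 * r + (r - 1)\<^sup>2) / (1 + r)\<^sup>2"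
    by (simp add: power_divide add_divide_distrib add.commute)
  also have "4 * r + (r - 1)\<^sup>2 = (1 + r)\<^sup>2"
    by (simp add: power2_eq_square algebra_simps)
  also have "(1 + r)\<^sup>2 / (1 + r)\<^sup>2 = 1"
    using pos by simp
  finally show ?thesis
    using norm_ge_zero[of "stereo p"] by (auto simp only: power2_eq_1_iff)
qed (simp add: norm_Pair)

lemma stereo_eq_iff: "stereo p = stereo q \<longleftrightarrow> p = q"
proof
  have fin_inf: "stereo (Fin z) \<noteq> stereo Infty" for z
    by (auto simp: add_nonneg_eq_0_iff)
  have fin_fin: "z = w" if eq: "stereo (Fin z) = stereo (Fin w)" for z w
  proof -
    have pos: "1 + (cmod u)\<^sup>2 > 0" for u by (simp add: add_pos_nonneg)
    have h: "((cmod u)\<^sup>2 - 1) / ((cmod u)\<^sup>2 + 1) = 1 - 2 / (1 + (cmod u)\<^sup>2)" for u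
      using pos[of u] by (simp add: field_simps)
    have a: "2 / (1 + (cmod z)\<^sup>2) = 2 / (1 + (cmod w)\<^sup>2)"
      using eq h[of z] h[of w] by simp
    then have "(2 / (1 + (cmod w)\<^sup>2)) *\<^sub>R z = (2 / (1 + (cmod w)\<^sup>2)) *\<^sub>R w"
      using eq by simp
    then show ?thesis using pos[of w] by (simp only: scaleR_cancel_left) auto
  qed
  show "p = q" if "stereo p = stereo q"
    using that fin_inf fin_fin by (metis ext_complex.exhaust)
qed simp

lemma abs_inner_stereo_le: "\<bar>stereo p \<bullet> stereo q\<bar> \<le> 1"
  using Cauchy_Schwarz_ineq2[of "stereo p" "stereo q"] by simp

lemma arccos_inner_triangle:
  fixes a b c :: "'a::real_inner"
  assumes [simp]: "norm a = 1" "norm b = 1" "norm c = 1"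
  shows "arccos (a \<bullet> b) \<le> arccos (a \<bullet> c) + arccos (b \<bullet> c)"
proof -
  have ab: "\<bar>a \<bullet> b\<bar> \<le> 1" using Cauchy_Schwarz_ineq2[of a b] by simp
  have ac: "\<bar>a \<bullet> c\<bar> \<le> 1" using Cauchy_Schwarz_ineq2[of a c] by simp
  have bc: "\<bar>b \<bullet> c\<bar> \<le> 1" using Cauchy_Schwarz_ineq2[of b c] by simp
  have unit: "a \<bullet> a = 1" "b \<bullet> b = 1" "c \<bullet> c = 1"
    by (simp_all add: dot_square_norm)
  define \<alpha> \<beta> where "\<alpha> = arccos (a \<bullet> c)" and "\<beta> = arccos (b \<bullet> c)"
  have nonneg: "0 \<le> \<alpha>" "0 \<le> \<beta>"
    using ac bc by (auto simp: \<alpha>_def \<beta>_def intro!: arccos_lbound)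
  have na: "norm (a - (a \<bullet> c) *\<^sub>R c) = sin \<alpha>"
    using ac by (simp add: \<alpha>_def sin_arccos norm_eq_sqrt_inner inner_simps unit
        inner_commute power2_eq_square)
  have nb: "norm (b - (b \<bullet> c) *\<^sub>R c) = sin \<beta>"
    using bc by (simp add: \<beta>_def sin_arccos norm_eq_sqrt_inner inner_simps unit
        inner_commute power2_eq_square)
  have "\<bar>(a - (a \<bullet> c) *\<^sub>R c) \<bullet> (b - (b \<bullet> c) *\<^sub>R c)\<bar> \<le> sin \<alpha> * sin \<beta>"
    using Cauchy_Schwarz_ineq2 na nb by metis
  moreover have "(a - (a \<bullet> c) *\<^sub>R c) \<bullet> (b - (b \<bullet> c) *\<^sub>R c) = a \<bullet> b - cos \<alpha> * cos \<beta>"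
    using ac bc by (simp add: \<alpha>_def \<beta>_def inner_simps unit inner_commute)
  ultimately have "cos (\<alpha> + \<beta>) \<le> a \<bullet> b"
    by (simp add: cos_add)
  show ?thesis
  proof (cases "\<alpha> + \<beta> \<le> pi")
    case True
    have "arccos (a \<bullet> b) \<le> arccos (cos (\<alpha> + \<beta>))"
      using \<open>cos (\<alpha> + \<beta>) \<le> a \<bullet> b\<close> ab by (intro arccos_le_arccos) auto
    also have "\<dots> = \<alpha> + \<beta>"
      using nonneg True by (intro arccos_cos) auto
    finally show ?thesis by (simp add: \<alpha>_def \<beta>_def)
  next
    case False
    have "arccos (a \<bullet> b) \<le> pi"
      using ab by (intro arccos_ubound) auto
    then show ?thesis using False by (simp add: \<alpha>_def \<beta>_def)
  qed
qed

text \<open>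
  The distance is the angle between the stereographic images, that is, the geodesic distance
  of the Riemannian metric \<open>2|dz| / (1 + |z|^2)\<close>.
\<close>

instantiation ext_complex :: metric_space
begin

definition dist_ext_complex :: "ext_complex \<Rightarrow> ext_complex \<Rightarrow> real"
  where "dist_ext_complex p q = arccos (stereo p \<bullet> stereo q)"

definition uniformity_ext_complex :: "(ext_complex \<times> ext_complex) filter"
  where "uniformity_ext_complex = (INF e\<in>{0<..}. principal {(p, q). dist p q < e})"

definition open_ext_complex :: "ext_complex set \<Rightarrow> bool"
  where "open_ext_complex U \<longleftrightarrow> (\<forall>p\<in>U. eventually (\<lambda>(p', q). p' = p \<longrightarrow> q \<in> U) uniformity)"

instance
proof
  fix p q r :: ext_complex
  have "arccos (stereo p \<bullet> stereo q) = 0 \<longleftrightarrow> stereo p \<bullet> stereo q = 1"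
    using cos_arccos_abs[OF abs_inner_stereo_le[of p q]] by (metis arccos_1 cos_zero)
  also have "\<dots> \<longleftrightarrow> stereo p = stereo q"
    using norm_cauchy_schwarz_eq[of "stereo p" "stereo q"] by auto
  finally show "dist p q = 0 \<longleftrightarrow> p = q"
    by (simp add: dist_ext_complex_def stereo_eq_iff)
  show "dist p q \<le> dist p r + dist q r"
    unfolding dist_ext_complex_def by (rule arccos_inner_triangle) simp_all
qed (rule uniformity_ext_complex_def open_ext_complex_def)+

end

lemma dist_stereo: "dist (stereo p) (stereo q) = 2 * sin (dist p q / 2)"
proof -
  have le: "- 1 \<le> stereo p \<bullet> stereo q" "stereo p \<bullet> stereo q \<le> 1"
    using abs_inner_stereo_le[of p q] by linarith+
  have bounds: "0 \<le> dist p q" "dist p q \<le> pi"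
    unfolding dist_ext_complex_def by (rule arccos_lbound[OF le], rule arccos_ubound[OF le])
  have unit: "stereo u \<bullet> stereo u = 1" for u
    by (simp add: dot_square_norm)
  have cos: "stereo p \<bullet> stereo q = cos (2 * (dist p q / 2))"
    using cos_arccos[OF le] unfolding dist_ext_complex_def by simp
  have "(dist (stereo p) (stereo q))\<^sup>2 = 2 - 2 * (stereo p \<bullet> stereo q)"
    unfolding dist_norm power2_norm_eq_inner
    by (simp add: inner_diff_left inner_diff_right inner_commute unit)
  also have "\<dots> = (2 * sin (dist p q / 2))\<^sup>2"
    unfolding cos cos_double_sin by (simp only: power_mult_distrib) algebra
  finally show ?thesis
  proof (rule power2_eq_imp_eq)
    show "0 \<le> 2 * sin (dist p q / 2)"
      using bounds sin_ge_zero[of "dist p q / 2"] by linarith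
  qed (rule zero_le_dist)
qed

text \<open>
  The map \<open>1/z\<close> serves as the chart at infinity. The value of \<^term>\<open>fin_part\<close> at
  \<^term>\<open>Infty\<close> is immaterial below: since f is required to be continuous, in a neighbourhood
  of p the maps take values in the domain of the chart at f p.
\<close>

fun sph_inverse :: "ext_complex \<Rightarrow> ext_complex" where
  "sph_inverse (Fin z) = (if z = 0 then Infty else Fin (inverse z))"
| "sph_inverse Infty = Fin 0"

fun fin_part :: "ext_complex \<Rightarrow> complex" where
  "fin_part (Fin z) = z"
| "fin_part Infty = 0"

definition chart_map :: "ext_complex \<Rightarrow> ext_complex \<Rightarrow> ext_complex"
  where "chart_map p = (if p = Infty then sph_inverse else id)"

definition local_rep :: "(ext_complex \<Rightarrow> ext_complex) \<Rightarrow> ext_complex \<Rightarrow> complex \<Rightarrow> complex"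
  where "local_rep f p z = fin_part (chart_map (f p) (f (chart_map p (Fin z))))"

definition sph_holomorphic_on :: "(ext_complex \<Rightarrow> ext_complex) \<Rightarrow> ext_complex set \<Rightarrow> bool"
  where "sph_holomorphic_on f D \<longleftrightarrow>
    continuous_on D f \<and> (\<forall>p\<in>D. local_rep f p analytic_on {fin_part (chart_map p p)})"

definition conformal_homeomorphism ::
    "ext_complex set \<Rightarrow> ext_complex set \<Rightarrow> (ext_complex \<Rightarrow> ext_complex) \<Rightarrow> bool"
  where "conformal_homeomorphism D E f \<longleftrightarrow>
    (\<exists>g. homeomorphism D E f g) \<and> sph_holomorphic_on f D"

definition sph_domain :: "ext_complex set \<Rightarrow> bool"
  where "sph_domain D \<longleftrightarrow> open D \<and> connected D \<and> D \<noteq> {}"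

text \<open>
  The closed geometric disks of the sphere are the closed spherical caps. In the affine
  coordinate these are the closed Euclidean disks, the complements of open Euclidean disks,
  and the closed half-planes, the latter two together with the point at infinity.
\<close>

definition closed_geometric_disk :: "ext_complex set \<Rightarrow> bool"
  where "closed_geometric_disk B \<longleftrightarrow> (\<exists>p r. 0 < r \<and> r < pi \<and> B = cball p r)"

definition circle_domain :: "ext_complex set \<Rightarrow> bool"
  where "circle_domain D \<longleftrightarrow>
    sph_domain D \<and> (\<forall>K\<in>components (- D). (\<exists>p. K = {p}) \<or> closed_geometric_disk K)"

definition peano_continuum :: "'a::topological_space set \<Rightarrow> bool"
  where "peano_continuum K \<longleftrightarrow> (\<exists>g. path g \<and> path_image g = K)"

definition peano_compactum :: "'a::metric_space set \<Rightarrow> bool"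
  where "peano_compactum S \<longleftrightarrow>
    compact S \<and> (\<forall>K\<in>components S. peano_continuum K) \<and>
    (\<forall>C>0. finite {K \<in> components S. diameter K > C})"

definition nondegenerate_components :: "'a::topological_space set \<Rightarrow> 'a set set"
  where "nondegenerate_components S = {K \<in> components S. \<exists>x\<in>K. \<exists>y\<in>K. x \<noteq> y}"

definition point_components :: "'a::topological_space set \<Rightarrow> 'a set"
  where "point_components S = {x. {x} \<in> components S}"

text \<open>
  One-dimensional Hausdorff (outer) measure. Since \<^const>\<open>diameter\<close> is only meaningful for
  bounded sets, covers by bounded sets are used; covers may contain empty sets, of diameter 0.
\<close>

definition linear_premeasure :: "real \<Rightarrow> 'a::metric_space set \<Rightarrow> ennreal"
  where "linear_premeasure \<delta> A =
    (INF U \<in> {U :: nat \<Rightarrow> 'a set. A \<subseteq> (\<Union>n. U n) \<and> (\<forall>n. bounded (U n) \<and> diameter (U n) \<le> \<delta>)}.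
      \<Sum>n. ennreal (diameter (U n)))"

definition linear_measure :: "'a::metric_space set \<Rightarrow> ennreal"
  where "linear_measure A = (SUP \<delta>\<in>{0<..}. linear_premeasure \<delta> A)"

definition sigma_finite_linear_measure :: "'a::metric_space set \<Rightarrow> bool"
  where "sigma_finite_linear_measure A \<longleftrightarrow>
    (\<exists>E :: nat \<Rightarrow> 'a set. A = (\<Union>n. E n) \<and> (\<forall>n. linear_measure (E n) < \<infinity>))"

end

theory Submission
  imports Defs "HOL-Complex_Analysis.Complex_Analysis"
begin

text \<open>
  Send a finite point of \<open>D\<close> and its finite image to infinity, so that \<open>D\<close> and \<open>\<Omega>\<close> become complements
  of compact plane sets \<open>E\<close> and \<open>F\<close> and the map becomes a holomorphic homeomorphism \<open>f\<close>. Collapsing the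
  components of \<open>E\<close> and of \<open>F\<close> to points, \<open>f\<close> extends to a homeomorphism of the quotients, because by
  Janiszewski's theorem a compact set \<open>J\<close> off \<open>F\<close> and its preimage have corresponding complementary
  components. Let \<open>p\<close> be a boundary point, \<open>Q\<close> its component (a point or a disk) and \<open>A\<close> the circle of
  radius \<open>r\<close> about \<open>p\<close> with \<open>Q\<close> removed, which is connected. For suitable small \<open>r\<close> the image of \<open>A\<close> under the
  extended correspondence is a connected set covered by countably many pieces of small total diameter: images
  of arcs (length-area principle) and components of \<open>F\<close>, of which only countably many are met for almost
  every \<open>r\<close> (Eilenberg's inequality and \<open>\<sigma>\<close>-finiteness) and only ones from a tail of the summable family
  for small \<open>r\<close>. Hence the image of \<open>A\<close> has small diameter. If its closure meets the component of \<open>F\<close>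
  that corresponds to \<open>Q\<close>, local connectedness of the Peano continuum bounding that component makes the
  intersection part of a small continuum, and Janiszewski's theorem again shows that \<open>f\<close> maps the part of
  \<open>- E\<close> inside the circle into a small disk. So \<open>f\<close> has a limit at \<open>p\<close>.
\<close>

unbundle no fps_syntax

section \<open>The correspondence between complementary components\<close>

text \<open>The obstacle: \<open>E\<close> may have uncountably many components and \<open>f\<close>
  has no values on them, so a circle about a boundary point has no image curve to which a length
  estimate could apply. The correspondence of components supplies a connected substitute, and a
  connected set covered by countably many sets of total diameter s has diameter at most s: project
  it by the distance from one of its points and compare Lebesgue measures. Uncountably many
  components of \<open>F\<close> of diameter 0 could break this; the hypothesis on linear measure
  excludes them for almost every radius. The logarithm of the radius is the parameter, because small
  circles then become vertical segments of bounded length over a half-line of infinite measure, on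
  which finite area forces short slices arbitrarily far out. All this controls only the part of the
  circle outside \<open>Q\<close>; the rest is related to a whole component of \<open>F\<close>,
  which may be large. That component does not separate the plane, and it stays harmless once the
  small part is enlarged so as to meet it in a connected set; this is what local connectedness is
  for.\<close>

lemma in_component_if_in_closure:
  assumes "C \<in> components S" "x \<in> closure C" "x \<in> S"
  shows "x \<in> C"
  using closedin_component[OF assms(1)] assms by (auto simp: closedin_closed closure_minimal)
    (metis closure_minimal inf_le2 subsetD)

text \<open>By Sura-Bura the component has a relatively clopen neighbourhood \<open>K\<close> in
  \<open>F\<close> inside \<open>W\<close>. Both \<open>K\<close> and \<open>F - K\<close> are
  closed, so a thin open neighbourhood of \<open>K\<close> has its frontier off both.\<close>

lemma component_open_nbhd_avoiding:
  fixes F :: "'a::euclidean_space set"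
  assumes "compact F" "C \<in> components F" "open W" "C \<subseteq> W"
  obtains V where "open V" "bounded V" "C \<subseteq> V" "V \<subseteq> W" "frontier V \<inter> F = {}"
proof -
  have "compact C"
    using assms compact_components by blast
  then obtain K where K: "openin (top_of_set F) K" "compact K" "C \<subseteq> K" "K \<subseteq> W"
    using Sura_Bura_clopen_subset[OF closed_imp_locally_compact[OF compact_imp_closed] assms(2) _ assms(3,4)]
      assms(1) by metis
  have "closedin (top_of_set F) (F - K)"
    using K(1) by auto
  then have "closed (F - K)"
    using assms(1) closedin_closed_trans compact_imp_closed by blast
  then have "open (W - (F - K))"
    using assms(3) by auto
  moreover have "K \<subseteq> W - (F - K)"
    using K by auto
  ultimately obtain e where e: "e > 0" "(\<Union>x\<in>K. cball x e) \<subseteq> W - (F - K)"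
    using compact_subset_open_imp_cball_epsilon_subset[OF \<open>compact K\<close>] by metis
  define V where "V = (\<Union>x\<in>K. ball x e)"
  have V: "V \<subseteq> (\<Union>x\<in>K. cball x e)" "K \<subseteq> V" "open V"
    using e(1) by (auto simp: V_def)
  have "closed (\<Union>x\<in>K. cball x e)" "bounded (\<Union>x\<in>K. cball x e)"
    using compact_minkowski_sum_cball[OF \<open>compact K\<close>, of e] by (auto intro: compact_imp_closed compact_imp_bounded)
  then have cl: "closure V \<subseteq> (\<Union>x\<in>K. cball x e)" "bounded V"
    using V(1) by (auto intro: closure_minimal[THEN subsetD] bounded_subset)
  have "frontier V \<inter> F = {}"
    using cl(1) e(2) V(2) by (force simp: frontier_def interior_open[OF V(3)])
  with V cl e(2) K(3) show thesis
    by (intro that[of V]) blast+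
qed

text \<open>Janiszewski for the disjoint sets \<open>V \<inter> F\<close> and \<open>- V\<close>:
  neither separates two points of \<open>V - F\<close>, hence neither does their union. The set
  \<open>V \<inter> F\<close> is compact because \<open>V\<close> accumulates outside itself only on
  \<open>J\<close>, which misses \<open>F\<close>.\<close>

lemma connected_component_diff_compact:
  fixes F :: "complex set"
  assumes "compact F" "connected (- F)" "closed J" "J \<inter> F = {}" "V \<in> components (- J)"
  shows "connected (V - F)"
  unfolding connected_iff_connected_component
proof (intro ballI)
  fix a b assume ab: "a \<in> V - F" "b \<in> V - F"
  have V: "V \<subseteq> - J" "connected V" "open V"
    using assms open_components[of "- J"] in_components_subset in_components_connected by blast+
  have "compact (closure V \<inter> F)"
    using assms(1) by (simp add: closed_Int_compact)
  moreover have "closure V \<inter> F = V \<inter> F"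
    using in_component_if_in_closure[OF assms(5)] closure_subset assms(4) by blast
  ultimately have 1: "compact (V \<inter> F)"
    by simp
  have 2: "connected_component (- (V \<inter> F)) a b"
    using assms(2) ab unfolding connected_component_def by (intro exI[of _ "- F"]) auto
  have 3: "connected_component (- (- V)) a b"
    using V ab unfolding connected_component_def by (intro exI[of _ "V"]) auto
  have "connected_component (- (V \<inter> F \<union> - V)) a b"
    by (rule Janiszewski[OF 1 _ _ 2 3]) (use V in auto)
  moreover have "- (V \<inter> F \<union> - V) = V - F" by auto
  ultimately show "connected_component (V - F) a b" by simp
qed

section \<open>The correspondence as a relation between points of the plane\<close>

definition cluster_graph :: "complex set \<Rightarrow> (complex \<Rightarrow> complex) \<Rightarrow> (complex \<times> complex) set"
  where "cluster_graph E f = closure ((\<lambda>z. (z, f z)) ` (- E))"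

text \<open>The induced map of the quotients, kept as a relation on points so that no quotient space
  has to be formed: a component of \<open>E\<close> is related as a whole to each component of
  \<open>F\<close> that contains a cluster value of \<open>f\<close> at one of its points. A point
  inside a disk of \<open>E\<close> has no cluster values of its own, which is why \<open>u\<close>
  and \<open>v\<close> may differ from \<open>z\<close> and \<open>w\<close>.\<close>

definition cluster_rel :: "complex set \<Rightarrow> complex set \<Rightarrow> (complex \<Rightarrow> complex) \<Rightarrow> complex \<Rightarrow> complex \<Rightarrow> bool"
  where "cluster_rel E F f z w \<longleftrightarrow>
    z \<notin> E \<and> w = f z \<or>
    z \<in> E \<and> w \<in> F \<and>
      (\<exists>u v. connected_component E z u \<and> connected_component F v w \<and> (u, v) \<in> cluster_graph E f)"

lemma cluster_graph_approx:
  assumes "(z, w) \<in> cluster_graph E f" "open A" "z \<in> A" "open B" "w \<in> B"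
  obtains x where "x \<notin> E" "x \<in> A" "f x \<in> B"
proof -
  have "A \<times> B \<inter> (\<lambda>z. (z, f z)) ` (- E) \<noteq> {}"
    using assms open_Times[of A B] unfolding cluster_graph_def closure_iff_nhds_not_empty by blast
  then show thesis using that by auto
qed

text \<open>\<open>- E\<close> and \<open>- F\<close> stand for two domains of the sphere with the
  point at infinity removed; \<open>proper\<close> expresses that \<open>f\<close> and
  \<open>g\<close> extend there by fixing it. The conditions are symmetric, so what is proved for
  \<open>f\<close> holds for \<open>g\<close> through \<open>swap\<close>.\<close>

locale complement_homeo =
  fixes E F :: "complex set" and f g :: "complex \<Rightarrow> complex"
  assumes compact_source: "compact E" and compact_target: "compact F"
    and connected_source: "connected (- E)" and connected_target: "connected (- F)"
    and homeo: "homeomorphism (- E) (- F) f g"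
    and proper: "bounded X \<Longrightarrow> bounded (f ` (X - E))" "bounded X \<Longrightarrow> bounded (g ` (X - F))"
begin

lemma swap: "complement_homeo F E g f"
  by unfold_locales
    (use compact_source compact_target connected_source connected_target proper homeomorphism_symD[OF homeo]
     in auto)

lemma gf: "z \<notin> E \<Longrightarrow> g (f z) = z" and fg: "w \<notin> F \<Longrightarrow> f (g w) = w"
  and f_notin: "z \<notin> E \<Longrightarrow> f z \<notin> F" and g_notin: "w \<notin> F \<Longrightarrow> g w \<notin> E"
  using homeo by (auto simp: homeomorphism_def)

lemma cont_f: "continuous_on (- E) f" and cont_g: "continuous_on (- F) g"
  using homeo by (auto simp: homeomorphism_def)

lemma cluster_graph_swap: "(w, z) \<in> cluster_graph F g \<longleftrightarrow> (z, w) \<in> cluster_graph E f"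
proof -
  have "(\<lambda>w. (w, g w)) ` (- F) = prod.swap ` (\<lambda>z. (z, f z)) ` (- E)"
    using gf fg f_notin g_notin by (force simp: image_iff)
  moreover have "closure (prod.swap ` X) = prod.swap ` closure X" for X :: "(complex \<times> complex) set"
  proof -
    have "linear (prod.swap :: complex \<times> complex \<Rightarrow> _)"
      by (auto intro!: linearI)
    then show ?thesis
      using closure_injective_linear_image[of prod.swap X] inj_swap by metis
  qed
  ultimately show ?thesis
    unfolding cluster_graph_def by (auto simp: image_iff intro!: bexI[of _ "(z, w)"])
qed

lemma cluster_graph_f: "z \<notin> E \<Longrightarrow> (z, f z) \<in> cluster_graph E f"
  unfolding cluster_graph_def by (intro closure_subset[THEN subsetD]) auto

lemma cluster_graph_source:
  assumes "(z, w) \<in> cluster_graph E f" "z \<notin> E"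
  shows "w = f z"
proof (rule ccontr)
  assume "w \<noteq> f z"
  then obtain A B where AB: "open A" "open B" "w \<in> A" "f z \<in> B" "A \<inter> B = {}"
    using hausdorff by metis
  have "open (- E)" using compact_source by (simp add: compact_imp_closed open_Compl)
  then have "open (- E \<inter> f -` B)"
    using continuous_open_preimage[OF cont_f] AB by blast
  then obtain x where "x \<in> - E \<inter> f -` B" "f x \<in> A"
    using cluster_graph_approx[OF assms(1) _ _ AB(1,3)] AB assms(2) by (metis ComplI IntI vimageI)
  then show False using AB by auto
qed

lemma cluster_graph_target: "(z, w) \<in> cluster_graph E f \<Longrightarrow> w \<notin> F \<Longrightarrow> z = g w"
  using complement_homeo.cluster_graph_source[OF swap] cluster_graph_swap by blast

lemma cluster_graph_iff: "(z, w) \<in> cluster_graph E f \<Longrightarrow> z \<in> E \<longleftrightarrow> w \<in> F"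
  using cluster_graph_source cluster_graph_target f_notin g_notin by metis

lemma compact_image_g: "compact J \<Longrightarrow> J \<inter> F = {} \<Longrightarrow> compact (g ` J)"
  by (rule compact_continuous_image[OF continuous_on_subset[OF cont_g]]) auto

lemma image_g_disjoint: "J \<inter> F = {} \<Longrightarrow> g ` J \<inter> E = {}"
  using g_notin by fastforce

text \<open>Removing \<open>F\<close> does not disconnect \<open>V\<close>, so \<open>g\<close> maps
  \<open>V - F\<close> into a single complementary component \<open>I\<close> of the image of
  \<open>J\<close>. Removing \<open>E\<close> does not disconnect \<open>I\<close> either, so
  \<open>f\<close> maps \<open>I - E\<close> into a connected set off \<open>J\<close>, which cannot
  leave \<open>V\<close>.\<close>

lemma matching_component:
  assumes "compact J" "J \<inter> F = {}" "V \<in> components (- J)" "V - F \<noteq> {}"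
  obtains I where "I \<in> components (- (g ` J))" "f ` (I - E) = V - F"
proof -
  define J' where "J' = g ` J"
  have J': "compact J'" "J' \<inter> E = {}"
    unfolding J'_def using assms compact_image_g image_g_disjoint by blast+
  have VJ: "V \<subseteq> - J" using assms in_components_subset by blast
  have "connected (V - F)"
    using connected_component_diff_compact[OF compact_target connected_target] assms compact_imp_closed
    by blast
  then have con: "connected (g ` (V - F))"
    by (intro connected_continuous_image continuous_on_subset[OF cont_g]) auto
  have sub: "g ` (V - F) \<subseteq> - J'"
  proof
    fix x assume "x \<in> g ` (V - F)"
    then obtain y where y: "y \<in> V" "y \<notin> F" "x = g y" by blast
    show "x \<in> - J'"
    proof
      assume "x \<in> J'"
      then obtain y' where "y' \<in> J" "g y' = g y" unfolding J'_def y by force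
      then have "y' = y" using fg y assms(2) by (metis disjoint_iff)
      then show False using \<open>y' \<in> J\<close> y VJ by blast
    qed
  qed
  obtain I where I: "I \<in> components (- J')" "g ` (V - F) \<subseteq> I"
    using exists_component_superset[OF sub _ con] assms(4) by (metis Compl_empty_eq VJ sub empty_subsetI
        image_is_empty subset_empty)
  have "connected (I - E)"
    using connected_component_diff_compact[OF compact_source connected_source _ _ I(1)] J' compact_imp_closed
    by blast
  then have conI: "connected (f ` (I - E))"
    by (intro connected_continuous_image continuous_on_subset[OF cont_f]) auto
  have "f ` (I - E) \<subseteq> - J"
  proof
    fix y assume "y \<in> f ` (I - E)"
    then obtain x where x: "x \<in> I" "x \<notin> E" "y = f x" by blast
    then have "g y = x" using gf by simp
    then show "y \<in> - J" using in_components_subset[OF I(1)] x(1) unfolding J'_def by auto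
  qed
  moreover have "V - F \<subseteq> f ` (I - E)"
    using I(2) fg g_notin by (auto simp: image_iff) (metis DiffI imageI subsetD)
  ultimately have "f ` (I - E) \<subseteq> V"
    using components_maximal[OF assms(3) conI] assms(4) by blast
  with \<open>V - F \<subseteq> f ` (I - E)\<close> f_notin have "f ` (I - E) = V - F" by auto
  with I(1) show thesis unfolding J'_def by (rule that)
qed

text \<open>These pairs play the role of corresponding basic neighbourhoods in the two quotients:
  both sets are saturated, \<open>V\<close> is as small as desired around the given component, and a
  point of the closed graph lies over \<open>I\<close> exactly when it lies over \<open>V\<close>.
  The set \<open>V\<close> is cut out by a frontier \<open>J\<close> off \<open>F\<close>, and
  \<open>I\<close> by the image of \<open>J\<close> under \<open>g\<close>.\<close>

lemma matching_nbhds: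
  assumes "v \<in> F" "open W" "connected_component_set F v \<subseteq> W"
  obtains V I where "open V" "open I" "connected_component_set F v \<subseteq> V" "V \<subseteq> W"
    "\<forall>(z, w) \<in> cluster_graph E f. z \<in> I \<longleftrightarrow> w \<in> V"
    "\<forall>z\<in>I. \<forall>z'. connected_component E z z' \<longrightarrow> z' \<in> I"
    "\<forall>w\<in>V. \<forall>w'. connected_component F w w' \<longrightarrow> w' \<in> V"
proof -
  define C where "C = connected_component_set F v"
  have C: "C \<in> components F" "C \<subseteq> W" "v \<in> C"
    using assms unfolding C_def by (auto simp: componentsI)
  obtain U where U: "open U" "bounded U" "C \<subseteq> U" "U \<subseteq> W" "frontier U \<inter> F = {}"
    using component_open_nbhd_avoiding[OF compact_target C(1) assms(2) C(2)] by metis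
  define J where "J = frontier U"
  have J: "compact J" "J \<inter> F = {}"
    unfolding J_def using U by (auto simp: compact_frontier_bounded)
  have CJ: "C \<subseteq> - J" using J in_components_subset[OF C(1)] by auto
  define V where "V = connected_component_set (- J) v"
  have V: "V \<in> components (- J)" "open V" "C \<subseteq> V"
    unfolding V_def using J C CJ in_components_connected[OF C(1)]
    using connected_component_maximal[of v C "- J"]
    by (auto simp: componentsI compact_imp_closed open_connected_component open_Compl)
  have "V \<inter> frontier U = {}"
    using V(1) in_components_subset J_def by blast
  then have "V \<subseteq> U"
    using connected_Int_frontier[of V U] in_components_connected[OF V(1)] V(3) C(3) U(3) by blast
  \<comment> \<open>Otherwise the frontier of \<open>V\<close> would lie in both \<open>J\<close>
    and \<open>F\<close>, so it would be empty and \<open>V\<close> the whole plane.\<close>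
  have "V - F \<noteq> {}"
  proof
    assume "V - F = {}"
    then have "closure V \<subseteq> F"
      using compact_target by (simp add: Diff_eq_empty_iff closure_minimal compact_imp_closed)
    moreover have "frontier V \<subseteq> J"
      using frontier_of_components_subset[OF V(1)] frontier_subset_closed[of J] J
      by (simp add: compact_imp_closed)
    ultimately have "frontier V = {}"
      using J(2) by (auto simp: frontier_def)
    then have "V = UNIV" using frontier_eq_empty[of V] V(3) C(3) by auto
    then show False using \<open>V - F = {}\<close> compact_target by (metis Diff_eq_empty_iff not_bounded_UNIV compact_imp_bounded bounded_subset)
  qed
  then obtain I where I: "I \<in> components (- (g ` J))" "f ` (I - E) = V - F"
    using matching_component[OF J V(1)] by metis
  have gJ: "compact (g ` J)" "g ` J \<inter> E = {}"
    using J compact_image_g image_g_disjoint by blast+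
  have oI: "open I"
    using open_components[OF _ I(1)] gJ by (simp add: compact_imp_closed open_Compl)
  have mem: "x \<in> I" if "x \<notin> E" "f x \<in> V" for x
  proof -
    have "f x \<in> f ` (I - E)" using that I(2) f_notin by auto
    then show ?thesis using that gf by (metis Diff_iff image_iff)
  qed
  \<comment> \<open>A point of the closed graph over \<open>I\<close> is a limit of graph points
    over \<open>V\<close>, so its second coordinate could leave \<open>V\<close> only through
    \<open>J\<close>; but over \<open>J\<close> the closed graph is the graph itself. The other
    direction is the same with the roles exchanged.\<close>
  have iff: "z \<in> I \<longleftrightarrow> w \<in> V" if zw: "(z, w) \<in> cluster_graph E f" for z w
  proof
    assume z: "z \<in> I"
    have "w \<in> closure V"
      unfolding closure_iff_nhds_not_empty
    proof (intro allI impI)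
      fix A B assume AB: "B \<subseteq> A" "w \<in> B" "open B"
      obtain x where "x \<notin> E" "x \<in> I" "f x \<in> B"
        using cluster_graph_approx[OF zw oI z AB(3,2)] .
      then show "V \<inter> A \<noteq> {}" using I(2) AB(1) by blast
    qed
    moreover have "w \<notin> J"
    proof
      assume "w \<in> J"
      then have "z = g w" using cluster_graph_target[OF zw] J(2) by blast
      then show False using \<open>w \<in> J\<close> z in_components_subset[OF I(1)] by auto
    qed
    ultimately show "w \<in> V" using in_component_if_in_closure[OF V(1)] by blast
  next
    assume w: "w \<in> V"
    have "z \<in> closure I"
      unfolding closure_iff_nhds_not_empty
    proof (intro allI impI)
      fix A B assume AB: "B \<subseteq> A" "z \<in> B" "open B"
      obtain x where "x \<notin> E" "x \<in> B" "f x \<in> V"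
        using cluster_graph_approx[OF zw AB(3,2) V(2) w] .
      then show "I \<inter> A \<noteq> {}" using mem AB(1) by blast
    qed
    moreover have "z \<notin> g ` J"
    proof
      assume "z \<in> g ` J"
      then obtain y where "y \<in> J" "z = g y" by blast
      then have "z \<notin> E" "f z \<in> J" using g_notin fg J(2) by (metis disjoint_iff)+
      then show False using cluster_graph_source[OF zw] w in_components_subset[OF V(1)] by auto
    qed
    ultimately show "z \<in> I" using in_component_if_in_closure[OF I(1)] by blast
  qed
  have sat: "x' \<in> Y" if cc: "connected_component S x x'" and "x \<in> Y" "Y \<in> components (- T)" "T \<inter> S = {}"
    for x x' :: complex and S T Y
  proof -
    obtain X where X: "connected X" "X \<subseteq> S" "x \<in> X" "x' \<in> X"
      using cc unfolding connected_component_def by blast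
    then have "X \<subseteq> Y"
      using components_maximal[OF that(3) X(1)] that by blast
    then show ?thesis using X by auto
  qed
  show thesis
    by (rule that[of V I]) (use V \<open>V \<subseteq> U\<close> U oI iff sat[OF _ _ I(1) gJ(2)] sat[OF _ _ V(1) J(2)] C_def in auto)
qed

abbreviation "rel \<equiv> cluster_rel E F f"

lemma rel_swap: "cluster_rel F E g w z \<longleftrightarrow> rel z w"
  unfolding cluster_rel_def cluster_graph_swap
  using gf fg f_notin g_notin by (metis connected_component_sym)

text \<open>A compact component has frontier points, and these are limits of points of
  \<open>- E\<close>. By \<open>proper\<close> the values of \<open>f\<close> along such a sequence
  stay bounded, so they accumulate at a finite point.\<close>

lemma cluster_graph_component_nonempty:
  assumes "z \<in> E"
  obtains u v where "connected_component E z u" "(u, v) \<in> cluster_graph E f"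
proof -
  define K where "K = connected_component_set E z"
  have K: "K \<in> components E" "z \<in> K" using assms by (auto simp: K_def componentsI)
  then have cK: "compact K" using compact_components compact_source by blast
  have "frontier K \<noteq> {}"
    using frontier_eq_empty[of K] K(2) cK compact_imp_bounded not_bounded_UNIV by auto
  then obtain u where u: "u \<in> frontier K" by blast
  then have uK: "u \<in> K" using cK by (metis compact_imp_closed frontier_subset_closed subsetD)
  have "u \<in> closure (- E)"
    using frontier_of_components_subset[OF K(1)] u frontier_complement[of E] by (auto simp: frontier_def)
  then obtain x where x: "\<And>n. x n \<in> - E" "x \<longlonglongrightarrow> u"
    using closure_sequential by metis
  have "bounded (range x)"
    using x(2) convergent_imp_bounded by blast
  then have "bounded (f ` (range x - E))" by (rule proper)
  moreover have "range (f \<circ> x) \<subseteq> f ` (range x - E)" using x(1) by auto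
  ultimately have "bounded (range (f \<circ> x))" by (rule bounded_subset)
  then obtain v r where v: "strict_mono r" "((f \<circ> x) \<circ> r) \<longlonglongrightarrow> v"
    using bounded_imp_convergent_subsequence by blast
  have "(\<lambda>n. (x (r n), f (x (r n)))) \<longlonglongrightarrow> (u, v)"
    using v LIMSEQ_subseq_LIMSEQ[OF x(2) v(1)] by (intro tendsto_Pair) (auto simp: o_def)
  then have "(u, v) \<in> cluster_graph E f"
    unfolding cluster_graph_def closure_sequential using x(1)
    by (intro exI[of _ "\<lambda>n. (x (r n), f (x (r n)))"]) simp
  with uK show thesis unfolding K_def by (intro that) auto
qed

lemma rel_total: "\<exists>w. rel z w"
proof (cases "z \<in> E")
  case True
  then obtain u v where uv: "connected_component E z u" "(u, v) \<in> cluster_graph E f"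
    using cluster_graph_component_nonempty by blast
  then have "v \<in> F" using cluster_graph_iff connected_component_in by blast
  then have "rel z v" unfolding cluster_rel_def using uv True connected_component_refl by blast
  then show ?thesis ..
qed (auto simp: cluster_rel_def)

lemma rel_onto: "\<exists>z. rel z w"
  using complement_homeo.rel_total[OF swap] rel_swap by blast

text \<open>If the two cluster values lay in different components of \<open>F\<close>, a matched
  pair could have \<open>v\<close> in \<open>V\<close> but not \<open>v'\<close>. As
  \<open>I\<close> contains the whole component of \<open>E\<close> as soon as it contains
  \<open>u\<close>, it contains \<open>u'\<close>, and then \<open>V\<close> contains
  \<open>v'\<close> after all.\<close>

lemma cluster_component:
  assumes "(u, v) \<in> cluster_graph E f" "(u', v') \<in> cluster_graph E f" "connected_component E u u'"
  shows "connected_component F v v'"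
proof (rule ccontr)
  assume neg: "\<not> connected_component F v v'"
  have in_F: "v \<in> F" "v' \<in> F"
    using assms cluster_graph_iff connected_component_in by blast+
  have opn: "open (- connected_component_set F v')"
    by (simp add: closed_connected_component compact_imp_closed compact_target open_Compl)
  have sub: "connected_component_set F v \<subseteq> - connected_component_set F v'"
    using neg connected_component_sym connected_component_trans by (metis ComplI mem_Collect_eq subsetI)
  obtain V I where VI0: "open V" "open I" and VI:
    "connected_component_set F v \<subseteq> V" "V \<subseteq> - connected_component_set F v'"
    "\<forall>(z, w) \<in> cluster_graph E f. z \<in> I \<longleftrightarrow> w \<in> V"
    "\<forall>z\<in>I. \<forall>z'. connected_component E z z' \<longrightarrow> z' \<in> I"
    "\<forall>w\<in>V. \<forall>w'. connected_component F w w' \<longrightarrow> w' \<in> V"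
    by (rule matching_nbhds[OF in_F(1) opn sub]) (rule that)
  have "v \<in> V" using VI(1) in_F by auto
  then have "v' \<in> V" using VI(3,4) assms by blast
  then show False using VI(2) in_F(2) by auto
qed

lemma rel_fibre:
  assumes "z \<in> E" "rel z w"
  shows "{w'. rel z w'} = connected_component_set F w"
proof safe
  fix w' assume "rel z w'"
  then obtain u v u' v' where h: "connected_component E z u" "connected_component F v w" "(u, v) \<in> cluster_graph E f"
    "connected_component E z u'" "connected_component F v' w'" "(u', v') \<in> cluster_graph E f"
    using assms unfolding cluster_rel_def by blast
  have "connected_component E u u'"
    using h connected_component_sym connected_component_trans by metis
  then have "connected_component F v v'"
    using cluster_component h by blast
  then show "connected_component F w w'"
    using h connected_component_sym connected_component_trans by metis
next
  fix w' assume "connected_component F w w'"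
  then show "rel z w'"
    using assms unfolding cluster_rel_def using connected_component_trans connected_component_in by metis
qed

lemma rel_in_iff: "rel z w \<Longrightarrow> z \<in> E \<longleftrightarrow> w \<in> F"
  unfolding cluster_rel_def using f_notin by blast

lemma rel_component_source: "rel z w \<Longrightarrow> connected_component E z z' \<Longrightarrow> rel z' w"
  unfolding cluster_rel_def using connected_component_sym connected_component_trans connected_component_in by metis

lemma rel_component_target: "rel z w \<Longrightarrow> connected_component F w w' \<Longrightarrow> rel z w'"
  unfolding cluster_rel_def using connected_component_trans connected_component_in f_notin by metis

lemma rel_fibre_source: "z \<notin> E \<Longrightarrow> rel z w \<longleftrightarrow> w = f z"
  by (auto simp: cluster_rel_def)

lemma connected_fibre: "connected {w. rel z w}"
proof (cases "z \<in> E")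
  case True
  with rel_total[of z] rel_fibre show ?thesis by (metis connected_connected_component)
qed (simp add: cluster_rel_def)

text \<open>Two fibres agree or are disjoint, so the relation is the graph of a bijection between
  the two quotients. This is the form in which injectivity is used below.\<close>

lemma rel_difunctional: "rel z w \<Longrightarrow> rel z w' \<Longrightarrow> rel z' w \<Longrightarrow> rel z' w'"
proof (cases "z \<in> E")
  case True
  assume "rel z w" "rel z w'" "rel z' w"
  then show ?thesis using rel_fibre[OF True] rel_component_target by blast
next
  case False
  assume "rel z w" "rel z w'" "rel z' w"
  then show ?thesis using rel_fibre_source[OF False] by auto
qed

text \<open>Upper semicontinuity of the fibres, which is continuity of the induced map of the
  quotients. At points of \<open>E\<close> it comes from matched neighbourhoods, elsewhere from
  continuity of \<open>f\<close>.\<close>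

lemma rel_usc:
  assumes "open W" "\<And>w. rel z w \<Longrightarrow> w \<in> W"
  obtains I where "open I" "z \<in> I" "\<And>z' w'. z' \<in> I \<Longrightarrow> rel z' w' \<Longrightarrow> w' \<in> W"
proof (cases "z \<in> E")
  case True
  obtain w where w: "rel z w" using rel_total by blast
  then have wF: "w \<in> F" using True rel_in_iff by blast
  have sub: "connected_component_set F w \<subseteq> W"
    using rel_fibre[OF True w] assms(2) by blast
  obtain V I where VI0: "open V" and VI: "open I" "connected_component_set F w \<subseteq> V" "V \<subseteq> W"
    "\<forall>(z, w) \<in> cluster_graph E f. z \<in> I \<longleftrightarrow> w \<in> V"
    "\<forall>z\<in>I. \<forall>z'. connected_component E z z' \<longrightarrow> z' \<in> I"
    "\<forall>w\<in>V. \<forall>w'. connected_component F w w' \<longrightarrow> w' \<in> V"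
    by (rule matching_nbhds[OF wF assms(1) sub]) (rule that)
  have iff: "z' \<in> I \<longleftrightarrow> w' \<in> V" if "rel z' w'" for z' w'
    using that unfolding cluster_rel_def
    using VI(4-6) cluster_graph_f connected_component_sym by blast
  show thesis
    by (rule that[of I]) (use VI iff w wF in auto)
next
  case False
  have "open (- E \<inter> f -` W)"
    using continuous_open_preimage[OF cont_f] assms(1) compact_source
    by (simp add: compact_imp_closed open_Compl)
  then show thesis
    by (rule that) (use False assms(2) in \<open>auto simp: rel_fibre_source\<close>)
qed

section \<open>Images of sets under the correspondence\<close>

definition "cluster_image X = {w. \<exists>z\<in>X. rel z w}"

text \<open>Upper semicontinuity of the inverse relation. The second assumption says that
  \<open>U\<close> is saturated, so the whole fibre over a point of the image lies in
  \<open>U\<close>, and with it the fibres over nearby points.\<close>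

lemma open_image:
  assumes "open U" "\<And>z z' w. rel z w \<Longrightarrow> rel z' w \<Longrightarrow> z \<in> U \<Longrightarrow> z' \<in> U"
  shows "open (cluster_image U)"
proof (subst open_subopen, safe)
  fix w assume "w \<in> cluster_image U"
  then obtain z where z: "z \<in> U" "rel z w" by (auto simp: cluster_image_def)
  obtain V where V: "open V" "w \<in> V" "\<And>w' z'. w' \<in> V \<Longrightarrow> rel z' w' \<Longrightarrow> z' \<in> U"
    using complement_homeo.rel_usc[OF swap assms(1), of w] unfolding rel_swap using assms(2) z by metis
  have "V \<subseteq> cluster_image U"
    using V(3) rel_onto unfolding cluster_image_def by blast
  with V show "\<exists>T. open T \<and> w \<in> T \<and> T \<subseteq> cluster_image U" by blast
qed

lemma closed_image:
  assumes "closed X"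
  shows "closed (cluster_image X)"
proof -
  have "open (- cluster_image X)"
  proof (subst open_subopen, safe)
    fix w assume "w \<notin> cluster_image X"
    then have "z \<in> - X" if "rel z w" for z using that by (auto simp: cluster_image_def)
    then obtain V where V: "open V" "w \<in> V" "\<And>w' z'. w' \<in> V \<Longrightarrow> rel z' w' \<Longrightarrow> z' \<in> - X"
      using complement_homeo.rel_usc[OF swap open_Compl[OF assms], of w] unfolding rel_swap by metis
    then have "V \<subseteq> - cluster_image X" by (auto simp: cluster_image_def)
    with V show "\<exists>T. open T \<and> w \<in> T \<and> T \<subseteq> - cluster_image X" by blast
  qed
  then show ?thesis by (simp add: closed_def)
qed

text \<open>Each fibre is connected, so it lies on one side of a separation of the image. The points
  whose fibre lies in a given open set form an open set, so the separation pulls back to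
  \<open>X\<close>.\<close>

lemma connected_image:
  assumes "connected X"
  shows "connected (cluster_image X)"
proof (rule connectedI)
  fix A B assume AB: "open A" "open B" "A \<inter> cluster_image X \<noteq> {}" "B \<inter> cluster_image X \<noteq> {}" "A \<inter> B \<inter> cluster_image X = {}" "cluster_image X \<subseteq> A \<union> B"
  define P where "P A = {z. \<forall>w. rel z w \<longrightarrow> w \<in> A}" for A
  have opn: "open (P A)" if A: "open A" for A
  proof (subst open_subopen, safe)
    fix z assume "z \<in> P A"
    then have "\<And>w. rel z w \<Longrightarrow> w \<in> A" by (auto simp: P_def)
    then obtain I where "open I" "z \<in> I" "\<And>z' w'. z' \<in> I \<Longrightarrow> rel z' w' \<Longrightarrow> w' \<in> A"
      using rel_usc[OF A] by metis
    then show "\<exists>T. open T \<and> z \<in> T \<and> T \<subseteq> P A"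
      by (auto simp: P_def)
  qed
  have dich: "z \<in> P A \<or> z \<in> P B" if "z \<in> X" for z
  proof -
    have "{w. rel z w} \<subseteq> cluster_image X" using that by (auto simp: cluster_image_def)
    then have "A \<inter> B \<inter> {w. rel z w} = {}" "{w. rel z w} \<subseteq> A \<union> B"
      using AB by blast+
    then have "A \<inter> {w. rel z w} = {} \<or> B \<inter> {w. rel z w} = {}"
      using connectedD[OF connected_fibre AB(1,2)] by metis
    then show ?thesis using \<open>{w. rel z w} \<subseteq> A \<union> B\<close> unfolding P_def by blast
  qed
  have disj: "\<not> (z \<in> P A \<and> z \<in> P B)" if "z \<in> X" for z
    using rel_total[of z] AB(5) that unfolding P_def cluster_image_def by blast
  have "P A \<inter> X \<noteq> {}"
    using AB(3,5) dich unfolding P_def cluster_image_def by blast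
  moreover have "P B \<inter> X \<noteq> {}"
    using AB(4,5) dich unfolding P_def cluster_image_def by blast
  ultimately show False
    using connectedD[OF assms opn[OF AB(1)] opn[OF AB(2)]] dich disj by blast
qed

text \<open>\<open>\<Sigma>\<close> is the saturation of the frontier of \<open>U\<close>. Both
  \<open>U - \<Sigma>\<close> and \<open>- closure U - \<Sigma>\<close> are open and saturated, so
  their images are open and disjoint, and they cover the complement of the image of the
  frontier.\<close>

lemma separation_by_image_of_frontier:
  assumes "open U" "z1 \<in> U - E" "z2 \<notin> closure U" "z2 \<notin> E"
  shows "\<not> connected_component (- cluster_image (frontier U)) (f z1) (f z2)"
proof
  define S where "S = frontier U"
  define \<Sigma> where "\<Sigma> = {z. \<exists>w\<in>cluster_image S. rel z w}"
  assume "connected_component (- cluster_image (frontier U)) (f z1) (f z2)"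
  then obtain X where X: "connected X" "X \<subseteq> - cluster_image S" "f z1 \<in> X" "f z2 \<in> X"
    unfolding connected_component_def S_def by blast
  have S: "closed S" by (simp add: S_def)
  interpret swapped: complement_homeo F E g f by (rule swap)
  have "\<Sigma> = swapped.cluster_image (cluster_image S)"
    unfolding \<Sigma>_def swapped.cluster_image_def rel_swap by blast
  then have \<Sigma>: "closed \<Sigma>" using closed_image[OF S] swapped.closed_image by simp
  \<comment> \<open>The fibre over \<open>w\<close> is connected, and once one of its points is off
    \<open>\<Sigma>\<close> all are. It then misses the frontier of \<open>Y\<close> and cannot
    leave \<open>Y\<close>.\<close>
  have sat: "z' \<in> Y - \<Sigma>" if "open Y" "frontier Y \<subseteq> S" "rel z w" "rel z' w" "z \<in> Y - \<Sigma>" for Y z z' w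
  proof -
    have C: "connected {z. rel z w}"
      using swapped.connected_fibre unfolding rel_swap .
    have no: "x \<notin> \<Sigma>" if "rel x w" for x
    proof
      assume "x \<in> \<Sigma>"
      then obtain w' where "w' \<in> cluster_image S" "rel x w'" by (auto simp: \<Sigma>_def)
      then have "rel z w'" using \<open>rel x w\<close> \<open>rel z w\<close> rel_difunctional by blast
      then show False using \<open>z \<in> Y - \<Sigma>\<close> \<open>w' \<in> cluster_image S\<close> by (auto simp: \<Sigma>_def)
    qed
    have "S \<subseteq> \<Sigma>" using rel_total unfolding \<Sigma>_def cluster_image_def by blast
    then have "{z. rel z w} \<inter> frontier Y = {}"
      using no \<open>frontier Y \<subseteq> S\<close> by blast
    then have "{z. rel z w} \<subseteq> Y"
      using connected_Int_frontier[OF C] that by blast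
    then show ?thesis using no that by blast
  qed
  define A where "A = cluster_image (U - \<Sigma>)"
  define B where "B = cluster_image (- closure U - \<Sigma>)"
  have fr: "frontier (- closure U) \<subseteq> S"
    unfolding S_def frontier_complement using interior_mono[OF closure_subset[of U]] by (auto simp: frontier_def)
  have A: "open A" unfolding A_def
  proof (rule open_image)
    show "open (U - \<Sigma>)" using assms(1) \<Sigma> by (simp add: open_Diff)
    show "z' \<in> U - \<Sigma>" if "rel z w" "rel z' w" "z \<in> U - \<Sigma>" for z z' w
      using sat[OF _ _ that] assms(1) S_def by simp
  qed
  have B: "open B" unfolding B_def
  proof (rule open_image)
    show "open (- closure U - \<Sigma>)" using open_Compl[OF closed_closure[of U]] \<Sigma> by (simp add: open_Diff)
    show "z' \<in> - closure U - \<Sigma>" if "rel z w" "rel z' w" "z \<in> - closure U - \<Sigma>" for z z' w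
      using sat[OF _ _ that] fr open_Compl[OF closed_closure[of U]] by simp
  qed
  have "X \<subseteq> A \<union> B"
  proof
    fix w assume w: "w \<in> X"
    obtain z where z: "rel z w" using rel_onto by blast
    have "z \<notin> \<Sigma>"
    proof
      assume "z \<in> \<Sigma>"
      then obtain w' z' where "z' \<in> S" "rel z' w'" "rel z w'" by (auto simp: \<Sigma>_def cluster_image_def)
      then have "rel z' w" using z rel_difunctional by blast
      then show False using X(2) w \<open>z' \<in> S\<close> by (auto simp: cluster_image_def)
    qed
    moreover have "z \<notin> S" using X(2) w z by (auto simp: cluster_image_def)
    ultimately show "w \<in> A \<union> B"
      using z unfolding A_def B_def cluster_image_def S_def frontier_def interior_open[OF assms(1)] by blast
  qed
  moreover have "A \<inter> B = {}"
  proof -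
    have False if "rel z w" "rel z' w" "z \<in> U - \<Sigma>" "z' \<in> - closure U - \<Sigma>" for z z' w
    proof -
      have "z' \<in> U - \<Sigma>" using sat[OF assms(1) _ that(1,2,3)] S_def by blast
      then show False using that(4) closure_subset by blast
    qed
    then show ?thesis unfolding A_def B_def cluster_image_def by blast
  qed
  moreover have "f z1 \<in> A" "f z2 \<in> B"
  proof -
    have *: "z \<in> \<Sigma> \<longleftrightarrow> f z \<in> cluster_image S" if "z \<notin> E" for z
      unfolding \<Sigma>_def using rel_fibre_source[OF that] by auto
    have "z1 \<notin> \<Sigma>" "z2 \<notin> \<Sigma>" using * assms X by blast+
    then show "f z1 \<in> A" "f z2 \<in> B"
      unfolding A_def B_def cluster_image_def using assms rel_fibre_source by blast+
  qed
  ultimately show False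
    using connectedD[OF X(1) A B] X(3,4) by blast
qed

text \<open>Suppose \<open>f z1\<close> were outside the disk. The set \<open>S\<close> lies in the
  disk and \<open>L\<close> in \<open>F\<close>, and both the disk and \<open>F\<close> have
  connected complements, so neither \<open>S\<close> nor \<open>L\<close> separates
  \<open>f z1\<close> from \<open>f z2\<close>. They meet exactly in the connected set
  \<open>N\<close>, so by Janiszewski their union does not separate either, although it contains the
  image of the frontier of \<open>U\<close>.\<close>

lemma image_of_neighbourhood_in_ball:
  assumes "open U" "p \<in> E" "z1 \<in> U - E" "z2 \<notin> closure U" "z2 \<notin> E"
    and "A = frontier U - connected_component_set E p"
    and "compact N" "connected N" "N \<subseteq> cluster_image {p}" "closure (cluster_image A) \<inter> cluster_image {p} \<subseteq> N"
    and "closure (cluster_image A) \<union> N \<subseteq> cball c \<epsilon>" "f z2 \<notin> cball c \<epsilon>"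
  shows "f z1 \<in> cball c \<epsilon>"
proof (rule ccontr)
  assume z1: "f z1 \<notin> cball c \<epsilon>"
  define L where "L = cluster_image {p}"
  define S where "S = closure (cluster_image A) \<union> N"
  have "closure (cluster_image A) \<subseteq> cball c \<epsilon>" using assms by blast
  then have 1: "compact S"
    unfolding S_def using assms(7) by (metis bounded_cball bounded_subset compact_Un compact_eq_bounded_closed closed_closure)
  have 2: "closed L" unfolding L_def by (rule closed_image) simp
  have "S \<inter> L = N" unfolding S_def L_def using assms by blast
  then have 3: "connected (S \<inter> L)" using assms by simp
  have "connected (- cball c \<epsilon>)"
    by (intro connected_complement_bounded_convex) auto
  then have 4: "connected_component (- S) (f z1) (f z2)"
    unfolding connected_component_def using assms z1 by (intro exI[of _ "- cball c \<epsilon>"]) (auto simp: S_def)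
  have "L \<subseteq> F" unfolding L_def cluster_image_def using rel_in_iff assms(2) by blast
  then have 5: "connected_component (- L) (f z1) (f z2)"
    unfolding connected_component_def using connected_target f_notin assms(3,5)
    by (intro exI[of _ "- F"]) auto
  have "connected_component (- (S \<union> L)) (f z1) (f z2)"
    by (rule Janiszewski[OF 1 2 3 4 5])
  moreover have "cluster_image (frontier U) \<subseteq> S \<union> L"
  proof
    fix w assume "w \<in> cluster_image (frontier U)"
    then obtain z where z: "z \<in> frontier U" "rel z w" by (auto simp: cluster_image_def)
    show "w \<in> S \<union> L"
    proof (cases "z \<in> A")
      case True
      then have "w \<in> cluster_image A" using z by (auto simp: cluster_image_def)
      then show ?thesis using closure_subset by (auto simp: S_def)
    next
      case False
      then have "connected_component E z p" using z assms(6) connected_component_sym by auto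
      then show ?thesis using rel_component_source z(2) unfolding L_def cluster_image_def by blast
    qed
  qed
  ultimately have "connected_component (- cluster_image (frontier U)) (f z1) (f z2)"
    using connected_component_of_subset by (metis Compl_anti_mono)
  then show False using separation_by_image_of_frontier assms by blast
qed

end

section \<open>Countable covers and level sets\<close>

lemma image_subset_interval:
  fixes u :: "'a \<Rightarrow> real"
  assumes "0 \<le> c" "\<And>x y. x \<in> A \<Longrightarrow> y \<in> A \<Longrightarrow> \<bar>u x - u y\<bar> \<le> c"
  obtains a where "u ` A \<subseteq> {a..a + c}"
proof (cases "A = {}")
  case False
  then obtain x0 where x0: "x0 \<in> A" by blast
  have bdd: "bdd_below (u ` A)"
    using assms(2)[OF x0] by (intro bdd_belowI[of _ "u x0 - c"]) (fastforce simp: abs_le_iff)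
  have "u ` A \<subseteq> {Inf (u ` A)..Inf (u ` A) + c}"
  proof
    fix t assume "t \<in> u ` A"
    then obtain x where x: "x \<in> A" "t = u x" by blast
    have "u x - c \<le> Inf (u ` A)"
      using False assms(2)[OF x(1)] by (intro cInf_greatest) (fastforce simp: abs_le_iff)+
    then show "t \<in> {Inf (u ` A)..Inf (u ` A) + c}"
      using cInf_lower[OF _ bdd, of t] x by auto
  qed
  then show thesis by (rule that)
qed (use that in auto)

text \<open>The images of the pieces under \<open>dist x\<close> are replaced by enclosing intervals
  of length \<open>c i\<close>, so no measurability of the pieces is at issue. These intervals cover
  \<open>{0..d}\<close> because \<open>X\<close> is connected.\<close>

lemma connected_dist_le_of_countable_cover:
  fixes X :: "'a::metric_space set"
  assumes "connected X" "X \<subseteq> (\<Union>i\<in>I. A i)" "countable I"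
    and "\<And>i. i \<in> I \<Longrightarrow> 0 \<le> c i"
    and "\<And>i x y. i \<in> I \<Longrightarrow> x \<in> A i \<Longrightarrow> y \<in> A i \<Longrightarrow> dist x y \<le> c i"
    and "(\<integral>\<^sup>+i. ennreal (c i) \<partial>count_space I) \<le> ennreal s" "0 \<le> s"
    and "x \<in> X" "y \<in> X"
  shows "dist x y \<le> s"
proof -
  define d where "d = dist x y"
  have "connected (dist x ` X)"
    by (intro connected_continuous_image continuous_intros assms)
  moreover have "0 \<in> dist x ` X" "d \<in> dist x ` X"
    using assms(8,9) unfolding d_def by force+
  ultimately have sub: "{0..d} \<subseteq> dist x ` X"
    by (rule connected_contains_Icc)
  have "\<exists>a. dist x ` A i \<subseteq> {a..a + c i}" if i: "i \<in> I" for i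
  proof -
    have "\<bar>dist x p - dist x q\<bar> \<le> c i" if "p \<in> A i" "q \<in> A i" for p q
      using assms(5)[OF i that] abs_dist_diff_le[of p x q] by (simp add: dist_commute)
    then show ?thesis
      using image_subset_interval[OF assms(4)[OF i], of "A i" "dist x"] by metis
  qed
  then obtain a where a: "\<And>i. i \<in> I \<Longrightarrow> dist x ` A i \<subseteq> {a i..a i + c i}"
    by metis
  have "ennreal d = emeasure lborel {0..d}" by (simp add: d_def)
  also have "\<dots> = (\<integral>\<^sup>+t. indicator {0..d} t \<partial>lborel)" by simp
  also have "\<dots> \<le> (\<integral>\<^sup>+t. (\<integral>\<^sup>+i. indicator {a i..a i + c i} t \<partial>count_space I) \<partial>lborel)"
  proof (rule nn_integral_mono)
    fix t :: real
    show "indicator {0..d} t \<le> (\<integral>\<^sup>+i. indicator {a i..a i + c i} t \<partial>count_space I)"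
    proof (cases "t \<in> {0..d}")
      case True
      then obtain i where i: "i \<in> I" "t \<in> {a i..a i + c i}"
      proof -
        obtain z where z: "z \<in> X" "t = dist x z" using True sub by blast
        then obtain i where i: "i \<in> I" "z \<in> A i" using assms(2) by blast
        then show thesis using a[OF i(1)] z(2) by (intro that[of i]) auto
      qed
      have "1 = (\<integral>\<^sup>+j. indicator {i} j \<partial>count_space I)"
        using i by (subst nn_integral_indicator) auto
      also have "\<dots> \<le> (\<integral>\<^sup>+i. indicator {a i..a i + c i} t \<partial>count_space I)"
        by (rule nn_integral_mono) (use i in \<open>auto simp: indicator_def\<close>)
      finally show ?thesis using True by simp
    qed simp
  qed
  \<comment> \<open>Tonelli for the counting measure; this is where countability of \<open>I\<close>
    is used.\<close>
  also have "\<dots> = (\<integral>\<^sup>+i. (\<integral>\<^sup>+t. indicator {a i..a i + c i} t \<partial>lborel) \<partial>count_space I)"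
    by (rule nn_integral_count_space_nn_integral) (use assms in auto)
  also have "\<dots> = (\<integral>\<^sup>+i. ennreal (c i) \<partial>count_space I)"
    by (rule nn_integral_cong) (use assms(4) in auto)
  finally have "ennreal d \<le> ennreal s" using assms(6) by simp
  then show ?thesis using assms(7) by (simp add: d_def)
qed

section \<open>Linear measure and level sets\<close>

lemma linear_measure_cover:
  fixes A :: "'a::metric_space set"
  assumes "linear_measure A < \<infinity>" "0 < \<delta>"
  obtains U :: "nat \<Rightarrow> 'a set" where "A \<subseteq> (\<Union>n. U n)" "\<And>n. bounded (U n)" "\<And>n. diameter (U n) \<le> \<delta>"
    "(\<Sum>n. ennreal (diameter (U n))) \<le> linear_measure A + 1"
proof -
  have "linear_premeasure \<delta> A \<le> linear_measure A"
    unfolding linear_measure_def using assms(2) by (intro SUP_upper) auto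
  \<comment> \<open>The added 1 makes the bound strict, so that an actual cover stays below it; only
    finiteness of the total matters later.\<close>
  also have "\<dots> < linear_measure A + 1"
    using assms(1) by (cases "linear_measure A" rule: ennreal_cases)
      (auto simp: ennreal_less_iff simp flip: ennreal_1 ennreal_plus)
  finally have "linear_premeasure \<delta> A < linear_measure A + 1" .
  then obtain U where "U \<in> {U :: nat \<Rightarrow> 'a set. A \<subseteq> (\<Union>n. U n) \<and> (\<forall>n. bounded (U n) \<and> diameter (U n) \<le> \<delta>)}"
    "(\<Sum>n. ennreal (diameter (U n))) < linear_measure A + 1"
    unfolding linear_premeasure_def INF_less_iff by blast
  then show thesis by (intro that[of U]) auto
qed

lemma infinite_ge_liminf_counting:
  fixes N :: "nat \<Rightarrow> ennreal"
  assumes "\<And>m::nat. eventually (\<lambda>k. of_nat m \<le> N k) sequentially"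
  shows "liminf N = \<infinity>"
proof (rule ccontr)
  assume "liminf N \<noteq> \<infinity>"
  then obtain m :: nat where "liminf N < of_nat m"
    using ennreal_Ex_less_of_nat[of "liminf N"] by (auto simp: less_top)
  moreover have "of_nat m \<le> liminf N"
    by (rule Liminf_bounded) (rule assms)
  ultimately show False by simp
qed

text \<open>
  Eilenberg's inequality in qualitative form: the number of pieces of a fine cover that meet the
  level of height r has a bounded integral, so by Fatou it stays bounded along a subsequence of
  finer and finer covers for almost every r.
\<close>

lemma AE_finite_level_set:
  fixes A :: "'a::metric_space set" and h :: "'a \<Rightarrow> real"
  assumes "linear_measure A < \<infinity>" "0 \<le> C"
    and "\<And>x y. x \<in> A \<Longrightarrow> y \<in> A \<Longrightarrow> \<bar>h x - h y\<bar> \<le> C * dist x y"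
  shows "AE r in lborel. finite {x \<in> A. h x = r}"
proof -
  define \<delta> where "\<delta> k = 1 / (real k + 1)" for k
  have \<delta>: "\<delta> k > 0" for k by (simp add: \<delta>_def add_pos_nonneg)
  have "\<exists>U :: nat \<Rightarrow> 'a set. A \<subseteq> (\<Union>n. U n) \<and> (\<forall>n. bounded (U n)) \<and> (\<forall>n. diameter (U n) \<le> \<delta> k) \<and>
    (\<Sum>n. ennreal (diameter (U n))) \<le> linear_measure A + 1" for k
    using linear_measure_cover[OF assms(1) \<delta>[of k]] by metis
  then obtain U :: "nat \<Rightarrow> nat \<Rightarrow> 'a set" where U: "\<And>k. A \<subseteq> (\<Union>n. U k n)" "\<And>k n. bounded (U k n)"
    "\<And>k n. diameter (U k n) \<le> \<delta> k" "\<And>k. (\<Sum>n. ennreal (diameter (U k n))) \<le> linear_measure A + 1"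
    by metis
  have dpos: "0 \<le> C * diameter (U k n)" for k n
    using assms(2) diameter_ge_0[OF U(2)] by simp
  have "\<exists>a. h ` (U k n \<inter> A) \<subseteq> {a..a + C * diameter (U k n)}" for k n
  proof -
    have "\<bar>h x - h y\<bar> \<le> C * diameter (U k n)" if "x \<in> U k n \<inter> A" "y \<in> U k n \<inter> A" for x y
    proof -
      have "\<bar>h x - h y\<bar> \<le> C * dist x y" using assms(3) that by auto
      also have "\<dots> \<le> C * diameter (U k n)"
        using diameter_bounded_bound[OF U(2), of x k n y] that assms(2) by (intro mult_left_mono) auto
      finally show ?thesis .
    qed
    then show ?thesis
      using image_subset_interval[OF dpos, of "U k n \<inter> A" h] by metis
  qed
  then obtain a where a: "\<And>k n. h ` (U k n \<inter> A) \<subseteq> {a k n..a k n + C * diameter (U k n)}"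
    by metis
  \<comment> \<open>\<open>N k r\<close> bounds from above the number of pieces of the cover of
    index \<open>k\<close> that contain a point of \<open>A\<close> at height \<open>r\<close>. As a
    sum of indicators of intervals it is measurable, whatever the pieces are.\<close>
  define N where "N k r = (\<Sum>n. indicator {a k n..a k n + C * diameter (U k n)} r :: ennreal)" for k r
  have Nm: "N k \<in> borel_measurable lborel" for k
    unfolding N_def by measurable
  have int: "(\<integral>\<^sup>+r. N k r \<partial>lborel) \<le> ennreal C * (linear_measure A + 1)" for k
  proof -
    have "(\<integral>\<^sup>+r. N k r \<partial>lborel) = (\<Sum>n. emeasure lborel {a k n..a k n + C * diameter (U k n)})"
      unfolding N_def by (subst nn_integral_suminf) auto
    also have "\<dots> = (\<Sum>n. ennreal C * ennreal (diameter (U k n)))"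
      using dpos assms(2) diameter_ge_0[OF U(2)] by (intro suminf_cong) (simp add: ennreal_mult)
    also have "\<dots> = ennreal C * (\<Sum>n. ennreal (diameter (U k n)))"
      by (rule ennreal_suminf_cmult)
    also have "\<dots> \<le> ennreal C * (linear_measure A + 1)"
      by (rule mult_left_mono[OF U(4)]) simp
    finally show ?thesis .
  qed
  have "(\<integral>\<^sup>+r. liminf (\<lambda>k. N k r) \<partial>lborel) \<le> liminf (\<lambda>k. \<integral>\<^sup>+r. N k r \<partial>lborel)"
    by (rule nn_integral_liminf) (rule Nm)
  also have "\<dots> \<le> liminf (\<lambda>k::nat. ennreal C * (linear_measure A + 1))"
    by (rule Liminf_mono) (use int in auto)
  also have "\<dots> = ennreal C * (linear_measure A + 1)"
    by (simp add: Liminf_const)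
  also have "\<dots> < \<infinity>"
    using assms(1) by (simp add: ennreal_mult_less_top)
  finally have fin: "(\<integral>\<^sup>+r. liminf (\<lambda>k. N k r) \<partial>lborel) \<noteq> \<infinity>" by simp
  have "AE r in lborel. liminf (\<lambda>k. N k r) \<noteq> \<infinity>"
    by (rule nn_integral_PInf_AE[OF _ fin]) (rule borel_measurable_liminf, rule Nm)
  then show ?thesis
  proof (rule AE_mp, intro AE_I2 impI)
    fix r :: real assume r: "liminf (\<lambda>k. N k r) \<noteq> \<infinity>"
    show "finite {x \<in> A. h x = r}"
    proof (rule ccontr)
      assume inf: "infinite {x \<in> A. h x = r}"
      have "eventually (\<lambda>k. of_nat m \<le> N k r) sequentially" for m :: nat
      proof -
        obtain B where B: "B \<subseteq> {x \<in> A. h x = r}" "finite B" "card B = m"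
          using infinite_arbitrarily_large[OF inf] by blast
        \<comment> \<open>Points of \<open>B\<close> are at least \<open>d\<close> apart, so once
          \<open>\<delta> k < d\<close> each needs a piece of its own, and \<open>N k r\<close> is
          at least \<open>m\<close>.\<close>
        obtain d where d: "d > 0" "\<And>x y. x \<in> B \<Longrightarrow> y \<in> B \<Longrightarrow> x \<noteq> y \<Longrightarrow> d \<le> dist x y"
        proof -
          let ?D = "(\<lambda>(x, y). dist x y) ` {(x, y) \<in> B \<times> B. x \<noteq> y}"
          have fin: "finite ?D" using B(2) by (auto intro: finite_subset[of _ "B \<times> B"])
          define d where "d = Min (insert 1 ?D)"
          have "d > 0" unfolding d_def using fin by (subst Min_gr_iff) auto
          moreover have "d \<le> dist x y" if "x \<in> B" "y \<in> B" "x \<noteq> y" for x y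
            unfolding d_def using fin that by (intro Min_le) auto
          ultimately show thesis by (rule that)
        qed
        have "(\<lambda>k. 1 / (real k + 1)) \<longlonglongrightarrow> 0"
          by real_asymp
        then have "eventually (\<lambda>k. \<delta> k < d) sequentially"
          unfolding \<delta>_def using d(1) by (rule order_tendstoD)
        then show ?thesis
        proof eventually_elim
          fix k assume k: "\<delta> k < d"
          have "\<exists>n. x \<in> U k n" if "x \<in> B" for x
            using U(1) that B(1) by blast
          then obtain \<nu> where \<nu>: "\<And>x. x \<in> B \<Longrightarrow> x \<in> U k (\<nu> x)" by metis
          have inj: "inj_on \<nu> B"
          proof (rule inj_onI, rule ccontr)
            fix x y assume xy: "x \<in> B" "y \<in> B" "\<nu> x = \<nu> y" "x \<noteq> y"
            have "dist x y \<le> diameter (U k (\<nu> x))"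
              using \<nu>[OF xy(1)] \<nu>[OF xy(2)] xy(3) by (intro diameter_bounded_bound U(2)) auto
            then show False using U(3)[of k "\<nu> x"] k d(2) xy by fastforce
          qed
          have "of_nat m = (\<Sum>n\<in>\<nu> ` B. 1 :: ennreal)"
            using B(3) card_image[OF inj] by simp
          also have "\<dots> \<le> (\<Sum>n\<in>\<nu> ` B. indicator {a k n..a k n + C * diameter (U k n)} r)"
          proof (rule sum_mono)
            fix n assume "n \<in> \<nu> ` B"
            then obtain x where x: "x \<in> B" "n = \<nu> x" by blast
            then have "r \<in> h ` (U k n \<inter> A)" using \<nu> B(1) by auto
            then have "r \<in> {a k n..a k n + C * diameter (U k n)}" using a by blast
            then show "1 \<le> (indicator {a k n..a k n + C * diameter (U k n)} r :: ennreal)"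
              by simp
          qed
          also have "\<dots> \<le> N k r"
            unfolding N_def by (rule sum_le_suminf) (use B(2) in auto)
          finally show "of_nat m \<le> N k r" .
        qed
      qed
      then have "liminf (\<lambda>k. N k r) = \<infinity>" by (rule infinite_ge_liminf_counting)
      then show False using r by simp
    qed
  qed
qed

lemma linear_measure_mono:
  assumes "A \<subseteq> B"
  shows "linear_measure A \<le> linear_measure B"
  unfolding linear_measure_def linear_premeasure_def
  by (intro SUP_mono' INF_superset_mono) (use assms in auto)

text \<open>The constant may depend on \<open>m\<close> because the lemma is meant for the logarithm
  of a distance, which is Lipschitz only away from the zero of that distance. Finite level sets on
  countably many pieces make a countable one.\<close>

lemma AE_countable_level_set:
  fixes A :: "'a::metric_space set" and h :: "'a \<Rightarrow> real" and B :: "nat \<Rightarrow> 'a set"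
  assumes "sigma_finite_linear_measure A" "\<And>m. 0 \<le> C m"
    and "\<And>m x y. x \<in> A \<inter> B m \<Longrightarrow> y \<in> A \<inter> B m \<Longrightarrow> \<bar>h x - h y\<bar> \<le> C m * dist x y"
  shows "AE r in lborel. countable {x \<in> A \<inter> (\<Union>m. B m). h x = r}"
proof -
  obtain E :: "nat \<Rightarrow> 'a set" where E: "A = (\<Union>n. E n)" "\<And>n. linear_measure (E n) < \<infinity>"
    using assms(1) unfolding sigma_finite_linear_measure_def by blast
  have "AE r in lborel. \<forall>n m. finite {x \<in> E n \<inter> B m. h x = r}"
    unfolding AE_all_countable
  proof (intro allI)
    fix n m
    show "AE r in lborel. finite {x \<in> E n \<inter> B m. h x = r}"
    proof (rule AE_finite_level_set[OF _ assms(2)])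
      show "linear_measure (E n \<inter> B m) < \<infinity>"
        using linear_measure_mono[of "E n \<inter> B m" "E n"] E(2)[of n] by (auto intro: order_le_less_trans)
      show "\<bar>h x - h y\<bar> \<le> C m * dist x y" if "x \<in> E n \<inter> B m" "y \<in> E n \<inter> B m" for x y
        using that E(1) by (intro assms(3)) auto
    qed
  qed
  then show ?thesis
  proof (rule AE_mp, intro AE_I2 impI)
    fix r assume "\<forall>n m. finite {x \<in> E n \<inter> B m. h x = r}"
    then have "countable (\<Union>n. \<Union>m. {x \<in> E n \<inter> B m. h x = r})"
      by (intro countable_UN) (auto intro: countable_finite)
    moreover have "(\<Union>n. \<Union>m. {x \<in> E n \<inter> B m. h x = r}) = {x \<in> A \<inter> (\<Union>m. B m). h x = r}"
      using E(1) by auto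
    ultimately show "countable {x \<in> A \<inter> (\<Union>m. B m). h x = r}" by simp
  qed
qed

text \<open>Uniform local connectedness of a Peano continuum. The parameter interval is cut into
  \<open>n\<close> parts whose images \<open>P i\<close> are small continua. Disjoint ones have
  positive distance, so a point close to \<open>c\<close> lies in a piece that meets the piece of
  \<open>c\<close>.\<close>

lemma path_image_small_connected_nbhds:
  fixes g :: "real \<Rightarrow> 'a::heine_borel"
  assumes "path g" "0 < \<epsilon>"
  obtains \<delta> where "0 < \<delta>"
    "\<And>c. c \<in> path_image g \<Longrightarrow> \<exists>N. compact N \<and> connected N \<and> N \<subseteq> path_image g \<and>
      path_image g \<inter> cball c \<delta> \<subseteq> N \<and> N \<subseteq> cball c \<epsilon>"
proof -
  have cont: "continuous_on {0..1} g" using assms(1) by (simp add: path_def)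
  then have "uniformly_continuous_on {0..1} g"
    by (rule compact_uniformly_continuous) simp
  then obtain d where d: "d > 0" "\<And>x y. x \<in> {0..1} \<Longrightarrow> y \<in> {0..1} \<Longrightarrow> dist x y < d \<Longrightarrow> dist (g x) (g y) < \<epsilon> / 2"
    using assms(2) unfolding uniformly_continuous_on_def by (metis half_gt_zero)
  obtain n :: nat where n: "n > 0" "1 / real n < d"
    using d(1) by (metis nat_approx_posE zero_less_Suc)
  define P where "P i = g ` {real i / real n..(real i + 1) / real n}" for i
  have seg: "{real i / real n..(real i + 1) / real n} \<subseteq> {0..1}" if "i < n" for i
    using that n(1) by (auto simp: field_simps intro: order_trans)
  have P: "compact (P i)" "connected (P i)" if "i < n" for i
    unfolding P_def using continuous_on_subset[OF cont seg[OF that]]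
    by (auto intro!: compact_continuous_image connected_continuous_image)
  have sub: "P i \<subseteq> path_image g" if "i < n" for i
    unfolding P_def path_image_def using seg[OF that] by blast
  have small: "dist x y \<le> \<epsilon> / 2" if asm: "i < n" "x \<in> P i" "y \<in> P i" for i x y
  proof -
    obtain s t where st: "s \<in> {real i / real n..(real i + 1) / real n}" "t \<in> {real i / real n..(real i + 1) / real n}"
      "x = g s" "y = g t" using asm unfolding P_def by blast
    have "\<bar>s - t\<bar> \<le> 1 / real n"
      using st(1,2) by (auto simp: add_divide_distrib abs_le_iff)
    then have "dist s t < d" using n(2) by (simp add: dist_real_def)
    then show ?thesis using d(2)[of s t] seg[OF asm(1)] st by (metis less_imp_le subsetD)
  qed
  have cover: "\<exists>i<n. x \<in> P i" if x: "x \<in> path_image g" for x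
  proof -
    obtain s where s: "s \<in> {0..1}" "x = g s" using x unfolding path_image_def by blast
    \<comment> \<open>The \<open>min\<close> treats the endpoint \<open>s = 1\<close>, where the
      floor gives \<open>n\<close>.\<close>
    define i where "i = min (nat \<lfloor>s * n\<rfloor>) (n - 1)"
    have i: "i < n" using n(1) by (auto simp: i_def)
    have "real i \<le> s * n"
      using s by (auto simp: i_def min_def) linarith+
    moreover have "s * n \<le> real i + 1"
    proof (cases "nat \<lfloor>s * n\<rfloor> \<le> n - 1")
      case True
      have "s * n \<le> real_of_int \<lfloor>s * n\<rfloor> + 1" by linarith
      moreover have "0 \<le> \<lfloor>s * n\<rfloor>" using s by simp
      ultimately show ?thesis using True by (simp add: i_def min_absorb1)
    next
      case False
      have "s * real n \<le> 1 * real n" using s by (intro mult_right_mono) auto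
      then show ?thesis using False n(1) by (simp add: i_def)
    qed
    ultimately have "s \<in> {real i / real n..(real i + 1) / real n}"
      using n(1) by (auto simp: field_simps)
    then show ?thesis using i s unfolding P_def by blast
  qed
  define R where "R = {(i, j) \<in> {..<n} \<times> {..<n}. P i \<inter> P j = {}}"
  have fR: "finite R" unfolding R_def by (rule finite_subset[of _ "{..<n} \<times> {..<n}"]) auto
  have "\<exists>e>0. \<forall>x\<in>P (fst q). \<forall>y\<in>P (snd q). e \<le> dist x y" if "q \<in> R" for q
  proof -
    obtain i j where ij: "q = (i, j)" "i < n" "j < n" "P i \<inter> P j = {}"
      using \<open>q \<in> R\<close> by (auto simp: R_def)
    show ?thesis
      using separate_compact_closed[OF P(1)[OF ij(2)] compact_imp_closed[OF P(1)[OF ij(3)]] ij(4)] ij(1) by simp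
  qed
  then obtain e where e: "\<And>q. q \<in> R \<Longrightarrow> e q > 0 \<and> (\<forall>x\<in>P (fst q). \<forall>y\<in>P (snd q). e q \<le> dist x y)"
    by metis
  \<comment> \<open>Half of the least lower bound \<open>e\<close> for the distances of disjoint
    pieces; the inserted 1 covers the case that there are none.\<close>
  define \<delta> where "\<delta> = Min (insert 1 (e ` R)) / 2"
  have Mpos: "Min (insert 1 (e ` R)) > 0" using fR e by (subst Min_gr_iff) auto
  then have \<delta>: "\<delta> > 0" by (simp add: \<delta>_def)
  show thesis
  proof (rule that[OF \<delta>])
    fix c assume "c \<in> path_image g"
    then obtain j where j: "j < n" "c \<in> P j" using cover by blast
    define S where "S = {i. i < n \<and> P i \<inter> P j \<noteq> {}}"
    \<comment> \<open>Each \<open>P i \<union> P j\<close> is connected because the two pieces meet,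
      and all these unions share \<open>P j\<close>.\<close>
    define N where "N = (\<Union>i\<in>S. P i \<union> P j)"
    have "compact N" unfolding N_def S_def
      using P j(1) by (intro compact_UN compact_Un) auto
    moreover have "connected N" unfolding N_def
      using P j by (intro connected_Union) (auto simp: S_def intro!: connected_Un)
    moreover have "N \<subseteq> path_image g" using sub j(1) by (auto simp: N_def S_def)
    moreover have "path_image g \<inter> cball c \<delta> \<subseteq> N"
    proof
      fix x assume x: "x \<in> path_image g \<inter> cball c \<delta>"
      then obtain i where i: "i < n" "x \<in> P i" using cover by blast
      have "P i \<inter> P j \<noteq> {}"
      proof
        assume "P i \<inter> P j = {}"
        then have R: "(i, j) \<in> R" using i j by (auto simp: R_def)
        then have "e (i, j) \<le> dist x c" using e[OF R] i j by simp
        moreover have "Min (insert 1 (e ` R)) \<le> e (i, j)" using fR R by (intro Min_le) auto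
        ultimately show False using x Mpos by (auto simp: \<delta>_def dist_commute)
      qed
      then show "x \<in> N" using i by (auto simp: N_def S_def)
    qed
    moreover have "N \<subseteq> cball c \<epsilon>"
    proof
      fix x assume "x \<in> N"
      then obtain i where i: "i < n" "P i \<inter> P j \<noteq> {}" "x \<in> P i \<or> x \<in> P j" unfolding N_def S_def by blast
      then obtain y where "y \<in> P i" "y \<in> P j" by blast
      then have "dist c y \<le> \<epsilon> / 2" "x \<in> P i \<Longrightarrow> dist y x \<le> \<epsilon> / 2" "x \<in> P j \<Longrightarrow> dist c x \<le> \<epsilon> / 2"
        using small i(1) j by blast+
      then show "x \<in> cball c \<epsilon>" using i(3) dist_triangle[of c x y] assms(2) by auto
    qed
    ultimately show "\<exists>N. compact N \<and> connected N \<and> N \<subseteq> path_image g \<and>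
      path_image g \<inter> cball c \<delta> \<subseteq> N \<and> N \<subseteq> cball c \<epsilon>" by blast
  qed
qed

section \<open>Sums over countable index sets and their tails\<close>

lemma nn_integral_count_space_Plus:
  fixes f :: "'a + 'b \<Rightarrow> ennreal"
  shows "(\<integral>\<^sup>+x. f x \<partial>count_space (A <+> B)) =
    (\<integral>\<^sup>+x. f (Inl x) \<partial>count_space A) + (\<integral>\<^sup>+y. f (Inr y) \<partial>count_space B)"
proof -
  have "(\<integral>\<^sup>+x. f x \<partial>count_space (A <+> B)) =
      (\<integral>\<^sup>+x. f x * indicator (Inl ` A) x + f x * indicator (Inr ` B) x \<partial>count_space UNIV)"
    by (subst nn_integral_count_space_indicator) (auto intro!: nn_integral_cong simp: indicator_def)
  also have "\<dots> = (\<integral>\<^sup>+x. f x \<partial>count_space (Inl ` A)) + (\<integral>\<^sup>+x. f x \<partial>count_space (Inr ` B))"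
    by (subst nn_integral_add)
      (auto simp: nn_integral_count_space_indicator[where X = "Inl ` A"] nn_integral_count_space_indicator[where X = "Inr ` B"])
  also have "(\<integral>\<^sup>+x. f x \<partial>count_space (Inl ` A)) = (\<integral>\<^sup>+x. f (Inl x) \<partial>count_space A)"
    by (rule nn_integral_bij_count_space[symmetric]) (auto simp: bij_betw_def)
  also have "(\<integral>\<^sup>+x. f x \<partial>count_space (Inr ` B)) = (\<integral>\<^sup>+x. f (Inr x) \<partial>count_space B)"
    by (rule nn_integral_bij_count_space[symmetric]) (auto simp: bij_betw_def)
  finally show ?thesis .
qed

lemma nn_integral_count_space_le_of_finite_sums:
  fixes f :: "'a \<Rightarrow> real"
  assumes "countable A" "\<And>x. x \<in> A \<Longrightarrow> 0 \<le> f x"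
    and "\<And>T. finite T \<Longrightarrow> T \<subseteq> A \<Longrightarrow> sum f T \<le> s"
  shows "(\<integral>\<^sup>+x. ennreal (f x) \<partial>count_space A) \<le> ennreal s"
proof (cases "finite A")
  case True
  then have "(\<integral>\<^sup>+x. ennreal (f x) \<partial>count_space A) = ennreal (sum f A)"
    using assms(2) by (simp add: nn_integral_count_space_finite sum_ennreal)
  then show ?thesis using assms(3)[OF True] by (simp add: ennreal_leI)
next
  case False
  have bij: "bij_betw (from_nat_into A) UNIV A"
    using assms(1) False by (rule bij_betw_from_nat_into)
  have "(\<integral>\<^sup>+x. ennreal (f x) \<partial>count_space A) = (\<Sum>i. ennreal (f (from_nat_into A i)))"
    by (simp flip: nn_integral_bij_count_space[OF bij] add: nn_integral_count_space_nat)
  also have "\<dots> \<le> ennreal s"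
  proof (rule suminf_le_const)
    fix n
    have inA: "from_nat_into A i \<in> A" for i using bij by (auto simp: bij_betw_def)
    have inj: "inj_on (from_nat_into A) {..<n}"
      using bij by (auto simp: bij_betw_def intro: inj_on_subset)
    have "(\<Sum>i<n. ennreal (f (from_nat_into A i))) = ennreal (sum f (from_nat_into A ` {..<n}))"
      using assms(2) inA by (simp add: sum_ennreal sum.reindex[OF inj])
    also have "\<dots> \<le> ennreal s"
      by (intro ennreal_leI assms(3)) (use inA in auto)
    finally show "(\<Sum>i<n. ennreal (f (from_nat_into A i))) \<le> ennreal s" .
  qed simp
  finally show ?thesis .
qed

lemma summable_on_small_tail:
  fixes f :: "'a \<Rightarrow> real"
  assumes "f summable_on A" "\<And>x. x \<in> A \<Longrightarrow> 0 \<le> f x" "0 < \<epsilon>"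
  obtains S where "finite S" "S \<subseteq> A"
    "\<And>T. finite T \<Longrightarrow> T \<subseteq> A - S \<Longrightarrow> sum f T \<le> \<epsilon>"
proof -
  obtain s where s: "(f has_sum s) A" using assms(1) by (auto simp: summable_on_def)
  obtain S where S: "finite S" "S \<subseteq> A" "dist (sum f S) s \<le> \<epsilon>"
    using has_sum_finite_approximation[OF s assms(3)] by blast
  show thesis
  proof (rule that[OF S(1,2)])
    fix T assume T: "finite T" "T \<subseteq> A - S"
    have "sum f (S \<union> T) \<le> s"
      using S T assms(2) by (intro finite_sum_le_has_sum[OF s]) auto
    moreover have "sum f (S \<union> T) = sum f S + sum f T"
      using S T by (intro sum.union_disjoint) auto
    ultimately show "sum f T \<le> \<epsilon>" using S(3) by (simp add: dist_real_def)
  qed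
qed

text \<open>Two points at maximal distance lie on the frontier: an interior point could be moved by
  \<open>e\<close> further away from the other one without leaving \<open>L\<close>.\<close>

lemma diameter_frontier_compact:
  fixes L :: "'a::euclidean_space set"
  assumes "compact L"
  shows "diameter (frontier L) = diameter L"
proof (cases "\<exists>a. L \<subseteq> {a}")
  case True
  then obtain a where "L = {} \<or> L = {a}" by blast
  then show ?thesis by (auto simp: frontier_def)
next
  case False
  then have ne: "L \<noteq> {}" by blast
  obtain x y where xy: "x \<in> L" "y \<in> L" "dist x y = diameter L"
    using diameter_compact_attained[OF assms ne] by blast
  obtain a b where ab: "a \<in> L" "b \<in> L" "a \<noteq> b" using False by blast
  have bd: "bounded L" using assms by (rule compact_imp_bounded)
  have "0 < dist a b" using ab by simp
  also have "dist a b \<le> diameter L" using diameter_bounded_bound[OF bd ab(1,2)] .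
  finally have neq: "x \<noteq> y" using xy(3) by auto
  have fr: "u \<in> frontier L" if u: "u \<in> L" "v \<in> L" "dist u v = diameter L" "u \<noteq> v" for u v
  proof (rule ccontr)
    assume "u \<notin> frontier L"
    then have "u \<in> interior L" using u(1) closure_subset by (auto simp: frontier_def)
    then obtain e where e: "e > 0" "cball u e \<subseteq> L" by (auto simp: mem_interior_cball)
    define w where "w = u + (e / norm (u - v)) *\<^sub>R (u - v)"
    have "w \<in> L" using e u(4) by (intro subsetD[OF e(2)]) (simp add: w_def dist_norm)
    have "w - v = (1 + e / norm (u - v)) *\<^sub>R (u - v)"
      by (simp add: w_def algebra_simps)
    then have "norm (w - v) = (1 + e / norm (u - v)) * norm (u - v)"
      using e(1) by simp
    also have "\<dots> = norm (u - v) + e" using u(4) by (simp add: field_simps)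
    finally have "dist w v > diameter L" using u(3) e(1) by (simp add: dist_norm)
    then show False using diameter_bounded_bound[OF bd \<open>w \<in> L\<close> u(2)] by simp
  qed
  have "x \<in> frontier L" "y \<in> frontier L"
    using fr[OF xy neq] fr[of y x] xy neq by (auto simp: dist_commute)
  moreover have sub: "frontier L \<subseteq> L"
    using assms by (simp add: compact_imp_closed frontier_subset_closed)
  ultimately have "diameter L \<le> diameter (frontier L)"
    using xy(3) diameter_bounded_bound[of "frontier L" x y] bounded_subset[OF bd sub] by simp
  moreover have "diameter (frontier L) \<le> diameter L"
    using diameter_subset[OF sub bd] .
  ultimately show ?thesis by simp
qed

text \<open>The centre \<open>p\<close> of the circle lies on the boundary of the disk. With the
  angle \<open>\<phi>\<close> measured from the outward direction \<open>p - m\<close>, expanding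
  the squared distance from \<open>m\<close> shows that a point of the circle is outside the disk
  exactly when \<open>cos \<phi> > - r / (2 * \<rho>)\<close>, and these angles form an interval
  about 0.\<close>

lemma connected_circle_minus_disk:
  fixes p m :: complex
  assumes "0 < r" "0 \<le> \<rho>" "dist p m = \<rho>"
  shows "connected (sphere p r - cball m \<rho>)"
proof (cases "\<rho> = 0")
  case True
  then have "sphere p r - cball m \<rho> = sphere p r" using assms by auto
  then show ?thesis by (simp add: connected_sphere)
next
  case False
  then have \<rho>: "\<rho> > 0" using assms by simp
  define d where "d = p - m"
  have d: "cmod d = \<rho>" using assms(3) by (simp add: d_def dist_norm)
  have d0: "d \<noteq> 0" using d \<rho> by auto
  define s where "s = - r / (2 * \<rho>)"
  define X where "X = {\<phi> \<in> {- pi..pi}. s < cos \<phi>}"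
  define \<gamma> where "\<gamma> \<phi> = p + (r / \<rho>) *\<^sub>R (d * cis \<phi>)" for \<phi>
  have "is_interval X"
    unfolding is_interval_1
  proof (intro ballI allI impI)
    fix a b x assume h: "a \<in> X" "b \<in> X" "a \<le> x \<and> x \<le> b"
    define M where "M = max \<bar>a\<bar> \<bar>b\<bar>"
    have "s < cos M" "M \<le> pi" "\<bar>x\<bar> \<le> M"
      using h by (auto simp: X_def M_def max_def abs_le_iff cos_abs_real)
    then have "cos M \<le> cos \<bar>x\<bar>" by (intro cos_monotone_0_pi_le) auto
    then show "x \<in> X" using \<open>s < cos M\<close> h by (auto simp: X_def)
  qed
  then have "connected X" by (simp add: is_interval_connected)
  then have con: "connected (\<gamma> ` X)"
    unfolding \<gamma>_def cis_conv_exp by (intro connected_continuous_image continuous_intros) auto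
  have sq: "(1 + a * x)\<^sup>2 + (a * y)\<^sup>2 = 1 + 2 * a * x + a\<^sup>2 * (y\<^sup>2 + x\<^sup>2)" for a x y :: real
    by (simp add: power2_eq_square algebra_simps)
  have iff: "\<gamma> \<phi> \<notin> cball m \<rho> \<longleftrightarrow> s < cos \<phi>" for \<phi>
  proof -
    have "\<gamma> \<phi> - m = d * (1 + complex_of_real (r / \<rho>) * cis \<phi>)"
    proof -
      have "\<gamma> \<phi> - m = d + complex_of_real (r / \<rho>) * (d * cis \<phi>)"
        by (simp add: \<gamma>_def d_def scaleR_conv_of_real)
      then show ?thesis by (simp only: distrib_left mult_1_right mult.left_commute)
    qed
    then have "cmod (\<gamma> \<phi> - m) = \<rho> * cmod (1 + complex_of_real (r / \<rho>) * cis \<phi>)"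
      by (simp add: norm_mult d)
    then have "\<gamma> \<phi> \<notin> cball m \<rho> \<longleftrightarrow> 1 < cmod (1 + complex_of_real (r / \<rho>) * cis \<phi>)"
      using \<rho> by (simp add: dist_norm norm_minus_commute not_le)
    also have "\<dots> \<longleftrightarrow> 1\<^sup>2 < (cmod (1 + complex_of_real (r / \<rho>) * cis \<phi>))\<^sup>2"
      by (meson norm_ge_zero power2_less_imp_less power_strict_mono zero_le_one zero_less_numeral)
    also have "(cmod (1 + complex_of_real (r / \<rho>) * cis \<phi>))\<^sup>2 =
        (1 + r / \<rho> * cos \<phi>)\<^sup>2 + (r / \<rho> * sin \<phi>)\<^sup>2"
      by (simp add: cmod_power2)
    also have "\<dots> = 1 + 2 * (r / \<rho>) * cos \<phi> + (r / \<rho>)\<^sup>2 * ((sin \<phi>)\<^sup>2 + (cos \<phi>)\<^sup>2)"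
      using sq .
    also have "1\<^sup>2 < \<dots> \<longleftrightarrow> 0 < (r / \<rho>) * (2 * cos \<phi> + r / \<rho>)"
      by (simp add: power2_eq_square algebra_simps)
    also have "\<dots> \<longleftrightarrow> 0 < 2 * cos \<phi> + r / \<rho>"
      using divide_pos_pos[OF assms(1) \<rho>] by (meson mult_pos_pos zero_less_mult_pos)
    also have "\<dots> \<longleftrightarrow> s < cos \<phi>" using \<rho> by (simp add: s_def field_simps) linarith
    finally show ?thesis .
  qed
  have "sphere p r - cball m \<rho> = \<gamma> ` X"
  proof
    show "\<gamma> ` X \<subseteq> sphere p r - cball m \<rho>"
    proof
      fix z assume "z \<in> \<gamma> ` X"
      then obtain \<phi> where \<phi>: "\<phi> \<in> X" "z = \<gamma> \<phi>" by blast
      have "dist p z = r"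
        using assms(1) \<rho> by (simp add: \<phi>(2) \<gamma>_def dist_norm norm_mult d)
      then show "z \<in> sphere p r - cball m \<rho>" using iff[of \<phi>] \<phi> by (simp add: X_def)
    qed
    show "sphere p r - cball m \<rho> \<subseteq> \<gamma> ` X"
    proof
      fix z assume z: "z \<in> sphere p r - cball m \<rho>"
      define u where "u = (z - p) / ((r / \<rho>) *\<^sub>R d)"
      have "cmod u = 1"
        using z assms(1) \<rho> by (simp add: u_def norm_divide d dist_norm norm_minus_commute)
      then have "u = cis (Arg u)"
        using cis_Arg[of u] by (cases "u = 0") (auto simp: sgn_eq)
      moreover have "z = p + (r / \<rho>) *\<^sub>R (d * u)"
        using assms(1) \<rho> d0 by (simp add: u_def scaleR_conv_of_real)
      ultimately have "z = \<gamma> (Arg u)" by (simp add: \<gamma>_def)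
      moreover have "Arg u \<in> X"
        using iff[of "Arg u"] z \<open>z = \<gamma> (Arg u)\<close> Arg_bounded[of u] by (auto simp: X_def)
      ultimately show "z \<in> \<gamma> ` X" by blast
    qed
  qed
  with con show ?thesis by simp
qed

section \<open>Length and area\<close>

lemma continuous_vector2: "continuous_on UNIV (\<lambda>(x, y). vector [x, y] :: real^2)"
proof -
  have "linear (\<lambda>(x, y). vector [x, y] :: real^2)"
    by (intro linearI) (auto simp: vec_eq_iff forall_2)
  then show ?thesis by (simp add: linear_continuous_on linear_conv_bounded_linear)
qed

lemma measurable_vector2:
  "(\<lambda>(x, y). vector [x, y] :: real^2) \<in> measurable (lborel \<Otimes>\<^sub>M lborel) borel"
  using borel_measurable_continuous_onI[OF continuous_vector2] by (simp add: borel_prod lborel_prod)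

text \<open>The area formula is applied in its determinant form on \<open>real^2\<close>, while
  slices need iterated integrals over two real variables; this identification of Lebesgue measures
  connects the two.\<close>

lemma lborel_vec2:
  "lborel = distr (lborel \<Otimes>\<^sub>M lborel) borel (\<lambda>(x, y). vector [x, y] :: real^2)"
proof (rule lborel_eqI)
  fix l u :: "real^2"
  assume lu: "\<And>b. b \<in> Basis \<Longrightarrow> l \<bullet> b \<le> u \<bullet> b"
  have le: "l $ 1 \<le> u $ 1" "l $ 2 \<le> u $ 2"
    using lu[of "axis 1 1"] lu[of "axis 2 1"] by (auto simp: axis_in_Basis_iff inner_axis)
  have vimage: "(\<lambda>(x, y). vector [x, y] :: real^2) -` box l u = box (l $ 1) (u $ 1) \<times> box (l $ 2) (u $ 2)"
    by (auto simp: mem_box_cart forall_2)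
  have "emeasure (distr (lborel \<Otimes>\<^sub>M lborel) borel (\<lambda>(x, y). vector [x, y] :: real^2)) (box l u) =
      emeasure (lborel \<Otimes>\<^sub>M lborel) (box (l $ 1) (u $ 1) \<times> box (l $ 2) (u $ 2))"
    by (subst emeasure_distr[OF measurable_vector2]) (auto simp: vimage space_pair_measure)
  also have "\<dots> = ennreal ((u $ 1 - l $ 1) * (u $ 2 - l $ 2))"
    using le by (simp add: lborel.emeasure_pair_measure_Times box_real ennreal_mult)
  also have "(u $ 1 - l $ 1) * (u $ 2 - l $ 2) = (\<Prod>b\<in>Basis. (u - l) \<bullet> b)"
  proof -
    have B: "(Basis :: (real^2) set) = {axis 1 1, axis 2 1}"
      by (auto simp: Basis_vec_def UNIV_2)
    show ?thesis unfolding B by (simp add: axis_eq_axis inner_axis)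
  qed
  finally show "emeasure (distr (lborel \<Otimes>\<^sub>M lborel) borel (\<lambda>(x, y). vector [x, y] :: real^2)) (box l u) =
      ennreal (\<Prod>b\<in>Basis. (u - l) \<bullet> b)" .
qed simp

lemma nn_integral_vec2:
  assumes "F \<in> borel_measurable borel"
  shows "(\<integral>\<^sup>+v. F v \<partial>(lborel :: (real^2) measure)) = (\<integral>\<^sup>+x. \<integral>\<^sup>+y. F (vector [x, y]) \<partial>lborel \<partial>lborel)"
proof -
  have "(\<integral>\<^sup>+v. F v \<partial>(lborel :: (real^2) measure)) =
      (\<integral>\<^sup>+p. F (case p of (x, y) \<Rightarrow> vector [x, y]) \<partial>(lborel \<Otimes>\<^sub>M lborel))"
    by (subst lborel_vec2, subst nn_integral_distr[OF measurable_vector2]) (use assms in auto)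
  also have "\<dots> = (\<integral>\<^sup>+x. \<integral>\<^sup>+y. F (vector [x, y]) \<partial>lborel \<partial>lborel)"
    using measurable_compose[OF measurable_vector2 assms]
    by (subst lborel.nn_integral_fst[symmetric]) auto
  finally show ?thesis .
qed

text \<open>Since \<open>k\<close> is arbitrary off \<open>W\<close>, measurability is first
  obtained for its extension by 0.\<close>

lemma borel_measurable_indicator_norm_power:
  fixes k :: "'a::topological_space \<Rightarrow> 'b::real_normed_vector"
  assumes "open W" "continuous_on W k"
  shows "(\<lambda>x. indicator W x * ennreal (norm (k x) ^ n)) \<in> borel_measurable borel"
proof -
  have [measurable]: "W \<in> sets borel" using assms(1) by simp
  have [measurable]: "(\<lambda>x. indicator W x *\<^sub>R k x) \<in> borel_measurable borel"
    using assms by (intro borel_measurable_continuous_on_indicator) auto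
  have "(\<lambda>x. indicator W x * ennreal (norm (indicator W x *\<^sub>R k x) ^ n)) \<in> borel_measurable borel"
    by measurable
  also have "(\<lambda>x. indicator W x * ennreal (norm (indicator W x *\<^sub>R k x) ^ n)) =
      (\<lambda>x. indicator W x * ennreal (norm (k x) ^ n))"
    by (auto simp: indicator_def)
  finally show ?thesis .
qed

text \<open>By the Cauchy-Riemann equations the Jacobian determinant of \<open>h\<close> is the
  square of the modulus of its derivative, so for injective \<open>h\<close> the integral is the
  area of the image of \<open>W\<close>, a bounded open set.\<close>

lemma area_integral_finite:
  assumes "open W" "h holomorphic_on W" "inj_on h W" "bounded (h ` W)"
  shows "(\<integral>\<^sup>+t. \<integral>\<^sup>+\<theta>. indicator W (Complex t \<theta>) * ennreal ((cmod (deriv h (Complex t \<theta>)))\<^sup>2)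
    \<partial>lborel \<partial>lborel) < \<infinity>"
proof -
  define to_c :: "real^2 \<Rightarrow> complex" where "to_c v = Complex (v $ 1) (v $ 2)" for v
  define of_c :: "complex \<Rightarrow> real^2" where "of_c z = vector [Re z, Im z]" for z
  have inv: "to_c (of_c z) = z" "of_c (to_c v) = v" for z v
    by (auto simp: to_c_def of_c_def vec_eq_iff forall_2)
  have lin_to: "bounded_linear to_c"
    unfolding to_c_def by (intro linear_conv_bounded_linear[THEN iffD1] linearI) (auto simp: complex_eq_iff)
  have lin_of: "bounded_linear of_c"
    unfolding of_c_def
    by (intro linear_conv_bounded_linear[THEN iffD1] linearI) (auto simp: vec_eq_iff forall_2)
  define S where "S = to_c -` W"
  define H where "H = (\<lambda>v. of_c (h (to_c v)))"
  define H' where "H' v = (\<lambda>d. of_c (deriv h (to_c v) * to_c d))" for v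
  have oS: "open S" unfolding S_def
    using open_vimage[OF assms(1)] linear_continuous_on[OF lin_to] by blast
  have H': "(H has_derivative H' v) (at v within S)" if "v \<in> S" for v
  proof -
    have "(h has_field_derivative deriv h (to_c v)) (at (to_c v))"
      using holomorphic_derivI[OF assms(2,1)] that by (simp add: S_def)
    then have "(h has_derivative (*) (deriv h (to_c v))) (at (to_c v))"
      by (simp add: has_field_derivative_def)
    then have "((\<lambda>v. h (to_c v)) has_derivative (\<lambda>d. deriv h (to_c v) * to_c d)) (at v within S)"
      by (rule has_derivative_compose[OF bounded_linear_imp_has_derivative[OF lin_to]])
    then show ?thesis unfolding H_def H'_def
      by (rule bounded_linear.has_derivative[OF lin_of])
  qed
  have injH: "inj_on H S"
    using assms(3) unfolding H_def S_def inj_on_def by (metis inv vimageE)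
  have det: "\<bar>det (matrix (H' v))\<bar> = (cmod (deriv h (to_c v)))\<^sup>2" for v
    unfolding det_2 matrix_def H'_def to_c_def of_c_def cmod_power2
    by (simp add: axis_def power2_eq_square)
  have HS: "H ` S = to_c -` (h ` W)"
  proof
    show "H ` S \<subseteq> to_c -` (h ` W)" unfolding H_def S_def using inv by auto
    show "to_c -` (h ` W) \<subseteq> H ` S"
    proof
      fix v assume "v \<in> to_c -` (h ` W)"
      then obtain z where z: "z \<in> W" "to_c v = h z" by auto
      then have "v = H (of_c z)" "of_c z \<in> S" unfolding H_def S_def using inv by (metis, simp)
      then show "v \<in> H ` S" by blast
    qed
  qed
  have "open (h ` W)" using open_mapping_thm3 assms by blast
  then have "open (H ` S)" unfolding HS
    using open_vimage linear_continuous_on[OF lin_to] by blast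
  moreover have "bounded (H ` S)"
  proof -
    have "H ` S \<subseteq> of_c ` (h ` W)" unfolding H_def S_def by auto
    then show ?thesis using bounded_linear_image[OF assms(4) lin_of] bounded_subset by blast
  qed
  ultimately have "H ` S \<in> lmeasurable" by (simp add: lmeasurable_open)
  then have "(\<lambda>v. \<bar>det (matrix (H' v))\<bar>) integrable_on S"
    using measurable_differentiable_image_eq[OF _ H' injH] oS by (simp add: borel_open sets_completionI_sets)
  then obtain I where "((\<lambda>v. (cmod (deriv h (to_c v)))\<^sup>2) has_integral I) S"
    unfolding det integrable_on_def by blast
  then have "(\<integral>\<^sup>+v. ennreal (indicator S v * (cmod (deriv h (to_c v)))\<^sup>2) \<partial>lborel) = ennreal I"
    by (intro nn_integral_has_integral_lebesgue) auto
  also have "(\<lambda>v. ennreal (indicator S v * (cmod (deriv h (to_c v)))\<^sup>2)) =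
      (\<lambda>v. indicator W (to_c v) * ennreal ((cmod (deriv h (to_c v)))\<^sup>2))"
    by (auto simp: S_def indicator_def)
  finally have fin: "(\<integral>\<^sup>+v. indicator W (to_c v) * ennreal ((cmod (deriv h (to_c v)))\<^sup>2) \<partial>lborel) = ennreal I" .
  have "continuous_on W (deriv h)"
    using holomorphic_deriv[OF assms(2,1)] by (rule holomorphic_on_imp_continuous_on)
  moreover have "to_c \<in> measurable borel borel"
    using linear_continuous_on[OF lin_to] by (rule borel_measurable_continuous_onI)
  ultimately have "(\<lambda>v. indicator W (to_c v) * ennreal ((cmod (deriv h (to_c v)))\<^sup>2)) \<in> borel_measurable borel"
    using measurable_compose borel_measurable_indicator_norm_power[OF assms(1)] by blast
  then show ?thesis
    using nn_integral_vec2 fin by (simp add: to_c_def)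
qed

text \<open>
  Instead of the Cauchy-Schwarz inequality, the length of a slice is compared with its share of
  the area through \<open>x \<le> \<delta> + x^2 / (4 \<delta>)\<close>.
\<close>

lemma short_slice_exists:
  assumes "open W" "h holomorphic_on W" "inj_on h W" "bounded (h ` W)"
    and strip: "\<And>z. z \<in> W \<Longrightarrow> \<bar>Im z\<bar> < pi"
    and P: "AE t in lborel. P t" and "0 < \<epsilon>"
  obtains t where "t < T" "P t"
    "(\<integral>\<^sup>+\<theta>. indicator W (Complex t \<theta>) * ennreal (cmod (deriv h (Complex t \<theta>))) \<partial>lborel) \<le> ennreal \<epsilon>"
proof -
  define q where "q t = (\<integral>\<^sup>+\<theta>. indicator W (Complex t \<theta>) * ennreal ((cmod (deriv h (Complex t \<theta>)))\<^sup>2) \<partial>lborel)" for t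
  \<comment> \<open>On a slice of length at most \<open>2 * pi\<close> the constant term contributes
    at most \<open>2 * pi * \<delta> = \<epsilon> / 2\<close>; a share of the area of at most
    \<open>\<eta> = 2 * \<delta> * \<epsilon>\<close> contributes at most
    \<open>\<eta> / (4 * \<delta>) = \<epsilon> / 2\<close>.\<close>
  define \<delta> where "\<delta> = \<epsilon> / (4 * pi)"
  have \<delta>: "\<delta> > 0" using assms(7) by (simp add: \<delta>_def)
  define \<eta> where "\<eta> = 2 * \<delta> * \<epsilon>"
  have \<eta>: "\<eta> > 0" using \<delta> assms(7) by (simp add: \<eta>_def)
  obtain Q where Q: "Q \<ge> 0" "(\<integral>\<^sup>+t. q t \<partial>lborel) = ennreal Q"
  proof -
    have "(\<integral>\<^sup>+t. q t \<partial>lborel) < \<infinity>"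
      using area_integral_finite[OF assms(1-4)] by (simp add: q_def)
    then show thesis
      using that by (cases "\<integral>\<^sup>+t. q t \<partial>lborel" rule: ennreal_cases) auto
  qed
  \<comment> \<open>Otherwise the share of the area exceeds \<open>\<eta>\<close> almost everywhere
    on a half-line, and a stretch of length \<open>n\<close> already has more than the total area
    \<open>Q\<close>.\<close>
  have "\<exists>t<T. P t \<and> q t \<le> ennreal \<eta>"
  proof (rule ccontr)
    assume neg: "\<not> (\<exists>t<T. P t \<and> q t \<le> ennreal \<eta>)"
    obtain n :: nat where n: "Q < \<eta> * real n"
      using \<eta> by (metis reals_Archimedean3 mult.commute)
    have "ennreal (\<eta> * real n) = (\<integral>\<^sup>+t. ennreal \<eta> * indicator {T - real n..<T} t \<partial>lborel)"
      using \<eta> by (subst nn_integral_cmult_indicator) (auto simp: ennreal_mult)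
    also have "\<dots> \<le> (\<integral>\<^sup>+t. q t \<partial>lborel)"
      by (rule nn_integral_mono_AE, rule AE_mp[OF P], intro AE_I2 impI)
        (use neg in \<open>auto simp: indicator_def not_le intro: less_imp_le\<close>)
    finally show False using n Q(1) unfolding Q(2) by (simp add: ennreal_le_iff2)
  qed
  then obtain t where t: "t < T" "P t" "q t \<le> ennreal \<eta>" by blast
  have meas: "(\<lambda>\<theta>. indicator W (Complex t \<theta>) * ennreal ((cmod (deriv h (Complex t \<theta>)))\<^sup>2)) \<in> borel_measurable lborel"
  proof -
    have "continuous_on W (deriv h)"
      using holomorphic_deriv[OF assms(2,1)] by (rule holomorphic_on_imp_continuous_on)
    moreover have "(\<lambda>\<theta>. Complex t \<theta>) \<in> measurable borel borel"
      by (intro borel_measurable_continuous_onI) (auto simp: Complex_eq intro!: continuous_intros)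
    ultimately have "(\<lambda>\<theta>. indicator W (Complex t \<theta>) * ennreal ((cmod (deriv h (Complex t \<theta>)))\<^sup>2)) \<in> borel_measurable borel"
      using measurable_compose borel_measurable_indicator_norm_power[OF assms(1)] by blast
    then show ?thesis by simp
  qed
  have amgm: "x \<le> \<delta> + x\<^sup>2 / (4 * \<delta>)" for x :: real
  proof -
    have "0 \<le> (x - 2 * \<delta>)\<^sup>2 / (4 * \<delta>)" using \<delta> by simp
    also have "\<dots> = x\<^sup>2 / (4 * \<delta>) - x + \<delta>"
      using \<delta> by (simp add: field_simps power2_eq_square)
    finally show ?thesis by simp
  qed
  have "(\<integral>\<^sup>+\<theta>. indicator W (Complex t \<theta>) * ennreal (cmod (deriv h (Complex t \<theta>))) \<partial>lborel)
    \<le> (\<integral>\<^sup>+\<theta>. ennreal \<delta> * indicator {- pi..pi} \<theta> +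
        ennreal (1 / (4 * \<delta>)) * (indicator W (Complex t \<theta>) * ennreal ((cmod (deriv h (Complex t \<theta>)))\<^sup>2)) \<partial>lborel)"
  proof (rule nn_integral_mono)
    fix \<theta> :: real
    show "indicator W (Complex t \<theta>) * ennreal (cmod (deriv h (Complex t \<theta>))) \<le>
      ennreal \<delta> * indicator {- pi..pi} \<theta> +
        ennreal (1 / (4 * \<delta>)) * (indicator W (Complex t \<theta>) * ennreal ((cmod (deriv h (Complex t \<theta>)))\<^sup>2))"
    proof (cases "Complex t \<theta> \<in> W")
      case True
      then have "\<theta> \<in> {- pi..pi}" using strip[OF True] by (auto simp: abs_less_iff)
      moreover have "ennreal (cmod (deriv h (Complex t \<theta>))) \<le>
          ennreal \<delta> + ennreal (1 / (4 * \<delta>)) * ennreal ((cmod (deriv h (Complex t \<theta>)))\<^sup>2)"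
        using amgm[of "cmod (deriv h (Complex t \<theta>))"] \<delta>
        by (simp flip: ennreal_mult ennreal_plus add: ennreal_leI)
      ultimately show ?thesis using True by simp
    qed simp
  qed
  also have "\<dots> = ennreal \<delta> * ennreal (2 * pi) + ennreal (1 / (4 * \<delta>)) * q t"
    unfolding q_def using meas \<delta>
    by (subst nn_integral_add) (auto simp: nn_integral_cmult nn_integral_cmult_indicator)
  also have "\<dots> \<le> ennreal \<delta> * ennreal (2 * pi) + ennreal (1 / (4 * \<delta>)) * ennreal \<eta>"
    by (intro add_left_mono mult_left_mono t) simp
  also have "\<dots> = ennreal (\<delta> * (2 * pi) + 1 / (4 * \<delta>) * \<eta>)"
    using \<delta> \<eta> by (simp flip: ennreal_mult ennreal_plus)
  also have "\<delta> * (2 * pi) + 1 / (4 * \<delta>) * \<eta> = \<epsilon>"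
    using \<delta> by (simp add: \<eta>_def \<delta>_def)
  finally show thesis by (rule that[OF t(1,2)])
qed

section \<open>Lengths of the arcs of a slice\<close>

lemma countable_components_of_open:
  fixes S :: "'a::euclidean_space set"
  assumes "open S"
  shows "countable (components S)"
proof (rule countable_disjoint_open_subsets)
  show "open C" if "C \<in> components S" for C
    using open_components[OF assms that] .
  show "disjoint (components S)"
    using pairwise_disjoint_components[of S] by (simp add: pairwise_def disjnt_def)
qed

text \<open>\<open>c C\<close> is the length of the curve \<open>k\<close> over the interval
  \<open>C\<close>. It bounds distances by the fundamental theorem of calculus, and the lengths add
  up to at most the total because the components are disjoint.\<close>

lemma arc_lengths:
  fixes k :: "real \<Rightarrow> 'a::euclidean_space"
  assumes "open \<Theta>" "\<And>x. x \<in> \<Theta> \<Longrightarrow> (k has_vector_derivative k' x) (at x)" "continuous_on \<Theta> k'"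
    and fin: "(\<integral>\<^sup>+x. indicator \<Theta> x * ennreal (norm (k' x)) \<partial>lborel) \<le> ennreal s"
  obtains c where "\<forall>C\<in>components \<Theta>. 0 \<le> c C \<and> (\<forall>x\<in>C. \<forall>y\<in>C. dist (k x) (k y) \<le> c C)"
    "(\<integral>\<^sup>+C. ennreal (c C) \<partial>count_space (components \<Theta>)) \<le> ennreal s"
proof -
  define \<mu> where "\<mu> X = (\<integral>\<^sup>+x. indicator X x * ennreal (norm (k' x)) \<partial>lborel)" for X
  define c where "c X = enn2real (\<mu> X)" for X
  have sub: "C \<subseteq> \<Theta>" "open C" "connected C" if "C \<in> components \<Theta>" for C
    using that in_components_subset open_components[OF assms(1)] in_components_connected by blast+
  have mono: "\<mu> X \<le> \<mu> Y" if "X \<subseteq> Y" for X Y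
    unfolding \<mu>_def by (rule nn_integral_mono) (use that in \<open>auto simp: indicator_def\<close>)
  have \<mu>c: "\<mu> X = ennreal (c X)" if "X \<subseteq> \<Theta>" for X
  proof -
    have "\<mu> X \<le> ennreal s" using mono[OF that] fin unfolding \<mu>_def by (rule order_trans)
    then have "\<mu> X < top" using ennreal_less_top order_le_less_trans by blast
    then show ?thesis by (simp add: c_def)
  qed
  have dist_le: "dist (k x) (k y) \<le> c C" if C: "C \<in> components \<Theta>" and xy: "x \<in> C" "y \<in> C" "x \<le> y" for C x y
  proof -
    have seg: "{x..y} \<subseteq> C"
      using connected_contains_Icc[OF sub(3)[OF C]] xy by blast
    then have seg': "{x..y} \<subseteq> \<Theta>" using sub(1)[OF C] by blast
    have 1: "(k' has_integral k y - k x) {x..y}"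
    proof (rule fundamental_theorem_of_calculus[OF xy(3)])
      fix t assume "t \<in> {x..y}"
      then show "(k has_vector_derivative k' t) (at t within {x..y})"
        using has_vector_derivative_at_within assms(2) seg' by blast
    qed
    have "(\<lambda>t. norm (k' t)) integrable_on {x..y}"
      using continuous_on_subset[OF assms(3) seg'] by (intro integrable_continuous_real continuous_intros)
    then obtain J where J: "((\<lambda>t. norm (k' t)) has_integral J) {x..y}"
      unfolding integrable_on_def by blast
    have "norm (k y - k x) \<le> J"
      using integral_norm_bound_integral[of k' "{x..y}" "\<lambda>t. norm (k' t)"] 1 J
      by (simp add: integral_unique has_integral_integrable)
    moreover have "ennreal J \<le> ennreal (c C)"
    proof -
      have "ennreal J = (\<integral>\<^sup>+t. ennreal (indicator {x..y} t * norm (k' t)) \<partial>lborel)"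
        using J by (intro nn_integral_has_integral_lebesgue[symmetric]) auto
      also have "\<dots> = \<mu> {x..y}" unfolding \<mu>_def by (intro nn_integral_cong) (auto simp: indicator_def)
      also have "\<dots> \<le> \<mu> C" by (rule mono[OF seg])
      finally show ?thesis using \<mu>c[OF sub(1)[OF C]] by simp
    qed
    then have "J \<le> c C" by (simp add: ennreal_le_iff c_def)
    ultimately show ?thesis by (simp add: dist_norm norm_minus_commute)
  qed
  have "(\<integral>\<^sup>+C. ennreal (c C) \<partial>count_space (components \<Theta>)) = (\<integral>\<^sup>+C. \<mu> C \<partial>count_space (components \<Theta>))"
    by (intro nn_integral_cong) (use \<mu>c sub in auto)
  also have "\<dots> = (\<integral>\<^sup>+x. \<integral>\<^sup>+C. indicator C x * ennreal (norm (k' x)) \<partial>count_space (components \<Theta>) \<partial>lborel)"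
    unfolding \<mu>_def
  proof (rule sym, rule nn_integral_count_space_nn_integral)
    show "countable (components \<Theta>)" by (rule countable_components_of_open[OF assms(1)])
    fix C assume C: "C \<in> components \<Theta>"
    show "(\<lambda>x. indicator C x * ennreal (norm (k' x))) \<in> borel_measurable lborel"
      using borel_measurable_indicator_norm_power[OF sub(2)[OF C] continuous_on_subset[OF assms(3) sub(1)[OF C]], of 1]
      by simp
  qed
  also have "\<dots> \<le> (\<integral>\<^sup>+x. indicator \<Theta> x * ennreal (norm (k' x)) \<partial>lborel)"
  proof (rule nn_integral_mono)
    fix x :: real
    \<comment> \<open>At most one component contains \<open>x\<close>, so the inner sum has at most
      one non-zero term.\<close>
    define C0 where "C0 = connected_component_set \<Theta> x"
    have "(\<integral>\<^sup>+C. indicator C x * ennreal (norm (k' x)) \<partial>count_space (components \<Theta>)) \<le>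
        (\<integral>\<^sup>+C. (indicator \<Theta> x * ennreal (norm (k' x))) * indicator {C0} C \<partial>count_space (components \<Theta>))"
    proof (rule nn_integral_mono)
      fix C assume "C \<in> space (count_space (components \<Theta>))"
      then have C: "C \<in> components \<Theta>" by simp
      show "indicator C x * ennreal (norm (k' x)) \<le> (indicator \<Theta> x * ennreal (norm (k' x))) * indicator {C0} C"
      proof (cases "x \<in> C")
        case True
        then have "x \<in> \<Theta>" "C = C0"
        proof -
          show "x \<in> \<Theta>" using sub(1)[OF C] True by blast
          obtain a where a: "C = connected_component_set \<Theta> a" using C by (auto simp: components_def)
          then show "C = C0" using connected_component_eq[of x \<Theta> a] True by (simp add: C0_def)
        qed
        then show ?thesis by (simp add: indicator_def)
      qed simp
    qed
    also have "\<dots> \<le> indicator \<Theta> x * ennreal (norm (k' x))"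
    proof (cases "C0 \<in> components \<Theta>")
      case True
      then show ?thesis by (subst nn_integral_cmult_indicator) auto
    next
      case False
      then have "(\<integral>\<^sup>+C. (indicator \<Theta> x * ennreal (norm (k' x))) * indicator {C0} C \<partial>count_space (components \<Theta>)) =
          (\<integral>\<^sup>+C. 0 \<partial>count_space (components \<Theta>))"
        by (intro nn_integral_cong) (auto simp: indicator_def)
      then show ?thesis by simp
    qed
    finally show "(\<integral>\<^sup>+C. indicator C x * ennreal (norm (k' x)) \<partial>count_space (components \<Theta>)) \<le>
        indicator \<Theta> x * ennreal (norm (k' x))" .
  qed
  finally have sum: "(\<integral>\<^sup>+C. ennreal (c C) \<partial>count_space (components \<Theta>)) \<le> ennreal s"
    using fin by simp
  show thesis
  proof (rule that[OF _ sum], intro ballI conjI)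
    show "0 \<le> c C" for C by (simp add: c_def)
    show "dist (k x) (k y) \<le> c C" if "C \<in> components \<Theta>" "x \<in> C" "y \<in> C" for C x y
      using dist_le[of C x y] dist_le[of C y x] that by (cases "x \<le> y") (auto simp: dist_commute)
  qed
qed

section \<open>Boundary limits in the plane\<close>

context complement_homeo
begin

lemma cluster_image_singleton: "cluster_image {z} = {w. rel z w}"
  by (simp add: cluster_image_def)

lemma cluster_image_singleton_component: "z \<in> E \<Longrightarrow> cluster_image {z} \<in> components F"
  using rel_total[of z] rel_fibre rel_in_iff unfolding cluster_image_singleton
  by (metis componentsI)

lemma cluster_image_singleton_eqD:
  assumes "z \<in> E" "cluster_image {z} = cluster_image {z'}"
  shows "connected_component E z z'"
proof -
  obtain w where w: "rel z w" using rel_total by blast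
  then have w': "rel z' w" using assms(2) by (auto simp: cluster_image_singleton)
  have "w \<in> F" using w assms(1) rel_in_iff by blast
  then have "{x. cluster_rel F E g w x} = connected_component_set E z"
    using complement_homeo.rel_fibre[OF swap] w unfolding rel_swap by blast
  then show ?thesis using w' unfolding rel_swap by blast
qed

text \<open>The hypotheses concern components of the boundary, the argument those of
  \<open>F\<close>. The frontier of \<open>L\<close> is connected because \<open>- F\<close> is; the
  component \<open>M\<close> of \<open>frontier F\<close> around it stays inside \<open>L\<close>
  and contains no interior point of \<open>L\<close>.\<close>

lemma frontier_component_target:
  assumes L: "L \<in> components F"
  shows "frontier L \<in> components (frontier F)"
proof -
  have cL: "compact L" using compact_components[OF compact_target L] .
  then have frL: "frontier L \<subseteq> L" by (simp add: compact_imp_closed frontier_subset_closed)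
  have con: "connected (frontier L)"
    using connected_frontier_component_complement[OF connected_target] L by simp
  have sub: "frontier L \<subseteq> frontier F" by (rule frontier_of_components_subset[OF L])
  have ne: "frontier L \<noteq> {}"
    using in_components_nonempty[OF L] cL compact_imp_bounded not_bounded_UNIV
    by (auto simp: frontier_eq_empty)
  obtain M where M: "M \<in> components (frontier F)" "frontier L \<subseteq> M"
    using exists_component_superset[OF sub _ con] ne sub by blast
  have "M \<subseteq> F"
    using in_components_subset[OF M(1)] compact_target frontier_subset_closed compact_imp_closed by blast
  then have "M \<subseteq> L"
    using components_maximal[OF L in_components_connected[OF M(1)]] M(2) ne frL by blast
  have "M \<subseteq> frontier L"
  proof
    fix x assume x: "x \<in> M"
    have "x \<notin> interior F" using x in_components_subset[OF M(1)] by (auto simp: frontier_def)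
    then have "x \<notin> interior L" using interior_mono[OF in_components_subset[OF L]] by blast
    then show "x \<in> frontier L" using x \<open>M \<subseteq> L\<close> closure_subset by (auto simp: frontier_def)
  qed
  then show ?thesis using M by (metis subset_antisym)
qed

lemma summable_on_components_target:
  assumes "diameter summable_on components (frontier F)"
  shows "diameter summable_on components F"
proof -
  have inj: "inj_on frontier (components F)"
  proof (rule inj_onI)
    fix L L' assume h: "L \<in> components F" "L' \<in> components F" "frontier L = frontier L'"
    have "frontier L \<subseteq> L" "frontier L' \<subseteq> L'"
      using h compact_components[OF compact_target] compact_imp_closed frontier_subset_closed by blast+
    moreover have "frontier L \<noteq> {}"
      using in_components_nonempty[OF frontier_component_target[OF h(1)]] .
    ultimately show "L = L'" using components_eq[OF h(1,2)] h(3) by blast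
  qed
  have "diameter summable_on (frontier ` components F)"
    by (rule summable_on_subset_banach[OF assms]) (use frontier_component_target in auto)
  then have "(diameter \<circ> frontier) summable_on components F"
    using summable_on_reindex[OF inj] by blast
  then show ?thesis
    by (rule summable_on_cong[THEN iffD1, rotated])
      (simp add: diameter_frontier_compact compact_components[OF compact_target])
qed

text \<open>All but finitely many components of \<open>F\<close> belong to a small tail of the sum.
  The points related to one of the finitely many others form a closed set, which omits
  \<open>p\<close> unless that component is the one related to \<open>p\<close>. Small circles
  therefore avoid them; the component of \<open>p\<close> itself is cut out of the circle.\<close>

lemma sum_diameters_near_point:
  assumes "diameter summable_on components F" "p \<in> E" "0 < \<epsilon>"
  obtains r1 where "0 < r1"
    "\<And>r T. r < r1 \<Longrightarrow> finite T \<Longrightarrow>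
      T \<subseteq> (\<lambda>z. cluster_image {z}) ` (E \<inter> sphere p r - connected_component_set E p) \<Longrightarrow> sum diameter T \<le> \<epsilon>"
proof -
  have "0 \<le> diameter L" if "L \<in> components F" for L
    using compact_components[OF compact_target that] compact_imp_bounded diameter_ge_0 by blast
  then obtain S where S: "finite S" "S \<subseteq> components F"
    "\<And>T. finite T \<Longrightarrow> T \<subseteq> components F - S \<Longrightarrow> sum diameter T \<le> \<epsilon>"
    using summable_on_small_tail[OF assms(1) _ assms(3)] by metis
  define K where "K M = {z. \<exists>w\<in>M. rel z w}" for M
  have opn: "open (- K M)" if "M \<in> S" for M
  proof -
    have "closed M"
      using that S(2) compact_components[OF compact_target] compact_imp_closed by blast
    then have "closed (complement_homeo.cluster_image F E g M)"
      by (rule complement_homeo.closed_image[OF swap])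
    then show ?thesis
      unfolding complement_homeo.cluster_image_def[OF swap] rel_swap K_def by (simp add: open_Compl)
  qed
  have "open (\<Inter>M\<in>S - {cluster_image {p}}. - K M)"
    using S(1) opn by (intro open_INT) auto
  moreover have "p \<in> (\<Inter>M\<in>S - {cluster_image {p}}. - K M)"
  proof (intro INT_I ComplI)
    fix M assume M: "M \<in> S - {cluster_image {p}}" and "p \<in> K M"
    then obtain w where w: "w \<in> M" "rel p w" by (auto simp: K_def)
    then have "M = cluster_image {p}"
      using components_eq[of M F "cluster_image {p}"] M S(2) cluster_image_singleton_component[OF assms(2)]
      by (auto simp: cluster_image_singleton)
    then show False using M by blast
  qed
  ultimately obtain r1 where r1: "r1 > 0" "ball p r1 \<subseteq> (\<Inter>M\<in>S - {cluster_image {p}}. - K M)"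
    using openE by blast
  show thesis
  proof (rule that[OF r1(1)])
    fix r T assume r: "r < r1" and T: "finite T"
      "T \<subseteq> (\<lambda>z. cluster_image {z}) ` (E \<inter> sphere p r - connected_component_set E p)"
    have "T \<subseteq> components F - S"
    proof
      fix L assume "L \<in> T"
      then obtain z where "z \<in> E \<inter> sphere p r - connected_component_set E p" "L = cluster_image {z}"
        using T(2) by blast
      then have z: "z \<in> E" "dist p z = r" "\<not> connected_component E p z" "L = cluster_image {z}"
        by auto
      have "L \<notin> S"
      proof
        assume "L \<in> S"
        have "L \<noteq> cluster_image {p}"
          using cluster_image_singleton_eqD[OF z(1), of p] z(3,4) connected_component_sym by metis
        then have "z \<notin> K L" using r1(2) \<open>L \<in> S\<close> z(2) r by auto
        then show False using rel_total[of z] z(4) by (auto simp: K_def cluster_image_singleton)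
      qed
      then show "L \<in> components F - S" using cluster_image_singleton_component z by blast
    qed
    then show "sum diameter T \<le> \<epsilon>" using S(3) T(1) by blast
  qed
qed

text \<open>Disks of positive radius are countable in number because they are disjoint with
  non-empty interior, and all points of one disk have the same image. The point components on the
  circle are countable by the choice of \<open>t\<close>.\<close>

lemma countable_components_meeting_circle:
  assumes "\<And>K. K \<in> components E \<Longrightarrow> \<exists>m \<rho>. 0 \<le> \<rho> \<and> K = cball m \<rho>"
    and "countable {z. {z} \<in> components E \<and> z \<noteq> p \<and> ln (dist p z) = t}" "r = exp t"
  shows "countable ((\<lambda>z. cluster_image {z}) ` (E \<inter> sphere p r))"
proof -
  define N where "N = {K \<in> components E. interior K \<noteq> {}}"
  have "countable N"
  proof (rule countable_disjoint_nonempty_interior_subsets)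
    show "pairwise disjnt N"
      using pairwise_disjoint_components[of E] unfolding N_def pairwise_def disjnt_def by blast
  qed (auto simp: N_def)
  then have "countable ((\<lambda>K. cluster_image {SOME z. z \<in> K}) ` N \<union>
      (\<lambda>z. cluster_image {z}) ` {z. {z} \<in> components E \<and> z \<noteq> p \<and> ln (dist p z) = t})"
    using assms(2) by auto
  then show ?thesis
  proof (rule countable_subset[rotated], safe)
    fix z assume z: "z \<in> E" "z \<in> sphere p r"
    define K where "K = connected_component_set E z"
    have K: "K \<in> components E" "z \<in> K" using z by (auto simp: K_def componentsI)
    obtain m \<rho> where m: "0 \<le> \<rho>" "K = cball m \<rho>" using assms(1)[OF K(1)] by blast
    assume no: "cluster_image {z} \<notin> (\<lambda>z. cluster_image {z}) ` {z. {z} \<in> components E \<and> z \<noteq> p \<and> ln (dist p z) = t}"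
    show "cluster_image {z} \<in> (\<lambda>K. cluster_image {SOME z. z \<in> K}) ` N"
    proof (cases "\<rho> = 0")
      case True
      then have "K = {z}" using m K(2) by auto
      moreover have "dist p z = exp t" using z(2) assms(3) by simp
      then have "z \<noteq> p" "ln (dist p z) = t" by auto
      ultimately show ?thesis using no K(1) by blast
    next
      case False
      then have "interior K \<noteq> {}" using m by (simp add: interior_cball)
      then have KN: "K \<in> N" using K by (simp add: N_def)
      have "(SOME z. z \<in> K) \<in> K" using K(2) by (rule someI)
      then have "connected_component E z (SOME z. z \<in> K)" by (simp add: K_def)
      then have "cluster_image {z} = cluster_image {SOME z. z \<in> K}"
        unfolding cluster_image_singleton using rel_component_source connected_component_sym by blast
      then show ?thesis using KN by blast
    qed
  qed
qed

text \<open>In the coordinate \<open>w\<close> with \<open>z = p + exp w\<close> the circle of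
  radius \<open>exp t\<close> becomes a vertical segment at real part \<open>t\<close>. The image of
  the circle is covered by the images of its arcs off \<open>E\<close>, of total length at most
  \<open>\<epsilon> / 2\<close>, and by components of \<open>F\<close> of total diameter at most
  \<open>\<epsilon> / 2\<close>.\<close>

lemma small_image_of_circle:
  assumes holo: "f holomorphic_on (- E)"
    and disks: "\<And>K. K \<in> components E \<Longrightarrow> \<exists>m \<rho>. 0 \<le> \<rho> \<and> K = cball m \<rho>"
    and summable: "diameter summable_on components F"
    and p: "p \<in> frontier E"
    and levels: "AE t in lborel. countable {z. {z} \<in> components E \<and> z \<noteq> p \<and> ln (dist p z) = t}"
    and pos: "0 < \<epsilon>" "0 < r0"
  obtains r where "0 < r" "r < r0"
    "\<And>x y. x \<in> cluster_image (sphere p r - connected_component_set E p) \<Longrightarrow>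
      y \<in> cluster_image (sphere p r - connected_component_set E p) \<Longrightarrow> dist x y \<le> \<epsilon>"
proof -
  have pE: "p \<in> E" using p compact_source compact_imp_closed frontier_subset_closed by blast
  define Q where "Q = connected_component_set E p"
  have Q: "Q \<in> components E" "p \<in> Q" using pE by (auto simp: Q_def componentsI)
  obtain m \<rho> where m: "0 \<le> \<rho>" "Q = cball m \<rho>" using disks[OF Q(1)] by blast
  have "dist p m = \<rho>"
  proof (rule ccontr)
    assume "dist p m \<noteq> \<rho>"
    then have "p \<in> ball m \<rho>" using Q(2) m(2) by (auto simp: dist_commute)
    moreover have "ball m \<rho> \<subseteq> E" using m(2) in_components_subset[OF Q(1)] ball_subset_cball by blast
    ultimately have "p \<in> interior E" using interior_maximal[OF _ open_ball] by blast
    then show False using p by (simp add: frontier_def)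
  qed
  note arc = connected_circle_minus_disk[OF _ m(1) this, folded m(2)]
  obtain r1 where r1: "0 < r1" "\<And>r T. r < r1 \<Longrightarrow> finite T \<Longrightarrow>
      T \<subseteq> (\<lambda>z. cluster_image {z}) ` (E \<inter> sphere p r - Q) \<Longrightarrow> sum diameter T \<le> \<epsilon> / 2"
    using sum_diameters_near_point[OF summable pE half_gt_zero[OF pos(1)]] unfolding Q_def by metis
  define T0 where "T0 = ln (min r0 r1)"
  have T0: "exp T0 = min r0 r1" using r1(1) pos(2) by (simp add: T0_def)
  \<comment> \<open>The open strip of width \<open>2 * pi\<close> makes \<open>exp\<close> injective
    at the price of omitting one point of each circle, which gets a piece of its own below.\<close>
  define W where "W = {w. Re w < T0 \<and> \<bar>Im w\<bar> < pi \<and> p + exp w \<notin> E}"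
  define h where "h w = f (p + exp w)" for w
  have oE: "open (- E)" using compact_source by (simp add: compact_imp_closed open_Compl)
  have oW: "open W"
  proof -
    have "open ((\<lambda>w. p + exp w) -` (- E))"
      by (intro open_vimage oE continuous_intros)
    moreover have "open {w. Re w < T0}" "open {w. \<bar>Im w\<bar> < pi}"
      by (intro open_Collect_less continuous_intros)+
    moreover have "W = {w. Re w < T0} \<inter> {w. \<bar>Im w\<bar> < pi} \<inter> (\<lambda>w. p + exp w) -` (- E)"
      by (auto simp: W_def)
    ultimately show ?thesis by auto
  qed
  have holW: "h holomorphic_on W"
  proof -
    have "(\<lambda>w. p + exp w) holomorphic_on W" by (intro holomorphic_intros)
    then have "(f \<circ> (\<lambda>w. p + exp w)) holomorphic_on W"
      by (rule holomorphic_on_compose_gen[OF _ holo]) (auto simp: W_def)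
    then show ?thesis by (simp add: h_def[abs_def] o_def)
  qed
  have injW: "inj_on h W"
  proof (rule inj_onI)
    fix x y assume xy: "x \<in> W" "y \<in> W" "h x = h y"
    have "g (h x) = p + exp x" "g (h y) = p + exp y"
      using gf[of "p + exp x"] gf[of "p + exp y"] xy(1,2) by (simp_all add: h_def W_def)
    then have "exp x = exp y" using xy(3) by simp
    moreover have "\<bar>Im x - Im y\<bar> < 2 * pi" using xy by (auto simp: W_def)
    ultimately show "x = y" using exp_complex_eqI by blast
  qed
  have bdW: "bounded (h ` W)"
  proof -
    have "h ` W \<subseteq> f ` (ball p (exp T0) - E)"
      by (auto simp: h_def W_def dist_norm norm_exp_eq_Re intro!: imageI)
    then show ?thesis using proper(1)[OF bounded_ball] bounded_subset by blast
  qed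
  have strip: "\<And>z. z \<in> W \<Longrightarrow> \<bar>Im z\<bar> < pi" by (simp add: W_def)
  obtain t where t: "t < T0" "countable {z. {z} \<in> components E \<and> z \<noteq> p \<and> ln (dist p z) = t}"
    "(\<integral>\<^sup>+\<theta>. indicator W (Complex t \<theta>) * ennreal (cmod (deriv h (Complex t \<theta>))) \<partial>lborel) \<le> ennreal (\<epsilon> / 2)"
    by (rule short_slice_exists[OF oW holW injW bdW _ levels half_gt_zero[OF pos(1)], of T0])
      (erule strip, rule that)
  define r where "r = exp t"
  have r: "0 < r" "r < r0" "r < r1" using t(1) T0 exp_less_cancel_iff[of t T0] by (auto simp: r_def)
  define \<Theta> where "\<Theta> = {\<theta>. Complex t \<theta> \<in> W}"
  define k where "k \<theta> = h (Complex t \<theta>)" for \<theta>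
  define k' where "k' \<theta> = \<i> * deriv h (Complex t \<theta>)" for \<theta>
  have contC: "continuous_on UNIV (Complex t)"
    by (auto simp: Complex_eq intro!: continuous_intros)
  have o\<Theta>: "open \<Theta>" unfolding \<Theta>_def using open_vimage[OF oW contC] by (simp add: vimage_def)
  have derk: "(k has_vector_derivative k' \<theta>) (at \<theta>)" if "\<theta> \<in> \<Theta>" for \<theta>
  proof -
    have "((\<lambda>\<theta>. Complex t \<theta>) has_vector_derivative \<i>) (at \<theta>)"
      unfolding Complex_eq by (auto intro!: derivative_eq_intros)
    moreover have "(h has_field_derivative deriv h (Complex t \<theta>)) (at (Complex t \<theta>))"
      using holomorphic_derivI[OF holW oW] that by (simp add: \<Theta>_def)
    ultimately show ?thesis
      using field_vector_diff_chain_at by (fastforce simp: k_def[abs_def] k'_def o_def)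
  qed
  have contk': "continuous_on \<Theta> k'"
  proof -
    have "continuous_on W (deriv h)"
      using holomorphic_deriv[OF holW oW] by (rule holomorphic_on_imp_continuous_on)
    then have "continuous_on \<Theta> (\<lambda>\<theta>. deriv h (Complex t \<theta>))"
      by (rule continuous_on_compose2[OF _ continuous_on_subset[OF contC]]) (auto simp: \<Theta>_def)
    then show ?thesis unfolding k'_def by (intro continuous_intros)
  qed
  have len: "(\<integral>\<^sup>+\<theta>. indicator \<Theta> \<theta> * ennreal (norm (k' \<theta>)) \<partial>lborel) \<le> ennreal (\<epsilon> / 2)"
  proof -
    have "(\<lambda>\<theta>. indicator \<Theta> \<theta> * ennreal (norm (k' \<theta>))) =
        (\<lambda>\<theta>. indicator W (Complex t \<theta>) * ennreal (cmod (deriv h (Complex t \<theta>))))"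
      by (auto simp: indicator_def \<Theta>_def k'_def norm_mult)
    then show ?thesis using t(3) by simp
  qed
  obtain c where c: "\<forall>C\<in>components \<Theta>. 0 \<le> c C \<and> (\<forall>x\<in>C. \<forall>y\<in>C. dist (k x) (k y) \<le> c C)"
    "(\<integral>\<^sup>+C. ennreal (c C) \<partial>count_space (components \<Theta>)) \<le> ennreal (\<epsilon> / 2)"
    by (rule arc_lengths[OF o\<Theta> _ contk' len]) (erule derk, rule that)
  define A where "A = sphere p r - Q"
  define \<L> where "\<L> = (\<lambda>z. cluster_image {z}) ` (E \<inter> sphere p r - Q)"
  \<comment> \<open>The singleton covers the point at which the strip cuts the circle. Its diameter
    is 0, so it is harmless even if \<open>p - r\<close> lies in \<open>E\<close> and the value of
    \<open>f\<close> there is arbitrary.\<close>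
  define \<X> where "\<X> = insert {f (p - r)} \<L>"
  have \<L>: "\<L> \<subseteq> components F" using cluster_image_singleton_component by (auto simp: \<L>_def)
  have bdX: "bounded X" if "X \<in> \<X>" for X
    using that \<L> compact_components[OF compact_target] compact_imp_bounded by (auto simp: \<X>_def)
  have cntX: "countable \<X>"
    using countable_components_meeting_circle[OF disks t(2) r_def]
    unfolding \<X>_def \<L>_def by (auto intro: countable_subset[rotated])
  have sumX: "(\<integral>\<^sup>+X. ennreal (diameter X) \<partial>count_space \<X>) \<le> ennreal (\<epsilon> / 2)"
  proof (rule nn_integral_count_space_le_of_finite_sums[OF cntX])
    show "0 \<le> diameter X" if "X \<in> \<X>" for X using bdX[OF that] by (rule diameter_ge_0)
    fix T assume T: "finite T" "T \<subseteq> \<X>"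
    have "sum diameter T = sum diameter (T - {{f (p - r)}})"
      using T(1) by (intro sum.mono_neutral_right) auto
    also have "\<dots> \<le> \<epsilon> / 2"
      using T r(3) by (intro r1(2)[of r]) (auto simp: \<X>_def \<L>_def)
    finally show "sum diameter T \<le> \<epsilon> / 2" .
  qed
  define I where "I = components \<Theta> <+> \<X>"
  define B where "B = case_sum (\<lambda>C. k ` C) (\<lambda>X. X)"
  define b where "b = case_sum c (diameter :: complex set \<Rightarrow> real)"
  have "connected A" unfolding A_def by (rule arc[OF r(1)])
  then have con: "connected (cluster_image A)" by (rule connected_image)
  have cover: "cluster_image A \<subseteq> (\<Union>i\<in>I. B i)"
  proof
    fix w assume "w \<in> cluster_image A"
    then obtain z where z: "z \<in> A" "rel z w" by (auto simp: cluster_image_def)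
    have zr: "dist p z = r" using z(1) by (simp add: A_def)
    consider "z \<in> E" | "z \<notin> E" "z = p - r" | "z \<notin> E" "z \<noteq> p - r" by blast
    then show "w \<in> (\<Union>i\<in>I. B i)"
    proof cases
      case 1
      then have "cluster_image {z} \<in> \<X>" using z(1) by (auto simp: \<X>_def \<L>_def A_def)
      moreover have "w \<in> cluster_image {z}" using z(2) by (simp add: cluster_image_singleton)
      ultimately show ?thesis unfolding I_def B_def by (intro UN_I[of "Inr (cluster_image {z})"]) auto
    next
      case 2
      then have "w = f (p - r)" using z(2) by (simp add: rel_fibre_source)
      then show ?thesis unfolding I_def B_def \<X>_def by (intro UN_I[of "Inr {f (p - r)}"]) auto
    next
      case 3
      define \<theta> where "\<theta> = Im (Ln (z - p))"
      have nz: "z - p \<noteq> 0" using zr r(1) by auto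
      have "Re (Ln (z - p)) = t" using nz zr by (simp add: r_def dist_norm norm_minus_commute)
      then have Ln: "Complex t \<theta> = Ln (z - p)" by (simp add: \<theta>_def complex_eq_iff)
      then have ex: "p + exp (Complex t \<theta>) = z" using nz by simp
      have "\<theta> \<noteq> pi"
      proof
        assume "\<theta> = pi"
        then have "exp (Complex t \<theta>) = - complex_of_real r"
          by (simp add: exp_eq_polar r_def cis_pi)
        then show False using ex 3(2) by simp
      qed
      moreover have "- pi < \<theta>" "\<theta> \<le> pi" using nz mpi_less_Im_Ln Im_Ln_le_pi by (auto simp: \<theta>_def)
      ultimately have "\<bar>\<theta>\<bar> < pi" by auto
      then have \<theta>: "\<theta> \<in> \<Theta>" using t(1) ex 3(1) by (simp add: \<Theta>_def W_def)
      have "w = k \<theta>" using z(2) 3(1) ex by (simp add: rel_fibre_source k_def h_def)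
      moreover obtain C where "C \<in> components \<Theta>" "\<theta> \<in> C"
        using \<theta> Union_components[of \<Theta>] by blast
      ultimately show ?thesis unfolding I_def B_def by (intro UN_I[of "Inl C"]) auto
    qed
  qed
  have cI: "countable I"
    using countable_components_of_open[OF o\<Theta>] cntX unfolding I_def by (rule countable_Plus)
  have "(\<integral>\<^sup>+i. ennreal (b i) \<partial>count_space I) =
      (\<integral>\<^sup>+C. ennreal (c C) \<partial>count_space (components \<Theta>)) + (\<integral>\<^sup>+X. ennreal (diameter X) \<partial>count_space \<X>)"
    unfolding I_def by (subst nn_integral_count_space_Plus) (simp add: b_def)
  also have "\<dots> \<le> ennreal (\<epsilon> / 2) + ennreal (\<epsilon> / 2)"
    by (rule add_mono[OF c(2) sumX])
  also have "\<dots> = ennreal \<epsilon>" using pos(1) by (simp flip: ennreal_plus)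
  finally have sum: "(\<integral>\<^sup>+i. ennreal (b i) \<partial>count_space I) \<le> ennreal \<epsilon>" .
  have b0: "0 \<le> b i" if "i \<in> I" for i
    using that c(1) diameter_ge_0[OF bdX] by (auto simp: b_def I_def)
  have bB: "dist x y \<le> b i" if "i \<in> I" "x \<in> B i" "y \<in> B i" for i x y
    using that c(1) diameter_bounded_bound[OF bdX] by (auto simp: b_def I_def B_def)
  show thesis
  proof (rule that[OF r(1,2)])
    fix x y assume "x \<in> cluster_image (sphere p r - connected_component_set E p)" "y \<in> cluster_image (sphere p r - connected_component_set E p)"
    then show "dist x y \<le> \<epsilon>"
      using connected_dist_le_of_countable_cover[OF con cover cI b0 bB sum] pos(1)
      unfolding A_def Q_def by simp
  qed
qed

lemma small_image_near_boundary_point: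
  assumes holo: "f holomorphic_on (- E)"
    and disks: "\<And>K. K \<in> components E \<Longrightarrow> \<exists>m \<rho>. 0 \<le> \<rho> \<and> K = cball m \<rho>"
    and peano: "\<And>M. M \<in> components (frontier F) \<Longrightarrow> peano_continuum M"
    and summable: "diameter summable_on components (frontier F)"
    and p: "p \<in> frontier E"
    and levels: "AE t in lborel. countable {z. {z} \<in> components E \<and> z \<noteq> p \<and> ln (dist p z) = t}"
    and pos: "0 < \<epsilon>"
  obtains r c where "0 < r" "f ` (ball p r - E) \<subseteq> cball c \<epsilon>"
proof -
  have pE: "p \<in> E" using p compact_source compact_imp_closed frontier_subset_closed by blast
  define L where "L = cluster_image {p}"
  have L: "L \<in> components F" using cluster_image_singleton_component[OF pE] by (simp add: L_def)
  have frL: "frontier L \<subseteq> L"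
    using compact_components[OF compact_target L] by (simp add: compact_imp_closed frontier_subset_closed)
  obtain \<gamma> where \<gamma>: "path \<gamma>" "path_image \<gamma> = frontier L"
    using peano[OF frontier_component_target[OF L]] by (auto simp: peano_continuum_def)
  obtain \<delta> where \<delta>: "0 < \<delta>" "\<And>c. c \<in> frontier L \<Longrightarrow>
      \<exists>N. compact N \<and> connected N \<and> N \<subseteq> frontier L \<and> frontier L \<inter> cball c \<delta> \<subseteq> N \<and> N \<subseteq> cball c \<epsilon>"
    using path_image_small_connected_nbhds[OF \<gamma>(1) pos] unfolding \<gamma>(2) by metis
  \<comment> \<open>The radius is chosen after \<open>\<delta>\<close>, so that the part of
    \<open>frontier L\<close> near the image of the circle fits into one small connected set
    \<open>N\<close>. The bound \<open>r < 1\<close> keeps all values considered in a fixed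
    disk.\<close>
  obtain r where r: "0 < r" "r < 1"
    "\<And>x y. x \<in> cluster_image (sphere p r - connected_component_set E p) \<Longrightarrow>
      y \<in> cluster_image (sphere p r - connected_component_set E p) \<Longrightarrow> dist x y \<le> min \<delta> \<epsilon>"
    using small_image_of_circle[OF holo disks summable_on_components_target[OF summable] p levels, of "min \<delta> \<epsilon>" 1]
      \<delta>(1) pos by (metis min_less_iff_conj zero_less_one)
  define A where "A = sphere p r - connected_component_set E p"
  have small: "dist x y \<le> min \<delta> \<epsilon>" if xy: "x \<in> closure (cluster_image A)" "y \<in> closure (cluster_image A)" for x y
  proof -
    have "cluster_image A \<times> cluster_image A \<subseteq> {q. dist (fst q) (snd q) \<le> min \<delta> \<epsilon>}"
      using r(3) by (auto simp: A_def)
    moreover have "closed {q :: complex \<times> complex. dist (fst q) (snd q) \<le> min \<delta> \<epsilon>}"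
      by (intro closed_Collect_le continuous_intros)
    ultimately have "closure (cluster_image A \<times> cluster_image A) \<subseteq> {q. dist (fst q) (snd q) \<le> min \<delta> \<epsilon>}"
      by (rule closure_minimal)
    then show ?thesis using xy by (auto simp: closure_Times)
  qed
  have "bounded (f ` (cball p 1 - E))" using proper(1)[OF bounded_cball] .
  then have "bounded (f ` (cball p 1 - E) \<union> F)"
    using compact_target compact_imp_bounded by auto
  then obtain B where B: "f ` (cball p 1 - E) \<union> F \<subseteq> cball 0 B" "B \<ge> 0"
    using bounded_subset_ballD[of _ 0] ball_subset_cball by (metis order_less_imp_le subset_trans)
  have imgB: "closure (cluster_image A) \<subseteq> cball 0 B"
  proof (rule closure_minimal[OF _ closed_cball], rule subset_trans[OF _ B(1)])
    show "cluster_image A \<subseteq> f ` (cball p 1 - E) \<union> F"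
    proof
      fix w assume "w \<in> cluster_image A"
      then obtain z where z: "z \<in> A" "rel z w" by (auto simp: cluster_image_def)
      show "w \<in> f ` (cball p 1 - E) \<union> F"
      proof (cases "z \<in> E")
        case True then show ?thesis using z(2) rel_in_iff by blast
      next
        case False
        then show ?thesis using z r(2) by (auto simp: rel_fibre_source A_def)
      qed
    qed
  qed
  \<comment> \<open>A reference value: it is outside every disk of radius \<open>\<epsilon>\<close>
    with centre in \<open>cball 0 B\<close>, and its preimage is outside the circle because values
    inside stay within \<open>B\<close>.\<close>
  define w2 where "w2 = complex_of_real (B + \<epsilon> + 1)"
  have w2: "cmod w2 = B + \<epsilon> + 1" using B(2) pos unfolding w2_def norm_of_real by simp
  then have w2B: "w2 \<notin> cball 0 B" using pos by simp
  then have w2F: "w2 \<notin> F" using B(1) by blast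
  define z2 where "z2 = g w2"
  have z2: "f z2 = w2" "z2 \<notin> E" using fg[OF w2F] g_notin[OF w2F] by (auto simp: z2_def)
  have z2out: "z2 \<notin> closure (ball p r)"
  proof
    assume "z2 \<in> closure (ball p r)"
    then have "z2 \<in> cball p 1" using r(1,2) by simp
    then have "f z2 \<in> f ` (cball p 1 - E)" using z2(2) by blast
    then show False using z2(1) w2B B(1) by blast
  qed
  have frU: "A = frontier (ball p r) - connected_component_set E p"
    using r(1) by (simp add: A_def frontier_ball)
  \<comment> \<open>Distinct components of \<open>E\<close> have distinct images. Hence the image of
    \<open>A\<close> avoids \<open>L\<close>, and its closure can touch \<open>L\<close> only along
    the frontier, which is where local connectedness is known.\<close>
  have "cluster_image A \<inter> L = {}"
  proof (rule ccontr)
    assume "cluster_image A \<inter> L \<noteq> {}"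
    then obtain z w where zw: "z \<in> A" "rel z w" "rel p w" by (auto simp: L_def cluster_image_def)
    then have "cluster_image {p} = cluster_image {z}"
      unfolding cluster_image_singleton using rel_difunctional by blast
    then show False using cluster_image_singleton_eqD[OF pE, of z] zw(1) by (auto simp: A_def)
  qed
  then have clL: "closure (cluster_image A) \<inter> L \<subseteq> frontier L"
  proof -
    have "cluster_image A \<inter> interior L = {}"
      using \<open>cluster_image A \<inter> L = {}\<close> interior_subset by blast
    then have "closure (cluster_image A) \<inter> interior L = {}"
      using open_Int_closure_eq_empty[OF open_interior, of L "cluster_image A"] by blast
    then show ?thesis using closure_subset by (auto simp: frontier_def)
  qed
  \<comment> \<open>If the closure of the image misses \<open>L\<close>, the empty set serves as
    \<open>N\<close>; otherwise the centre \<open>c\<close> is taken in the intersection.\<close>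
  obtain c N where cN: "compact N" "connected N" "N \<subseteq> L" "closure (cluster_image A) \<inter> L \<subseteq> N"
    "closure (cluster_image A) \<union> N \<subseteq> cball c \<epsilon>" "f z2 \<notin> cball c \<epsilon>"
  proof (cases "closure (cluster_image A) = {}")
    case True
    show thesis
      by (rule that[of "{}" "0"]) (use True w2 z2(1) B(2) in auto)
  next
    case False
    have sub: "closure (cluster_image A) \<subseteq> cball c \<epsilon>" if "c \<in> closure (cluster_image A)" for c
      using small[OF that] by auto
    have far: "f z2 \<notin> cball c \<epsilon>" if "c \<in> closure (cluster_image A)" for c
    proof
      assume "f z2 \<in> cball c \<epsilon>"
      moreover have "norm c \<le> B" using that imgB by auto
      ultimately show False
        using w2 z2(1) norm_triangle_ineq2[of w2 c] by (simp add: dist_norm norm_minus_commute)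
    qed
    show thesis
    proof (cases "closure (cluster_image A) \<inter> L = {}")
      case True
      obtain c where "c \<in> closure (cluster_image A)" using False by (meson ex_in_conv)
      then show thesis using True sub far by (intro that[of "{}" c]) auto
    next
      case ne: False
      then obtain c where c: "c \<in> closure (cluster_image A)" "c \<in> L" by blast
      then have "c \<in> frontier L" using clL by blast
      then obtain N where N: "compact N" "connected N" "N \<subseteq> frontier L" "frontier L \<inter> cball c \<delta> \<subseteq> N" "N \<subseteq> cball c \<epsilon>"
        using \<delta>(2) by blast
      have "closure (cluster_image A) \<inter> L \<subseteq> N"
        using N(4) clL small[OF c(1)] by auto
      then show thesis
        using N sub[OF c(1)] far[OF c(1)] frL by (intro that[of N c]) auto
    qed
  qed
  show thesis
  proof (rule that[OF r(1)], safe)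
    fix z1 assume "z1 \<in> ball p r" "z1 \<notin> E"
    then show "f z1 \<in> cball c \<epsilon>"
      using image_of_neighbourhood_in_ball[OF open_ball pE _ z2out z2(2) frU cN(1,2) _ _ cN(5,6)] cN(3,4)
      unfolding L_def by blast
  qed
qed

text \<open>Small images of neighbourhoods amount to the Cauchy condition at \<open>p\<close>, so
  completeness gives a limit along one sequence in \<open>- E\<close>, which is then the limit of
  \<open>f\<close>.\<close>

lemma boundary_limit_exists:
  assumes "f holomorphic_on (- E)"
    and "\<And>K. K \<in> components E \<Longrightarrow> \<exists>m \<rho>. 0 \<le> \<rho> \<and> K = cball m \<rho>"
    and "\<And>M. M \<in> components (frontier F) \<Longrightarrow> peano_continuum M"
    and "diameter summable_on components (frontier F)"
    and p: "p \<in> frontier E"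
    and "AE t in lborel. countable {z. {z} \<in> components E \<and> z \<noteq> p \<and> ln (dist p z) = t}"
  shows "\<exists>l. (f \<longlongrightarrow> l) (at p within - E)"
proof -
  have osc: "\<exists>r>0. \<forall>x\<in>ball p r - E. \<forall>y\<in>ball p r - E. dist (f x) (f y) \<le> \<epsilon>" if "\<epsilon> > 0" for \<epsilon>
  proof -
    have e2: "0 < \<epsilon> / 2" using that by simp
    obtain r c where rc: "0 < r" "f ` (ball p r - E) \<subseteq> cball c (\<epsilon> / 2)"
      by (rule small_image_near_boundary_point[OF assms(1) _ _ assms(4-6) e2])
        (erule assms(2), erule assms(3), rule that)
    have "dist (f x) (f y) \<le> \<epsilon>" if "x \<in> ball p r - E" "y \<in> ball p r - E" for x y
    proof -
      have "f x \<in> cball c (\<epsilon> / 2)" "f y \<in> cball c (\<epsilon> / 2)" using rc(2) that by blast+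
      then have "dist c (f x) \<le> \<epsilon> / 2" "dist c (f y) \<le> \<epsilon> / 2" by simp_all
      then show ?thesis using dist_triangle3[of "f x" "f y" c] by linarith
    qed
    then show ?thesis using rc(1) by blast
  qed
  have "p \<in> closure (- E)" using p by (simp add: frontier_closures)
  then obtain z where z: "\<And>n. z n \<in> - E" "z \<longlonglongrightarrow> p" using closure_sequential by metis
  have "Cauchy (\<lambda>n. f (z n))"
  proof (rule metric_CauchyI)
    fix e :: real assume e: "e > 0"
    obtain r where r: "r > 0" "\<forall>x\<in>ball p r - E. \<forall>y\<in>ball p r - E. dist (f x) (f y) \<le> e / 2"
      using osc[of "e / 2"] e by auto
    obtain M where M: "\<And>n. n \<ge> M \<Longrightarrow> dist (z n) p < r"
      using z(2) r(1) unfolding lim_sequentially by blast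
    have "dist (f (z m)) (f (z n)) < e" if "m \<ge> M" "n \<ge> M" for m n
    proof -
      have "z m \<in> ball p r - E" "z n \<in> ball p r - E"
        using M[OF that(1)] M[OF that(2)] z(1) by (auto simp: dist_commute)
      then have "dist (f (z m)) (f (z n)) \<le> e / 2" using r(2) by blast
      then show ?thesis using e by simp
    qed
    then show "\<exists>M. \<forall>m\<ge>M. \<forall>n\<ge>M. dist (f (z m)) (f (z n)) < e" by blast
  qed
  then obtain l where l: "(\<lambda>n. f (z n)) \<longlonglongrightarrow> l"
    using Cauchy_convergent convergent_def by blast
  have "(f \<longlongrightarrow> l) (at p within - E)"
  proof (rule tendstoI)
    fix e :: real assume e: "e > 0"
    obtain r where r: "r > 0" "\<forall>x\<in>ball p r - E. \<forall>y\<in>ball p r - E. dist (f x) (f y) \<le> e / 2"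
      using osc[of "e / 2"] e by auto
    obtain M where M: "\<And>n. n \<ge> M \<Longrightarrow> dist (z n) p < r"
      using z(2) r(1) unfolding lim_sequentially by blast
    have close: "dist (f x) l \<le> e / 2" if x: "x \<in> ball p r - E" for x
    proof (rule Lim_bounded)
      show "(\<lambda>n. dist (f x) (f (z n))) \<longlonglongrightarrow> dist (f x) l" by (intro tendsto_intros l)
      show "\<forall>n\<ge>M. dist (f x) (f (z n)) \<le> e / 2"
      proof (intro allI impI)
        fix n assume "n \<ge> M"
        then have "z n \<in> ball p r - E" using M z(1) by (auto simp: dist_commute)
        then show "dist (f x) (f (z n)) \<le> e / 2" using r(2) x by blast
      qed
    qed
    have "eventually (\<lambda>x. x \<in> ball p r - E) (at p within - E)"
      unfolding eventually_at using r(1) by (intro exI[of _ r]) (auto simp: dist_commute)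
    then show "eventually (\<lambda>x. dist (f x) l < e) (at p within - E)"
      by eventually_elim (use close e in fastforce)
  qed
  then show ?thesis ..
qed

end

section \<open>From the sphere to the plane\<close>

text \<open>
  \<open>pole_chart \<alpha>\<close> is the affine coordinate that sends the point \<open>\<alpha>\<close> to infinity, where its value is
  junk (\<open>1 / 0 = 0\<close>); \<open>pole_point \<alpha>\<close> is its inverse.
\<close>

fun pole_chart :: "complex \<Rightarrow> ext_complex \<Rightarrow> complex" where
  "pole_chart \<alpha> (Fin w) = 1 / (w - \<alpha>)"
| "pole_chart \<alpha> Infty = 0"

definition pole_point :: "complex \<Rightarrow> complex \<Rightarrow> ext_complex"
  where "pole_point \<alpha> z = (if z = 0 then Infty else Fin (\<alpha> + 1 / z))"

lemma pole_chart_point [simp]: "pole_chart \<alpha> (pole_point \<alpha> z) = z"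
  by (simp add: pole_point_def)

lemma pole_point_chart: "q \<noteq> Fin \<alpha> \<Longrightarrow> pole_point \<alpha> (pole_chart \<alpha> q) = q"
  by (cases q) (auto simp: pole_point_def)

lemma pole_point_neq [simp]: "pole_point \<alpha> z \<noteq> Fin \<alpha>"
  by (auto simp: pole_point_def)

text \<open>The chordal metric. It does not exceed the spherical distance and, unlike the latter,
  has algebraic expressions in the affine coordinate.\<close>

definition chord :: "ext_complex \<Rightarrow> ext_complex \<Rightarrow> real"
  where "chord p q = dist (stereo p) (stereo q)"

lemma chord_commute: "chord p q = chord q p"
  by (simp add: chord_def dist_commute)

lemma chord_pos: "p \<noteq> q \<Longrightarrow> 0 < chord p q"
  by (simp add: chord_def stereo_eq_iff)

lemma chord_nonneg: "0 \<le> chord p q"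
  by (simp add: chord_def)

lemma chord_le_2: "chord p q \<le> 2"
  using norm_triangle_ineq4[of "stereo p" "stereo q"] by (simp add: chord_def dist_norm)

lemma chord_le_dist: "chord p q \<le> dist p q"
  unfolding chord_def dist_stereo using sin_x_le_x[of "dist p q / 2"] by simp

lemma chord_sq: "(chord p q)\<^sup>2 = 2 - 2 * (stereo p \<bullet> stereo q)"
proof -
  have unit: "stereo u \<bullet> stereo u = 1" for u by (simp add: dot_square_norm)
  show ?thesis
    unfolding chord_def dist_norm power2_norm_eq_inner
    by (simp add: inner_diff_left inner_diff_right inner_commute unit)
qed

lemma chord_sq_Fin_Fin:
  "(chord (Fin z) (Fin w))\<^sup>2 = 4 * (cmod (z - w))\<^sup>2 / ((1 + (cmod z)\<^sup>2) * (1 + (cmod w)\<^sup>2))"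
proof -
  define a b where "a = (cmod z)\<^sup>2" and "b = (cmod w)\<^sup>2"
  have ab: "1 + a > 0" "1 + b > 0" "a + 1 \<noteq> 0" "b + 1 \<noteq> 0"
    by (auto simp: a_def b_def add_pos_nonneg add_nonneg_eq_0_iff)
  have zw: "(cmod (z - w))\<^sup>2 = a + b - 2 * (z \<bullet> w)"
    unfolding a_def b_def power2_norm_eq_inner
    by (simp add: inner_diff_left inner_diff_right inner_commute)
  have "stereo (Fin z) \<bullet> stereo (Fin w) =
      2 / (1 + a) * (2 / (1 + b)) * (z \<bullet> w) + (a - 1) / (a + 1) * ((b - 1) / (b + 1))"
    by (simp add: a_def b_def)
  also have "\<dots> = (4 * (z \<bullet> w) + (a - 1) * (b - 1)) / ((1 + a) * (1 + b))"
    using ab by (simp add: add_divide_distrib add.commute)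
  finally have "(chord (Fin z) (Fin w))\<^sup>2 = 2 - 2 * ((4 * (z \<bullet> w) + (a - 1) * (b - 1)) / ((1 + a) * (1 + b)))"
    by (simp only: chord_sq)
  also have "\<dots> = (2 * ((1 + a) * (1 + b)) - 2 * (4 * (z \<bullet> w) + (a - 1) * (b - 1))) / ((1 + a) * (1 + b))"
    using ab by (simp add: diff_divide_distrib)
  also have "2 * ((1 + a) * (1 + b)) - 2 * (4 * (z \<bullet> w) + (a - 1) * (b - 1)) = 4 * (a + b - 2 * (z \<bullet> w))"
    by (simp add: algebra_simps)
  finally show ?thesis unfolding zw a_def b_def .
qed

lemma chord_sq_Fin_Infty: "(chord (Fin z) Infty)\<^sup>2 = 4 / (1 + (cmod z)\<^sup>2)"
proof -
  have "(cmod z)\<^sup>2 + 1 \<noteq> 0" "1 + (cmod z)\<^sup>2 \<noteq> 0" by (auto simp: add_nonneg_eq_0_iff)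
  then show ?thesis unfolding chord_sq by (simp add: field_simps)
qed

text \<open>Up to a similarity, \<open>pole_chart \<alpha>\<close> is stereographic projection from
  the point \<open>Fin \<alpha>\<close>, so distances change as under an inversion: the distortion
  is a product of one factor for each point. The proof compares squares, where all chord formulas
  are rational.\<close>

lemma pole_chart_dist:
  assumes "p \<noteq> Fin \<alpha>" "q \<noteq> Fin \<alpha>"
  shows "dist (pole_chart \<alpha> p) (pole_chart \<alpha> q) * (chord p (Fin \<alpha>) * chord q (Fin \<alpha>) * (1 + (cmod \<alpha>)\<^sup>2)) =
    2 * chord p q"
proof (rule power2_eq_imp_eq)
  define A where "A = 1 + (cmod \<alpha>)\<^sup>2"
  have A: "A > 0" by (simp add: A_def add_pos_nonneg)
  have N: "1 + (cmod z)\<^sup>2 > 0" for z by (simp add: add_pos_nonneg)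
  have fin: "(dist (1 / (z - \<alpha>)) (1 / (w - \<alpha>)))\<^sup>2 = (cmod (z - w))\<^sup>2 / ((cmod (z - \<alpha>))\<^sup>2 * (cmod (w - \<alpha>))\<^sup>2)"
    if "z \<noteq> \<alpha>" "w \<noteq> \<alpha>" for z w
  proof -
    have "1 / (z - \<alpha>) - 1 / (w - \<alpha>) = (w - z) / ((z - \<alpha>) * (w - \<alpha>))"
      using that by (simp add: field_simps)
    then show ?thesis
      by (simp add: dist_norm norm_divide norm_mult power_divide power_mult_distrib norm_minus_commute)
  qed
  have "(dist (pole_chart \<alpha> p) (pole_chart \<alpha> q))\<^sup>2 * ((chord p (Fin \<alpha>))\<^sup>2 * (chord q (Fin \<alpha>))\<^sup>2 * A\<^sup>2) =
      4 * (chord p q)\<^sup>2"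
  proof (cases p; cases q)
    fix z w assume pq: "p = Fin z" "q = Fin w"
    then have ne: "z \<noteq> \<alpha>" "w \<noteq> \<alpha>" using assms by auto
    have "u / (s * t) * ((4 * s / (a * A)) * (4 * t / (b * A)) * A\<^sup>2) = 4 * (4 * u / (a * b))"
      if "s \<noteq> 0" "t \<noteq> 0" "a > 0" "b > 0" for s t u a b :: real
      using that A by (simp add: field_simps power2_eq_square)
    from this[of "(cmod (z - \<alpha>))\<^sup>2" "(cmod (w - \<alpha>))\<^sup>2" "1 + (cmod z)\<^sup>2" "1 + (cmod w)\<^sup>2" "(cmod (z - w))\<^sup>2"]
    show ?thesis
      using ne N by (simp only: pq chord_sq_Fin_Fin pole_chart.simps A_def[symmetric] fin[OF ne])
        (simp add: norm_eq_zero)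
  next
    have alg: "1 / s * ((4 * s / (a * A)) * (4 / A) * A\<^sup>2) = 4 * (4 / a)" if "s \<noteq> 0" "a > 0" for s a :: real
      using that A by (simp add: field_simps power2_eq_square)
    have inf: "(dist (1 / (z - \<alpha>)) 0)\<^sup>2 = 1 / (cmod (z - \<alpha>))\<^sup>2" for z
      by (simp add: norm_divide power_divide)
    {
      fix z assume pq: "p = Fin z" "q = Infty"
      then have ne: "(cmod (z - \<alpha>))\<^sup>2 \<noteq> 0" using assms by auto
      show ?thesis
        using alg[OF ne N[of z]] by (simp only: pq chord_sq_Fin_Fin chord_sq_Fin_Infty chord_commute[of Infty]
            pole_chart.simps A_def[symmetric] inf)
    next
      fix w assume pq: "p = Infty" "q = Fin w"
      then have ne: "(cmod (w - \<alpha>))\<^sup>2 \<noteq> 0" using assms by auto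
      show ?thesis
        using alg[OF ne N[of w]] by (simp only: pq chord_sq_Fin_Fin chord_sq_Fin_Infty chord_commute[of Infty]
            pole_chart.simps A_def[symmetric] inf dist_commute[of 0] mult.commute[of "4 / A"])
    }
  qed (simp add: chord_def)
  then show "(dist (pole_chart \<alpha> p) (pole_chart \<alpha> q) * (chord p (Fin \<alpha>) * chord q (Fin \<alpha>) * (1 + (cmod \<alpha>)\<^sup>2)))\<^sup>2 =
      (2 * chord p q)\<^sup>2"
    by (simp add: power_mult_distrib A_def)
qed (auto intro!: mult_nonneg_nonneg chord_nonneg add_nonneg_nonneg)

lemma pole_chart_lipschitz:
  assumes "0 < \<kappa>" "\<kappa> \<le> chord p (Fin \<alpha>)" "\<kappa> \<le> chord q (Fin \<alpha>)"
  shows "dist (pole_chart \<alpha> p) (pole_chart \<alpha> q) \<le> 2 / \<kappa>\<^sup>2 * dist p q"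
proof -
  have ne: "p \<noteq> Fin \<alpha>" "q \<noteq> Fin \<alpha>" using assms by (auto simp: chord_def)
  have "\<kappa> * \<kappa> * 1 \<le> chord p (Fin \<alpha>) * chord q (Fin \<alpha>) * (1 + (cmod \<alpha>)\<^sup>2)"
    using assms by (intro mult_mono) auto
  then have "dist (pole_chart \<alpha> p) (pole_chart \<alpha> q) * \<kappa>\<^sup>2 \<le>
      dist (pole_chart \<alpha> p) (pole_chart \<alpha> q) * (chord p (Fin \<alpha>) * chord q (Fin \<alpha>) * (1 + (cmod \<alpha>)\<^sup>2))"
    by (intro mult_left_mono) (auto simp: power2_eq_square)
  also have "\<dots> = 2 * chord p q" by (rule pole_chart_dist[OF ne])
  also have "\<dots> \<le> 2 * dist p q" using chord_le_dist by simp
  finally show ?thesis using assms(1) by (simp add: field_simps)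
qed

text \<open>Chordal convergence suffices, since the spherical distance is \<open>arccos\<close> of
  the inner product and \<open>arccos\<close> is continuous up to the endpoint 1.\<close>

lemma tendsto_stereoD:
  assumes "((\<lambda>x. stereo (f x)) \<longlongrightarrow> stereo l) F"
  shows "(f \<longlongrightarrow> l) F"
proof -
  have "((\<lambda>x. arccos (stereo (f x) \<bullet> stereo l)) \<longlongrightarrow> arccos (stereo l \<bullet> stereo l)) F"
  proof (rule continuous_on_tendsto_compose[OF continuous_on_arccos'])
    show "((\<lambda>x. stereo (f x) \<bullet> stereo l) \<longlongrightarrow> stereo l \<bullet> stereo l) F"
      by (intro tendsto_intros assms)
  qed (use abs_inner_stereo_le in \<open>auto simp: abs_le_iff intro!: always_eventually\<close>)
  moreover have "stereo l \<bullet> stereo l = 1" by (simp add: dot_square_norm)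
  ultimately have "((\<lambda>x. dist (f x) l) \<longlongrightarrow> 0) F"
    by (simp add: dist_ext_complex_def)
  then show ?thesis by (rule tendsto_dist_iff[THEN iffD2])
qed

lemma chord_pole_point_le:
  "chord (pole_point \<alpha> z) (pole_point \<alpha> w) \<le> 2 * (1 + (cmod \<alpha>)\<^sup>2) * dist z w"
proof -
  have "chord (pole_point \<alpha> z) (Fin \<alpha>) * chord (pole_point \<alpha> w) (Fin \<alpha>) * (1 + (cmod \<alpha>)\<^sup>2) \<le> 2 * 2 * (1 + (cmod \<alpha>)\<^sup>2)"
    by (intro mult_mono chord_le_2) (auto simp: chord_nonneg)
  then have "dist z w * (chord (pole_point \<alpha> z) (Fin \<alpha>) * chord (pole_point \<alpha> w) (Fin \<alpha>) * (1 + (cmod \<alpha>)\<^sup>2)) \<le>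
      dist z w * (2 * 2 * (1 + (cmod \<alpha>)\<^sup>2))"
    by (intro mult_left_mono) auto
  then have "2 * chord (pole_point \<alpha> z) (pole_point \<alpha> w) \<le> dist z w * (2 * 2 * (1 + (cmod \<alpha>)\<^sup>2))"
    using pole_chart_dist[of "pole_point \<alpha> z" \<alpha> "pole_point \<alpha> w"] by simp
  also have "\<dots> = 2 * (2 * (1 + (cmod \<alpha>)\<^sup>2) * dist z w)" by simp
  finally show ?thesis by linarith
qed

lemma continuous_pole_point: "continuous_on S (pole_point \<alpha>)"
proof -
  have "(pole_point \<alpha> \<longlongrightarrow> pole_point \<alpha> z) (at z within S)" for z
  proof (rule tendsto_stereoD, rule tendsto_dist_iff[THEN iffD2], rule tendsto_sandwich[where f = "\<lambda>_. 0"])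
    show "eventually (\<lambda>w. 0 \<le> dist (stereo (pole_point \<alpha> w)) (stereo (pole_point \<alpha> z))) (at z within S)" by simp
    show "eventually (\<lambda>w. dist (stereo (pole_point \<alpha> w)) (stereo (pole_point \<alpha> z)) \<le>
        2 * (1 + (cmod \<alpha>)\<^sup>2) * dist w z) (at z within S)"
      using chord_pole_point_le[of \<alpha> _ z] by (simp add: chord_def)
    show "((\<lambda>w. 2 * (1 + (cmod \<alpha>)\<^sup>2) * dist w z) \<longlongrightarrow> 0) (at z within S)"
      by (rule tendsto_eq_intros refl | simp)+
  qed simp
  then show ?thesis by (simp add: continuous_on_def)
qed

lemma chord_ge_of_open:
  assumes "open U" "a \<in> U"
  obtains \<kappa> where "0 < \<kappa>" "\<And>q. q \<notin> U \<Longrightarrow> \<kappa> \<le> chord q a"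
proof (rule ccontr)
  assume neg: "\<not> thesis"
  have "\<exists>q. q \<notin> U \<and> chord q a < 1 / (real n + 1)" for n
    using that[of "1 / (real n + 1)"] neg by (force simp: not_le add_pos_nonneg)
  then obtain q where q: "\<And>n. q n \<notin> U" "\<And>n. chord (q n) a < 1 / (real n + 1)" by metis
  have "q \<longlonglongrightarrow> a"
  proof (rule tendsto_stereoD, rule tendsto_dist_iff[THEN iffD2], rule tendsto_sandwich[where f = "\<lambda>_. 0"])
    show "eventually (\<lambda>n. dist (stereo (q n)) (stereo a) \<le> 1 / (real n + 1)) sequentially"
      using q(2) by (auto simp: chord_def intro!: always_eventually less_imp_le)
    show "(\<lambda>n. 1 / (real n + 1)) \<longlonglongrightarrow> 0" by real_asymp
  qed auto
  then have "eventually (\<lambda>n. q n \<in> U) sequentially" using assms by (rule topological_tendstoD)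
  then show False using q(1) by (auto dest: eventually_happens')
qed

lemma continuous_pole_chart: "continuous_on (- {Fin \<alpha>}) (pole_chart \<alpha>)"
proof (rule continuous_at_imp_continuous_on, rule ballI)
  fix p assume "p \<in> - {Fin \<alpha>}"
  then have pos: "0 < chord p (Fin \<alpha>)" by (intro chord_pos) simp
  define e where "e = chord p (Fin \<alpha>) / 2"
  have e: "e > 0" "e = chord p (Fin \<alpha>) / 2" using pos by (simp_all add: e_def)
  have "(pole_chart \<alpha> \<longlongrightarrow> pole_chart \<alpha> p) (at p)"
  proof (rule tendsto_dist_iff[THEN iffD2], rule tendsto_sandwich[where f = "\<lambda>_. 0"])
    have "eventually (\<lambda>q. dist q p < e) (at p)"
      using e(1) eventually_at by blast
    then show "eventually (\<lambda>q. dist (pole_chart \<alpha> q) (pole_chart \<alpha> p) \<le> 2 / e\<^sup>2 * dist q p) (at p)"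
    proof eventually_elim
      case (elim q)
      have "chord p (Fin \<alpha>) \<le> chord p q + chord q (Fin \<alpha>)"
        unfolding chord_def by (rule dist_triangle)
      moreover have "chord p q < e" using chord_le_dist[of p q] elim by (simp add: dist_commute)
      ultimately show ?case using e by (intro pole_chart_lipschitz) auto
    qed
    show "((\<lambda>q. 2 / e\<^sup>2 * dist q p) \<longlongrightarrow> 0) (at p)"
      by (rule tendsto_eq_intros refl | simp)+
  qed auto
  then show "isCont (pole_chart \<alpha>) p" by (simp add: isCont_def)
qed

lemma dist_le_pi: "dist (p :: ext_complex) q \<le> pi"
  unfolding dist_ext_complex_def using abs_inner_stereo_le[of p q] by (intro arccos_ubound) auto

text \<open>The chart vanishes at \<open>Infty\<close>, so a Lipschitz estimate against
  \<open>Infty\<close> bounds it; \<open>k\<close> is small enough for the estimate to apply to both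
  points.\<close>

lemma norm_pole_chart_le:
  assumes "0 < \<kappa>"
  obtains R where "\<And>q. \<kappa> \<le> chord q (Fin \<alpha>) \<Longrightarrow> cmod (pole_chart \<alpha> q) \<le> R"
proof -
  define k where "k = min \<kappa> (chord Infty (Fin \<alpha>))"
  have k: "k > 0" using assms chord_pos[of Infty "Fin \<alpha>"] by (simp add: k_def)
  show thesis
  proof (rule that)
    fix q assume "\<kappa> \<le> chord q (Fin \<alpha>)"
    then have "dist (pole_chart \<alpha> q) (pole_chart \<alpha> Infty) \<le> 2 / k\<^sup>2 * dist q Infty"
      using k by (intro pole_chart_lipschitz) (auto simp: k_def)
    also have "\<dots> \<le> 2 / k\<^sup>2 * pi"
      by (intro mult_left_mono dist_le_pi) auto
    finally show "cmod (pole_chart \<alpha> q) \<le> 2 / k\<^sup>2 * pi" by simp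
  qed
qed

section \<open>Open sets, frontiers and connectedness in the affine coordinate\<close>

lemma pole_point_image_conv: "pole_point \<alpha> ` X = {q. q \<noteq> Fin \<alpha> \<and> pole_chart \<alpha> q \<in> X}"
  using pole_point_chart by (force simp: image_iff)

lemma open_pole_point_image: "open X \<Longrightarrow> open (pole_point \<alpha> ` X)"
proof -
  assume "open X"
  then have "open (- {Fin \<alpha>} \<inter> pole_chart \<alpha> -` X)"
    by (intro continuous_open_preimage continuous_pole_chart) auto
  moreover have "- {Fin \<alpha>} \<inter> pole_chart \<alpha> -` X = pole_point \<alpha> ` X"
    unfolding pole_point_image_conv by auto
  ultimately show ?thesis by simp
qed

lemma open_pole_point_vimage: "open U \<Longrightarrow> open (pole_point \<alpha> -` U)"
  by (rule open_vimage[OF _ continuous_pole_point])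

lemma closed_pole_point_vimage: "closed U \<Longrightarrow> closed (pole_point \<alpha> -` U)"
  by (rule closed_vimage[OF _ continuous_pole_point])

lemma compact_pole_point_vimage:
  assumes "open D" "Fin \<alpha> \<in> D"
  shows "compact (pole_point \<alpha> -` (- D))"
proof -
  obtain \<kappa> where \<kappa>: "0 < \<kappa>" "\<And>q. q \<notin> D \<Longrightarrow> \<kappa> \<le> chord q (Fin \<alpha>)"
    using chord_ge_of_open[OF assms] by metis
  obtain R where "\<And>q. \<kappa> \<le> chord q (Fin \<alpha>) \<Longrightarrow> cmod (pole_chart \<alpha> q) \<le> R"
    using norm_pole_chart_le[OF \<kappa>(1)] by metis
  then have "cmod z \<le> R" if "z \<in> pole_point \<alpha> -` (- D)" for z
    using \<kappa>(2) that by (metis ComplD pole_chart_point vimageD)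
  then have "bounded (pole_point \<alpha> -` (- D))" by (auto simp: bounded_iff)
  then show ?thesis
    using closed_pole_point_vimage[of "- D"] assms(1) by (simp add: compact_eq_bounded_closed closed_Compl)
qed

lemma frontier_pole_point_vimage:
  assumes "open D" "Fin \<alpha> \<in> D"
  shows "frontier (pole_point \<alpha> -` (- D)) = pole_point \<alpha> -` frontier D"
proof -
  let ?E = "pole_point \<alpha> -` (- D)"
  have cE: "closed ?E" using assms(1) by (intro closed_pole_point_vimage) auto
  have frD: "frontier D = - D - interior (- D)"
    by (auto simp: frontier_def interior_open[OF assms(1)] closure_interior)
  have "z \<in> interior ?E \<longleftrightarrow> pole_point \<alpha> z \<in> interior (- D)" for z
  proof
    assume "z \<in> interior ?E"
    then have "pole_point \<alpha> z \<in> pole_point \<alpha> ` interior ?E" by blast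
    moreover have "pole_point \<alpha> ` interior ?E \<subseteq> - D" using interior_subset by blast
    ultimately show "pole_point \<alpha> z \<in> interior (- D)"
      using interior_maximal[OF _ open_pole_point_image[OF open_interior]] by blast
  next
    assume "pole_point \<alpha> z \<in> interior (- D)"
    moreover have "pole_point \<alpha> -` interior (- D) \<subseteq> ?E" using interior_subset by blast
    ultimately show "z \<in> interior ?E"
      using interior_maximal[OF _ open_pole_point_vimage[OF open_interior]] by blast
  qed
  moreover have "frontier ?E = ?E - interior ?E"
    by (simp add: frontier_def closure_closed[OF cE])
  ultimately show "frontier ?E = pole_point \<alpha> -` frontier D"
    unfolding frD by auto
qed

lemma homeomorphism_image_component:
  assumes "homeomorphism S T f g" "C \<in> components S"
  shows "f ` C \<in> components T"
proof -
  have C: "connected C" "C \<subseteq> S" "C \<noteq> {}"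
    using assms(2) in_components_connected in_components_subset in_components_nonempty by blast+
  have fg: "f ` S = T" "g ` T = S" "\<And>x. x \<in> S \<Longrightarrow> g (f x) = x" "\<And>y. y \<in> T \<Longrightarrow> f (g y) = y"
    "continuous_on S f" "continuous_on T g"
    using assms(1) by (auto simp: homeomorphism_def)
  have "connected (f ` C)" "f ` C \<subseteq> T" "f ` C \<noteq> {}"
    using C fg by (auto intro!: connected_continuous_image continuous_on_subset[OF fg(5)])
  then obtain C' where C': "C' \<in> components T" "f ` C \<subseteq> C'"
    using exists_component_superset by (metis subset_empty)
  have T: "C' \<subseteq> T" "connected C'" using C' in_components_subset in_components_connected by blast+
  have "connected (g ` C')" "g ` C' \<subseteq> S"
    using T fg by (auto intro!: connected_continuous_image continuous_on_subset[OF fg(6)])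
  moreover have "C \<inter> g ` C' \<noteq> {}"
  proof -
    obtain x where x: "x \<in> C" using C by blast
    then have "g (f x) = x" "f x \<in> C'" using fg(3) C C' by blast+
    then show ?thesis using x by (metis IntI empty_iff imageI)
  qed
  ultimately have "g ` C' \<subseteq> C" using components_maximal[OF assms(2)] by blast
  have "C' \<subseteq> f ` C"
  proof
    fix y assume "y \<in> C'"
    then have "g y \<in> C" "f (g y) = y" using \<open>g ` C' \<subseteq> C\<close> fg(4) T(1) by blast+
    then show "y \<in> f ` C" by (metis imageI)
  qed
  then show ?thesis using C' by (metis subset_antisym)
qed

lemma homeomorphism_pole_point:
  assumes "Fin \<alpha> \<notin> S"
  shows "homeomorphism (pole_point \<alpha> -` S) S (pole_point \<alpha>) (pole_chart \<alpha>)"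
proof (rule homeomorphismI)
  show "continuous_on S (pole_chart \<alpha>)"
    by (rule continuous_on_subset[OF continuous_pole_chart]) (use assms in auto)
  have "pole_point \<alpha> (pole_chart \<alpha> q) = q" if "q \<in> S" for q
    using pole_point_chart[of q \<alpha>] assms that by blast
  then show "pole_chart \<alpha> ` S \<subseteq> pole_point \<alpha> -` S" "\<And>y. y \<in> S \<Longrightarrow> pole_point \<alpha> (pole_chart \<alpha> y) = y"
    by auto
qed (auto intro: continuous_pole_point)

lemma neighbourhood_of_pole:
  shows "open (- pole_point \<alpha> ` cball 0 R)" "Fin \<alpha> \<in> - pole_point \<alpha> ` cball 0 R"
proof -
  have "compact (pole_point \<alpha> ` cball 0 R)"
    by (intro compact_continuous_image continuous_pole_point compact_cball)
  then show "open (- pole_point \<alpha> ` cball 0 R)" by (simp add: compact_imp_closed open_Compl)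
  show "Fin \<alpha> \<in> - pole_point \<alpha> ` cball 0 R" using pole_point_neq by (auto dest: sym)
qed

text \<open>In a separation of the preimage, the connected region \<open>P\<close> near infinity
  lies on one side; adding the pole to that side would separate \<open>D\<close>.\<close>

lemma connected_pole_point_vimage:
  assumes "sph_domain D" "Fin \<alpha> \<in> D"
  shows "connected (pole_point \<alpha> -` D)"
proof (rule ccontr)
  have oD: "open D" and cD: "connected D" using assms(1) by (auto simp: sph_domain_def)
  define S where "S = pole_point \<alpha> -` D"
  have oS: "open S" unfolding S_def by (rule open_pole_point_vimage[OF oD])
  have "bounded (- S)"
    using compact_imp_bounded[OF compact_pole_point_vimage[OF oD assms(2)]] by (simp add: S_def vimage_Compl)
  then obtain R where R: "- S \<subseteq> cball 0 R"
    using bounded_subset_ballD[of "- S" 0] ball_subset_cball by blast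
  define P where "P = - cball (0::complex) R"
  have P: "connected P" "P \<subseteq> S" unfolding P_def using R
    by (auto intro!: connected_complement_bounded_convex)
  assume "\<not> connected (pole_point \<alpha> -` D)"
  then obtain A B where AB: "open A" "open B" "A \<inter> S \<noteq> {}" "B \<inter> S \<noteq> {}" "A \<inter> B \<inter> S = {}" "S \<subseteq> A \<union> B"
    unfolding S_def[symmetric] connected_def by blast
  have key: False if h: "open A" "open B" "A \<inter> S \<noteq> {}" "B \<inter> S \<noteq> {}" "A \<inter> B \<inter> S = {}" "S \<subseteq> A \<union> B" "B \<inter> P = {}" for A B
  proof -
    \<comment> \<open>The added set is a neighbourhood of the pole whose other points lie over
      \<open>P\<close>.\<close>
    define U where "U = pole_point \<alpha> ` (A \<inter> S) \<union> - pole_point \<alpha> ` cball 0 R"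
    define V where "V = pole_point \<alpha> ` (B \<inter> S)"
    have "open U" "open V" unfolding U_def V_def
      using h oS neighbourhood_of_pole by (auto intro!: open_Un open_pole_point_image)
    moreover have "U \<inter> D \<noteq> {}" "V \<inter> D \<noteq> {}" using h(3,4) unfolding U_def V_def S_def by blast+
    moreover have "D \<subseteq> U \<union> V"
    proof
      fix q assume q: "q \<in> D"
      show "q \<in> U \<union> V"
      proof (cases "q = Fin \<alpha>")
        case True then show ?thesis using neighbourhood_of_pole(2) by (simp add: U_def)
      next
        case False
        then have eq: "q = pole_point \<alpha> (pole_chart \<alpha> q)" by (simp add: pole_point_chart)
        then have "pole_chart \<alpha> q \<in> S" using q by (simp add: S_def)
        then have "pole_chart \<alpha> q \<in> A \<inter> S \<or> pole_chart \<alpha> q \<in> B \<inter> S" using h(6) by blast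
        then show ?thesis using eq unfolding U_def V_def by blast
      qed
    qed
    moreover have "U \<inter> V \<inter> D = {}"
    proof (rule ccontr)
      assume "U \<inter> V \<inter> D \<noteq> {}"
      then obtain z where z: "z \<in> B" "z \<in> S" "pole_point \<alpha> z \<in> U" by (auto simp: V_def)
      have "z \<notin> A" using z h(5) by blast
      then have "pole_point \<alpha> z \<notin> pole_point \<alpha> ` (A \<inter> S)"
        by (metis IntD1 imageE pole_chart_point)
      then have "pole_point \<alpha> z \<notin> pole_point \<alpha> ` cball 0 R" using z(3) by (auto simp: U_def)
      then have "z \<in> P" unfolding P_def by blast
      then show False using h(7) z by blast
    qed
    ultimately show False using connectedD[OF cD, of U V] by blast
  qed
  have "A \<inter> P = {} \<or> B \<inter> P = {}"
    using connectedD[OF P(1) AB(1,2)] AB(5,6) P(2) by blast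
  then show False
    using key[OF AB] key[OF AB(2,1,4,3)] AB(5,6) by (auto simp: Int_commute Un_commute)
qed

text \<open>Homogeneous coordinates: the point is the quotient of \<open>\<alpha> * z + 1\<close> by
  \<open>z\<close>, and clearing denominators gives a formula that holds at \<open>z = 0\<close>
  too.\<close>

lemma stereo_pole_point:
  fixes \<alpha> z :: complex
  defines "\<Delta> \<equiv> (cmod z)\<^sup>2 + (cmod (\<alpha> * z + 1))\<^sup>2"
  shows "stereo (pole_point \<alpha> z) =
    ((2 / \<Delta>) *\<^sub>R ((\<alpha> * z + 1) * cnj z), ((cmod (\<alpha> * z + 1))\<^sup>2 - (cmod z)\<^sup>2) / \<Delta>)"
proof (cases "z = 0")
  case False
  define w where "w = \<alpha> + 1 / z"
  define a b where "a = (cmod z)\<^sup>2" and "b = (cmod (\<alpha> * z + 1))\<^sup>2"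
  have a: "a > 0" using False by (simp add: a_def)
  have b: "b \<ge> 0" by (simp add: b_def)
  have wz: "w * z = \<alpha> * z + 1" using False by (simp add: w_def field_simps)
  have "b = (cmod w)\<^sup>2 * a" unfolding a_def b_def wz[symmetric] by (simp add: norm_mult power_mult_distrib)
  then have w2: "(cmod w)\<^sup>2 = b / a" using a by simp
  have "w * complex_of_real a = (\<alpha> * z + 1) * cnj z"
    unfolding a_def wz[symmetric] complex_norm_square by (simp add: mult_ac)
  then have w: "w = (1 / a) *\<^sub>R ((\<alpha> * z + 1) * cnj z)"
    using a by (simp add: scaleR_conv_of_real field_simps)
  have "2 / (1 + b / a) * (1 / a) = 2 / (a + b)" "(b / a - 1) / (b / a + 1) = (b - a) / (a + b)"
  proof -
    have "1 + b / a = (a + b) / a" "b / a + 1 = (a + b) / a" "b / a - 1 = (b - a) / a"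
      using a by (simp_all add: add_divide_distrib diff_divide_distrib)
    then show "2 / (1 + b / a) * (1 / a) = 2 / (a + b)" "(b / a - 1) / (b / a + 1) = (b - a) / (a + b)"
      unfolding \<open>1 + b / a = (a + b) / a\<close> \<open>b / a + 1 = (a + b) / a\<close> \<open>b / a - 1 = (b - a) / a\<close>
      using a by simp_all
  qed
  then show ?thesis
    unfolding \<Delta>_def a_def[symmetric] b_def[symmetric] using False
    by (simp add: pole_point_def w_def[symmetric] w2) (subst w, simp)
qed (simp add: pole_point_def \<Delta>_def)

lemma mem_cball_stereo:
  assumes "0 \<le> r" "r \<le> pi"
  shows "x \<in> cball q r \<longleftrightarrow> cos r \<le> stereo q \<bullet> stereo x"
proof -
  have le: "- 1 \<le> stereo q \<bullet> stereo x" "stereo q \<bullet> stereo x \<le> 1"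
    using abs_inner_stereo_le[of q x] by linarith+
  have "dist q x \<le> r \<longleftrightarrow> cos r \<le> cos (dist q x)"
    using assms arccos_lbound[OF le] arccos_ubound[OF le]
    by (intro cos_mono_le_eq[symmetric]) (auto simp: dist_ext_complex_def)
  then show ?thesis by (simp add: dist_ext_complex_def cos_arccos[OF le])
qed

text \<open>A cap is cut from the unit sphere by a half-space. Inserting homogeneous coordinates and
  multiplying by \<open>\<Delta> > 0\<close> yields a quadratic inequality with leading term
  \<open>- A * (cmod z)\<^sup>2\<close>. Here \<open>A > 0\<close> because the pole is outside the
  cap, and completing the square gives the centre \<open>m\<close> and the squared radius
  \<open>s\<close>.\<close>

lemma pole_point_vimage_cap:
  assumes "0 < r" "r < pi" "Fin \<alpha> \<notin> cball q r"
  obtains m s where "pole_point \<alpha> -` cball q r = {z. (cmod (z - m))\<^sup>2 \<le> s}"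
proof -
  define c where "c = cos r"
  obtain v h where vh: "stereo q = (v, h)" by (metis surj_pair)
  define A where "A = c * (1 + (cmod \<alpha>)\<^sup>2) - 2 * (v \<bullet> \<alpha>) - h * ((cmod \<alpha>)\<^sup>2 - 1)"
  have N: "1 + (cmod \<alpha>)\<^sup>2 > 0" by (simp add: add_pos_nonneg)
  have "stereo q \<bullet> stereo (Fin \<alpha>) < c"
    using assms mem_cball_stereo[of r "Fin \<alpha>" q] by (simp add: c_def)
  moreover have "stereo q \<bullet> stereo (Fin \<alpha>) = (2 * (v \<bullet> \<alpha>) + h * ((cmod \<alpha>)\<^sup>2 - 1)) / (1 + (cmod \<alpha>)\<^sup>2)"
    by (simp add: vh add_divide_distrib add.commute)
  ultimately have A: "A > 0" using N by (simp add: A_def divide_less_eq)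
  define b where "b = v + (h - c) *\<^sub>R \<alpha>"
  define m where "m = (1 / A) *\<^sub>R cnj b"
  define s where "s = (h - c) / A + (cmod m)\<^sup>2"
  have "pole_point \<alpha> z \<in> cball q r \<longleftrightarrow> (cmod (z - m))\<^sup>2 \<le> s" for z
  proof -
    define \<Delta> where "\<Delta> = (cmod z)\<^sup>2 + (cmod (\<alpha> * z + 1))\<^sup>2"
    have \<Delta>: "\<Delta> > 0"
      by (cases "z = 0") (auto simp: \<Delta>_def add_pos_nonneg)
    have inner: "stereo q \<bullet> stereo (pole_point \<alpha> z) =
        (2 * (v \<bullet> ((\<alpha> * z + 1) * cnj z)) + h * ((cmod (\<alpha> * z + 1))\<^sup>2 - (cmod z)\<^sup>2)) / \<Delta>"
      unfolding stereo_pole_point vh \<Delta>_def[symmetric] by (simp add: add_divide_distrib)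
    have expand: "2 * (v \<bullet> ((\<alpha> * z + 1) * cnj z)) + h * ((cmod (\<alpha> * z + 1))\<^sup>2 - (cmod z)\<^sup>2) - c * \<Delta> =
        (h - c) + 2 * (cnj b \<bullet> z) - A * (cmod z)\<^sup>2"
      unfolding \<Delta>_def b_def A_def cmod_power2 inner_complex_def
      by (simp add: power2_eq_square algebra_simps)
    have sq: "(cmod (z - m))\<^sup>2 = (cmod z)\<^sup>2 - 2 * (m \<bullet> z) + (cmod m)\<^sup>2"
      unfolding power2_norm_eq_inner by (simp add: inner_diff_left inner_diff_right inner_commute)
    have mz: "A * (m \<bullet> z) = cnj b \<bullet> z" using A by (simp add: m_def)
    have "pole_point \<alpha> z \<in> cball q r \<longleftrightarrow> c \<le> stereo q \<bullet> stereo (pole_point \<alpha> z)"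
      using mem_cball_stereo[of r] assms by (simp add: c_def)
    also have "\<dots> \<longleftrightarrow> c * \<Delta> \<le> 2 * (v \<bullet> ((\<alpha> * z + 1) * cnj z)) + h * ((cmod (\<alpha> * z + 1))\<^sup>2 - (cmod z)\<^sup>2)"
      unfolding inner using \<Delta> by (simp add: le_divide_eq)
    also have "\<dots> \<longleftrightarrow> A * ((cmod z)\<^sup>2 - 2 * (m \<bullet> z)) \<le> h - c"
      using expand mz by (auto simp: algebra_simps)
    also have "\<dots> \<longleftrightarrow> (cmod z)\<^sup>2 - 2 * (m \<bullet> z) \<le> (h - c) / A"
      using A by (simp add: le_divide_eq mult.commute)
    also have "\<dots> \<longleftrightarrow> (cmod (z - m))\<^sup>2 \<le> s"
      unfolding sq s_def by linarith
    finally show ?thesis .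
  qed
  then have "pole_point \<alpha> -` cball q r = {z. (cmod (z - m))\<^sup>2 \<le> s}" by blast
  then show thesis by (rule that)
qed

lemma circle_domain_components:
  assumes "circle_domain D" "Fin \<alpha> \<in> D" "K \<in> components (pole_point \<alpha> -` (- D))"
  shows "\<exists>m \<rho>. 0 \<le> \<rho> \<and> K = cball m \<rho>"
proof -
  have hom: "homeomorphism (pole_point \<alpha> -` (- D)) (- D) (pole_point \<alpha>) (pole_chart \<alpha>)"
    by (rule homeomorphism_pole_point) (use assms in auto)
  have comp: "pole_point \<alpha> ` K \<in> components (- D)"
    by (rule homeomorphism_image_component[OF hom assms(3)])
  have K: "pole_point \<alpha> -` (pole_point \<alpha> ` K) = K"
    using pole_chart_point by (auto simp: image_iff) (metis pole_chart_point)
  obtain z0 where z0: "z0 \<in> K" using in_components_nonempty[OF assms(3)] by blast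
  consider q where "pole_point \<alpha> ` K = {q}" | q r where "0 < r" "r < pi" "pole_point \<alpha> ` K = cball q r"
  proof -
    have "\<forall>K\<in>components (- D). (\<exists>p. K = {p}) \<or> closed_geometric_disk K"
      using assms(1) by (simp add: circle_domain_def)
    from bspec[OF this comp] show thesis
      unfolding closed_geometric_disk_def using that by metis
  qed
  then show ?thesis
  proof cases
    case 1
    have "K = {z0}"
    proof
      show "K \<subseteq> {z0}"
      proof
        fix z assume "z \<in> K"
        then have "pole_point \<alpha> z \<in> {q}" "pole_point \<alpha> z0 \<in> {q}"
          unfolding 1[symmetric] using z0 by (auto intro: imageI)
        then have "pole_point \<alpha> z = pole_point \<alpha> z0" by simp
        then show "z \<in> {z0}" by (metis pole_chart_point singletonI)
      qed
    qed (use z0 in auto)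
    then show ?thesis by (intro exI[of _ z0] exI[of _ 0]) auto
  next
    case 2
    have "Fin \<alpha> \<notin> cball q r" using 2(3) pole_point_neq by (metis imageE)
    then obtain m s where ms: "pole_point \<alpha> -` cball q r = {z. (cmod (z - m))\<^sup>2 \<le> s}"
      using pole_point_vimage_cap[OF 2(1,2)] by metis
    then have Kms: "K = {z. (cmod (z - m))\<^sup>2 \<le> s}" using K 2(3) by simp
    have "0 \<le> (cmod (z0 - m))\<^sup>2" by simp
    also have "\<dots> \<le> s" using z0 Kms by simp
    finally have s: "0 \<le> s" .
    have "K = cball m (sqrt s)"
    proof -
      have "(cmod (z - m))\<^sup>2 \<le> s \<longleftrightarrow> dist m z \<le> sqrt s" for z
        using real_le_rsqrt[of "cmod (z - m)" s] sqrt_ge_absD[of "cmod (z - m)" s]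
        by (auto simp: dist_norm norm_minus_commute)
      then show ?thesis unfolding Kms by (simp add: cball_def)
    qed
    then show ?thesis using s by (intro exI[of _ m] exI[of _ "sqrt s"]) auto
  qed
qed

lemma continuous_extension_by_limits:
  fixes f :: "'a::metric_space \<Rightarrow> 'b::metric_space"
  assumes "continuous_on S f"
    and "\<And>x. x \<in> closure S - S \<Longrightarrow> \<exists>l. (f \<longlongrightarrow> l) (at x within S)"
  obtains h where "continuous_on (closure S) h" "h ` closure S \<subseteq> closure (f ` S)" "\<And>x. x \<in> S \<Longrightarrow> h x = f x"
proof -
  \<comment> \<open>Here \<open>y = x\<close> is allowed. So at points of \<open>S\<close>
    continuity yields this limit with value \<open>f x\<close>, off \<open>S\<close> it is the usual
    limit, and one condition serves on the whole closure.\<close>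
  define lim where "lim x l \<longleftrightarrow> (\<forall>e>0. \<exists>d>0. \<forall>y\<in>S. dist y x < d \<longrightarrow> dist (f y) l < e)" for x l
  have ex: "\<exists>l. lim x l \<and> (x \<in> S \<longrightarrow> l = f x)" if x: "x \<in> closure S" for x
  proof (cases "x \<in> S")
    case True
    then have "lim x (f x)" using assms(1) unfolding lim_def continuous_on_iff by blast
    then show ?thesis by blast
  next
    case False
    then obtain l where l: "(f \<longlongrightarrow> l) (at x within S)" using assms(2) x by blast
    have "lim x l"
      using l False unfolding lim_def Lim_within by (metis dist_nz)
    then show ?thesis using False by blast
  qed
  then obtain h where h: "\<And>x. x \<in> closure S \<Longrightarrow> lim x (h x)" "\<And>x. x \<in> closure S \<Longrightarrow> x \<in> S \<Longrightarrow> h x = f x"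
    by metis
  have near: "\<exists>y\<in>S. dist y x < d \<and> dist (f y) (h x) < e" if asm: "x \<in> closure S" "0 < d" "0 < e" for x d e
  proof -
    obtain d' where d': "d' > 0" "\<forall>y\<in>S. dist y x < d' \<longrightarrow> dist (f y) (h x) < e"
      using h(1)[OF asm(1)] asm(3) unfolding lim_def by blast
    obtain y where "y \<in> S" "dist y x < min d d'"
      using asm(1,2) d'(1) unfolding closure_approachable by (metis min_less_iff_conj)
    then show ?thesis using d'(2) by auto
  qed
  show thesis
  proof (rule that)
    show "continuous_on (closure S) h"
      unfolding continuous_on_iff
    proof (intro ballI allI impI)
      fix x e assume x: "x \<in> closure S" and e: "(0::real) < e"
      obtain d where d: "d > 0" "\<forall>y\<in>S. dist y x < d \<longrightarrow> dist (f y) (h x) < e / 2"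
        using h(1)[OF x] e unfolding lim_def by (meson half_gt_zero)
      have "dist (h x') (h x) < e" if x': "x' \<in> closure S" "dist x' x < d / 2" for x'
      proof -
        obtain y where y: "y \<in> S" "dist y x' < d / 2" "dist (f y) (h x') < e / 2"
          using near[OF x'(1), of "d / 2" "e / 2"] d(1) e by auto
        have "dist y x < d" using dist_triangle[of y x x'] y(2) x'(2) by linarith
        then have "dist (f y) (h x) < e / 2" using d(2) y(1) by blast
        then show ?thesis using dist_triangle3[of "h x'" "h x" "f y"] y(3) by linarith
      qed
      then show "\<exists>d>0. \<forall>x'\<in>closure S. dist x' x < d \<longrightarrow> dist (h x') (h x) < e"
        using d(1) by (intro exI[of _ "d / 2"]) auto
    qed
    show "h ` closure S \<subseteq> closure (f ` S)"
    proof safe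
      fix x assume x: "x \<in> closure S"
      show "h x \<in> closure (f ` S)"
        unfolding closure_approachable using near[OF x zero_less_one] by blast
    qed
    show "h x = f x" if "x \<in> S" for x using h(2) that closure_subset by blast
  qed
qed

section \<open>Transfer of the map and of the hypotheses to the plane\<close>

lemma transferred_map_bounded:
  assumes hom: "homeomorphism D \<Omega> \<phi> \<psi>" and "open D" "open \<Omega>" "Fin \<alpha> \<in> D" "\<phi> (Fin \<alpha>) = Fin \<beta>"
    and "bounded X"
  shows "bounded ((\<lambda>z. pole_chart \<beta> (\<phi> (pole_point \<alpha> z))) ` (X - pole_point \<alpha> -` (- D)))"
proof -
  obtain R where R: "X \<subseteq> cball 0 R"
    using bounded_subset_ballD[OF assms(6), of 0] ball_subset_cball by blast
  \<comment> \<open>A neighbourhood of the pole that avoids the points over \<open>X\<close>. The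
    open map \<open>\<phi>\<close> sends it to a neighbourhood of \<open>Fin \<beta>\<close>, and
    outside the latter the chart is bounded.\<close>
  define N where "N = - pole_point \<alpha> ` cball 0 R"
  have N: "open N" "Fin \<alpha> \<in> N" unfolding N_def by (rule neighbourhood_of_pole)+
  have "openin (top_of_set D) (D \<inter> N)" using N(1) by blast
  then have "openin (top_of_set \<Omega>) (\<phi> ` (D \<inter> N))"
    by (rule homeomorphism_imp_open_map[OF hom])
  then have "open (\<phi> ` (D \<inter> N))" using openin_open_trans assms(3) by blast
  moreover have "Fin \<beta> \<in> \<phi> ` (D \<inter> N)" using assms(4,5) N(2) by (metis IntI imageI)
  ultimately obtain \<kappa> where \<kappa>: "0 < \<kappa>" "\<And>q. q \<notin> \<phi> ` (D \<inter> N) \<Longrightarrow> \<kappa> \<le> chord q (Fin \<beta>)"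
    using chord_ge_of_open by metis
  obtain R' where R': "\<And>q. \<kappa> \<le> chord q (Fin \<beta>) \<Longrightarrow> cmod (pole_chart \<beta> q) \<le> R'"
    using norm_pole_chart_le[OF \<kappa>(1)] by metis
  have "cmod (pole_chart \<beta> (\<phi> (pole_point \<alpha> z))) \<le> R'" if z: "z \<in> X" "pole_point \<alpha> z \<in> D" for z
  proof -
    have "\<phi> (pole_point \<alpha> z) \<notin> \<phi> ` (D \<inter> N)"
    proof
      assume "\<phi> (pole_point \<alpha> z) \<in> \<phi> ` (D \<inter> N)"
      then obtain q where q: "q \<in> D" "q \<in> N" "\<phi> (pole_point \<alpha> z) = \<phi> q" by blast
      then have "pole_point \<alpha> z = q"
        using hom z(2) unfolding homeomorphism_def by metis
      then show False using q(2) z(1) R unfolding N_def by blast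
    qed
    then show ?thesis using \<kappa>(2) R' by blast
  qed
  then show ?thesis by (auto simp: bounded_iff)
qed

lemma continuous_transferred_map:
  assumes hom: "homeomorphism D \<Omega> \<phi> \<psi>" and "Fin \<alpha> \<in> D" "\<phi> (Fin \<alpha>) = Fin \<beta>"
  shows "continuous_on (pole_point \<alpha> -` D) (\<lambda>z. pole_chart \<beta> (\<phi> (pole_point \<alpha> z)))"
    and "z \<in> pole_point \<alpha> -` D \<Longrightarrow> pole_point \<beta> (pole_chart \<beta> (\<phi> (pole_point \<alpha> z))) = \<phi> (pole_point \<alpha> z)"
proof -
  have ne: "\<phi> (pole_point \<alpha> z) \<noteq> Fin \<beta>" if "pole_point \<alpha> z \<in> D" for z
    using that hom assms(2,3) pole_point_neq unfolding homeomorphism_def by metis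
  have "continuous_on (pole_point \<alpha> -` D) (\<lambda>z. \<phi> (pole_point \<alpha> z))"
    by (rule continuous_on_compose2[OF _ continuous_pole_point]) (use hom in \<open>auto simp: homeomorphism_def\<close>)
  then show "continuous_on (pole_point \<alpha> -` D) (\<lambda>z. pole_chart \<beta> (\<phi> (pole_point \<alpha> z)))"
    by (rule continuous_on_compose2[OF continuous_pole_chart]) (use ne ne[symmetric] in auto)
  show "pole_point \<beta> (pole_chart \<beta> (\<phi> (pole_point \<alpha> z))) = \<phi> (pole_point \<alpha> z)" if "z \<in> pole_point \<alpha> -` D"
    using ne that by (intro pole_point_chart) auto
qed

lemma complement_homeo_transfer:
  assumes "sph_domain D" "sph_domain \<Omega>" and hom: "homeomorphism D \<Omega> \<phi> \<psi>"
    and "Fin \<alpha> \<in> D" "\<phi> (Fin \<alpha>) = Fin \<beta>"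
  shows "complement_homeo (pole_point \<alpha> -` (- D)) (pole_point \<beta> -` (- \<Omega>))
    (\<lambda>z. pole_chart \<beta> (\<phi> (pole_point \<alpha> z))) (\<lambda>w. pole_chart \<alpha> (\<psi> (pole_point \<beta> w)))"
proof -
  have op: "open D" "open \<Omega>" using assms(1,2) by (auto simp: sph_domain_def)
  have hom': "homeomorphism \<Omega> D \<psi> \<phi>" using hom by (rule homeomorphism_symD)
  have \<beta>: "Fin \<beta> \<in> \<Omega>" "\<psi> (Fin \<beta>) = Fin \<alpha>"
    using hom assms(4,5) unfolding homeomorphism_def by (metis imageI)+
  have E: "- (pole_point \<alpha> -` (- D)) = pole_point \<alpha> -` D" "- (pole_point \<beta> -` (- \<Omega>)) = pole_point \<beta> -` \<Omega>"
    by auto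
  note f = continuous_transferred_map[OF hom assms(4,5)]
  note g = continuous_transferred_map[OF hom' \<beta>]
  have hmem: "\<phi> q \<in> \<Omega>" "\<psi> (\<phi> q) = q" if "q \<in> D" for q
    using hom that unfolding homeomorphism_def by blast+
  have hmem': "\<psi> q \<in> D" "\<phi> (\<psi> q) = q" if "q \<in> \<Omega>" for q
    using hom that unfolding homeomorphism_def by blast+
  show ?thesis
  proof (unfold_locales, unfold E)
    show "compact (pole_point \<alpha> -` (- D))" "compact (pole_point \<beta> -` (- \<Omega>))"
      using compact_pole_point_vimage op assms(4) \<beta>(1) by blast+
    show "connected (pole_point \<alpha> -` D)" "connected (pole_point \<beta> -` \<Omega>)"
      using connected_pole_point_vimage assms(1,2,4) \<beta>(1) by blast+
    show "homeomorphism (pole_point \<alpha> -` D) (pole_point \<beta> -` \<Omega>)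
      (\<lambda>z. pole_chart \<beta> (\<phi> (pole_point \<alpha> z))) (\<lambda>w. pole_chart \<alpha> (\<psi> (pole_point \<beta> w)))"
      by (rule homeomorphismI[OF f(1) g(1)]) (use f(2) g(2) hmem hmem' in auto)
    show "bounded ((\<lambda>z. pole_chart \<beta> (\<phi> (pole_point \<alpha> z))) ` (X - pole_point \<alpha> -` (- D)))" if "bounded X" for X
      using transferred_map_bounded[OF hom op assms(4,5) that] .
    show "bounded ((\<lambda>w. pole_chart \<alpha> (\<psi> (pole_point \<beta> w))) ` (X - pole_point \<beta> -` (- \<Omega>)))" if "bounded X" for X
      using transferred_map_bounded[OF hom' op(2,1) \<beta> that] .
  qed
qed

lemma holomorphic_transfer:
  assumes "sph_domain D" and hom: "homeomorphism D \<Omega> \<phi> \<psi>" and holo: "sph_holomorphic_on \<phi> D"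
    and "Fin \<alpha> \<in> D" "\<phi> (Fin \<alpha>) = Fin \<beta>"
  shows "(\<lambda>z. pole_chart \<beta> (\<phi> (pole_point \<alpha> z))) holomorphic_on (pole_point \<alpha> -` D)"
proof -
  define S where "S = pole_point \<alpha> -` D"
  define f where "f = (\<lambda>z. pole_chart \<beta> (\<phi> (pole_point \<alpha> z)))"
  define k where "k = (\<lambda>\<zeta>. fin_part (\<phi> (Fin \<zeta>)))"
  have oD: "open D" using assms(1) by (simp add: sph_domain_def)
  have oS: "open S" unfolding S_def by (rule open_pole_point_vimage[OF oD])
  have contf: "continuous_on S f" and ff: "\<And>z. z \<in> S \<Longrightarrow> pole_point \<beta> (f z) = \<phi> (pole_point \<alpha> z)"
    using continuous_transferred_map[OF hom assms(4,5)] by (simp_all add: S_def f_def)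
  \<comment> \<open>The points where a chart at infinity could be needed: 0 represents
    \<open>Infty\<close> in the source, and only the other point can be mapped to
    \<open>Infty\<close>. Elsewhere the local representative of \<open>\<phi>\<close> is
    \<open>k\<close>; at these two points continuity makes the singularity removable.\<close>
  define P where "P = {0, pole_chart \<alpha> (\<psi> Infty)}"
  have fin: "\<phi> (pole_point \<alpha> z) \<noteq> Infty" if "z \<in> S - P" for z
  proof
    assume "\<phi> (pole_point \<alpha> z) = Infty"
    then have "pole_point \<alpha> z = \<psi> Infty"
      using hom that unfolding homeomorphism_def S_def by (metis DiffD1 vimageD)
    then have "z = pole_chart \<alpha> (\<psi> Infty)" by (metis pole_chart_point)
    then show False using that by (simp add: P_def)
  qed
  have eq: "f z = 1 / (k (\<alpha> + 1 / z) - \<beta>)" "k (\<alpha> + 1 / z) \<noteq> \<beta>" if z: "z \<in> S - P" for z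
  proof -
    have pp: "pole_point \<alpha> z = Fin (\<alpha> + 1 / z)" using z by (simp add: P_def pole_point_def)
    obtain w where w: "\<phi> (pole_point \<alpha> z) = Fin w" using fin[OF z] by (cases "\<phi> (pole_point \<alpha> z)") auto
    have kw: "k (\<alpha> + 1 / z) = w" using w pp by (simp add: k_def)
    then show "f z = 1 / (k (\<alpha> + 1 / z) - \<beta>)" using w by (simp add: f_def)
    show "k (\<alpha> + 1 / z) \<noteq> \<beta>"
      using ff[of z] z kw w pole_point_neq[of \<beta> "f z"] by auto
  qed
  have "f holomorphic_on (S - P)"
    unfolding holomorphic_on_def
  proof
    fix z assume z: "z \<in> S - P"
    have z0: "z \<noteq> 0" using z by (simp add: P_def)
    have pp: "pole_point \<alpha> z = Fin (\<alpha> + 1 / z)" using z0 by (simp add: pole_point_def)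
    then have "Fin (\<alpha> + 1 / z) \<in> D" using z by (simp add: S_def)
    then have "local_rep \<phi> (Fin (\<alpha> + 1 / z)) analytic_on {fin_part (chart_map (Fin (\<alpha> + 1 / z)) (Fin (\<alpha> + 1 / z)))}"
      using holo unfolding sph_holomorphic_on_def by blast
    moreover have "local_rep \<phi> (Fin (\<alpha> + 1 / z)) = k"
      using fin[OF z] unfolding pp by (simp add: local_rep_def[abs_def] chart_map_def k_def)
    ultimately have "k analytic_on {\<alpha> + 1 / z}" by (simp add: chart_map_def)
    then have "k field_differentiable at (\<alpha> + 1 / z)" by (rule analytic_on_imp_differentiable_at) simp
    moreover have "(\<lambda>z. \<alpha> + 1 / z) field_differentiable at z"
      using z0 by (intro derivative_intros) auto
    ultimately have "(k \<circ> (\<lambda>z. \<alpha> + 1 / z)) field_differentiable at z"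
      by (intro field_differentiable_compose) auto
    then have "(\<lambda>z. 1 / (k (\<alpha> + 1 / z) - \<beta>)) field_differentiable at z"
      using eq(2)[OF z] by (intro derivative_intros) (auto simp: o_def)
    moreover have "open (S - P)" using oS by (simp add: P_def open_Diff finite_imp_closed)
    ultimately have "f field_differentiable at z"
      unfolding field_differentiable_def
      using has_field_derivative_transform_within_open[of _ _ z "S - P" f] eq(1)[symmetric] z by blast
    then show "f field_differentiable at z within S - P"
      by (rule field_differentiable_at_within)
  qed
  then have "f holomorphic_on S"
    by (rule no_isolated_singularity[OF contf _ oS]) (simp add: P_def)
  then show ?thesis by (simp add: S_def f_def)
qed

lemma target_boundary_transfer:
  assumes "open \<Omega>" "Fin \<beta> \<in> \<Omega>" "M \<in> components (frontier (pole_point \<beta> -` (- \<Omega>)))"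
  shows "pole_point \<beta> ` M \<in> components (frontier \<Omega>)"
proof -
  have "Fin \<beta> \<notin> frontier \<Omega>" using assms(1,2) by (simp add: frontier_def interior_open)
  from homeomorphism_pole_point[OF this] assms(3) show ?thesis
    unfolding frontier_pole_point_vimage[OF assms(1,2)] by (rule homeomorphism_image_component)
qed

lemma peano_transfer:
  assumes "open \<Omega>" "Fin \<beta> \<in> \<Omega>" "peano_compactum (frontier \<Omega>)"
    and "M \<in> components (frontier (pole_point \<beta> -` (- \<Omega>)))"
  shows "peano_continuum M"
proof -
  have "pole_point \<beta> ` M \<in> components (frontier \<Omega>)"
    by (rule target_boundary_transfer[OF assms(1,2,4)])
  then obtain \<gamma> where \<gamma>: "path \<gamma>" "path_image \<gamma> = pole_point \<beta> ` M"
    using assms(3) unfolding peano_compactum_def peano_continuum_def by blast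
  have "path (pole_chart \<beta> \<circ> \<gamma>)"
    by (rule path_continuous_image[OF \<gamma>(1) continuous_on_subset[OF continuous_pole_chart]])
      (use \<gamma>(2) pole_point_neq pole_point_neq[symmetric] in auto)
  moreover have "path_image (pole_chart \<beta> \<circ> \<gamma>) = M"
    unfolding path_image_compose \<gamma>(2) by (simp add: image_image)
  ultimately show ?thesis unfolding peano_continuum_def by blast
qed

lemma bounded_ext_complex: "bounded (S :: ext_complex set)"
  unfolding bounded_def using dist_le_pi by blast

text \<open>Degenerate components have diameter 0. The pole lies in the open set
  \<open>\<Omega>\<close>, so the affine coordinate is Lipschitz on the complement and diameters
  grow at most by a constant factor.\<close>

lemma summable_transfer:
  assumes "open \<Omega>" "Fin \<beta> \<in> \<Omega>"
    and "diameter summable_on nondegenerate_components (frontier \<Omega>)"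
  shows "diameter summable_on components (frontier (pole_point \<beta> -` (- \<Omega>)))"
proof -
  define F where "F = pole_point \<beta> -` (- \<Omega>)"
  have "diameter K = 0" if K: "K \<in> components (frontier \<Omega>) - nondegenerate_components (frontier \<Omega>)" for K
  proof -
    obtain x where x: "x \<in> K" using K in_components_nonempty by blast
    then have "K = {x}" using K by (auto simp: nondegenerate_components_def)
    then show ?thesis by simp
  qed
  then have sum\<Omega>: "diameter summable_on components (frontier \<Omega>)"
    using assms(3) by (subst summable_on_cong_neutral[where T = "nondegenerate_components (frontier \<Omega>)" and g = diameter])
      (auto simp: nondegenerate_components_def)
  have inj: "inj_on ((`) (pole_point \<beta>)) (components (frontier F))"
    by (rule inj_on_image) (auto intro!: inj_onI dest: arg_cong[where f = "pole_chart \<beta>"])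
  have "diameter summable_on ((`) (pole_point \<beta>) ` components (frontier F))"
    by (rule summable_on_subset_banach[OF sum\<Omega>])
      (use target_boundary_transfer[OF assms(1,2)] in \<open>auto simp: F_def\<close>)
  then have sum: "(\<lambda>M. diameter (pole_point \<beta> ` M)) summable_on components (frontier F)"
    using summable_on_reindex[OF inj, of diameter] by (simp add: o_def)
  obtain \<kappa> where \<kappa>: "0 < \<kappa>" "\<And>q. q \<notin> \<Omega> \<Longrightarrow> \<kappa> \<le> chord q (Fin \<beta>)"
    using chord_ge_of_open[OF assms(1,2)] by metis
  have "diameter M \<le> 2 / \<kappa>\<^sup>2 * diameter (pole_point \<beta> ` M)" if M: "M \<in> components (frontier F)" for M
  proof (rule diameter_le)
    show "M \<noteq> {} \<or> 0 \<le> 2 / \<kappa>\<^sup>2 * diameter (pole_point \<beta> ` M)"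
      using in_components_nonempty[OF M] by blast
    have "closed F" unfolding F_def using assms(1) by (intro closed_pole_point_vimage) auto
    then have MF: "M \<subseteq> F" using in_components_subset[OF M] frontier_subset_closed by blast
    fix x y assume xy: "x \<in> M" "y \<in> M"
    have "dist x y \<le> 2 / \<kappa>\<^sup>2 * dist (pole_point \<beta> x) (pole_point \<beta> y)"
      using pole_chart_lipschitz[OF \<kappa>(1), of "pole_point \<beta> x" \<beta> "pole_point \<beta> y"] \<kappa>(2) xy MF
      by (auto simp: F_def)
    also have "\<dots> \<le> 2 / \<kappa>\<^sup>2 * diameter (pole_point \<beta> ` M)"
      by (intro mult_left_mono diameter_bounded_bound bounded_ext_complex) (use xy in auto)
    finally show "norm (x - y) \<le> 2 / \<kappa>\<^sup>2 * diameter (pole_point \<beta> ` M)" by (simp add: dist_norm)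
  qed
  moreover have "0 \<le> diameter M" if "M \<in> components (frontier F)" for M
  proof -
    have "compact F" unfolding F_def by (rule compact_pole_point_vimage[OF assms(1,2)])
    then have "bounded M"
      using in_components_subset[OF that] frontier_subset_closed compact_imp_closed compact_imp_bounded bounded_subset
      by metis
    then show ?thesis by (rule diameter_ge_0)
  qed
  ultimately show ?thesis
    unfolding F_def[symmetric]
    by (intro summable_on_comparison_test[OF summable_on_cmult_right[OF sum, of "2 / \<kappa>\<^sup>2"]]) auto
qed

lemma levels_transfer:
  assumes "open D" "Fin \<alpha> \<in> D" "sigma_finite_linear_measure (point_components (frontier D))"
  shows "AE t in lborel. countable {z. {z} \<in> components (pole_point \<alpha> -` (- D)) \<and> z \<noteq> p \<and> ln (dist p z) = t}"
proof -
  define E where "E = pole_point \<alpha> -` (- D)"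
  define A where "A = point_components (frontier D)"
  define B where "B m = {q. 1 / (real m + 1) \<le> dist p (pole_chart \<alpha> q)}" for m
  define h where "h q = ln (dist p (pole_chart \<alpha> q))" for q
  obtain \<kappa> where \<kappa>: "0 < \<kappa>" "\<And>q. q \<notin> D \<Longrightarrow> \<kappa> \<le> chord q (Fin \<alpha>)"
    using chord_ge_of_open[OF assms(1,2)] by metis
  have AD: "q \<notin> D" if "q \<in> A" for q
    using that assms(1) in_components_subset[of "{q}" "frontier D"]
    by (auto simp: A_def point_components_def frontier_def interior_open)
  \<comment> \<open>A point component of the complement is its own frontier, so it lies in
    \<open>frontier D\<close>; the component of \<open>frontier D\<close> through it is a connected
    subset of \<open>- D\<close> and hence no larger.\<close>
  have mem: "pole_point \<alpha> z \<in> A" if z: "{z} \<in> components E" for z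
  proof -
    have "frontier {z} \<subseteq> frontier E" by (rule frontier_of_components_subset[OF z])
    then have "pole_point \<alpha> z \<in> frontier D"
      using frontier_pole_point_vimage[OF assms(1,2)] by (auto simp: E_def frontier_def)
    then obtain C where C: "C \<in> components (frontier D)" "pole_point \<alpha> z \<in> C"
      using Union_components[of "frontier D"] by blast
    have hom: "homeomorphism (pole_point \<alpha> -` (- D)) (- D) (pole_point \<alpha>) (pole_chart \<alpha>)"
      by (rule homeomorphism_pole_point) (use assms(2) in auto)
    have "{pole_point \<alpha> z} \<in> components (- D)"
      using homeomorphism_image_component[OF hom, of "{z}"] z by (simp add: E_def)
    moreover have "C \<subseteq> - D"
      using in_components_subset[OF C(1)] assms(1) by (auto simp: frontier_def interior_open)
    ultimately have "C \<subseteq> {pole_point \<alpha> z}"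
      using components_maximal in_components_connected[OF C(1)] C(2) by blast
    then have "C = {pole_point \<alpha> z}" using C(2) by blast
    then show ?thesis using C(1) by (simp add: A_def point_components_def)
  qed
  \<comment> \<open>The factor \<open>real m + 1\<close> bounds the derivative of \<open>ln\<close>
    at the distances occurring on \<open>B m\<close>, and \<open>2 / \<kappa>\<^sup>2\<close> is the
    Lipschitz constant of the chart off \<open>D\<close>.\<close>
  have "AE t in lborel. countable {q \<in> A \<inter> (\<Union>m. B m). h q = t}"
  proof (rule AE_countable_level_set[where C = "\<lambda>m. (real m + 1) * (2 / \<kappa>\<^sup>2)"])
    show "sigma_finite_linear_measure A" using assms(3) by (simp add: A_def)
    show "0 \<le> (real m + 1) * (2 / \<kappa>\<^sup>2)" for m by simp
    show "\<bar>h q - h q'\<bar> \<le> (real m + 1) * (2 / \<kappa>\<^sup>2) * dist q q'" if q: "q \<in> A \<inter> B m" "q' \<in> A \<inter> B m" for m q q'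
    proof -
      have ln_le: "ln b - ln a \<le> (real m + 1) * (b - a)" if "1 / (real m + 1) \<le> a" "a \<le> b" for a b :: real
      proof -
        have a: "a > 0" using that(1) by (rule order_less_le_trans[rotated]) (simp add: add_pos_nonneg)
        then have "ln b - ln a = ln (b / a)" using that(2) by (simp add: ln_div)
        also have "\<dots> \<le> b / a - 1" using a that(2) by (intro ln_le_minus_one) auto
        also have "\<dots> = (1 / a) * (b - a)" using a by (simp add: field_simps)
        also have "\<dots> \<le> (real m + 1) * (b - a)"
          using that a by (intro mult_right_mono) (auto simp: field_simps)
        finally show ?thesis .
      qed
      define a b where "a = dist p (pole_chart \<alpha> q)" and "b = dist p (pole_chart \<alpha> q')"
      have ab: "1 / (real m + 1) \<le> a" "1 / (real m + 1) \<le> b" using q by (auto simp: B_def a_def b_def)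
      have "0 < 1 / (real m + 1)" by (simp add: add_pos_nonneg)
      then have pos: "0 < a" "0 < b" using ab by linarith+
      have "\<bar>ln a - ln b\<bar> \<le> (real m + 1) * \<bar>a - b\<bar>"
      proof (cases "a \<le> b")
        case True
        then have "ln a \<le> ln b" using pos by simp
        then show ?thesis using ln_le[OF ab(1) True] True by simp
      next
        case False
        then have "ln b \<le> ln a" using pos by simp
        then show ?thesis using ln_le[OF ab(2), of a] False by simp
      qed
      moreover have "\<bar>a - b\<bar> \<le> dist (pole_chart \<alpha> q) (pole_chart \<alpha> q')"
        using abs_dist_diff_le[of "pole_chart \<alpha> q" p "pole_chart \<alpha> q'"] by (simp add: a_def b_def dist_commute)
      moreover have "dist (pole_chart \<alpha> q) (pole_chart \<alpha> q') \<le> 2 / \<kappa>\<^sup>2 * dist q q'"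
        using q AD \<kappa> by (intro pole_chart_lipschitz) auto
      ultimately have "\<bar>ln a - ln b\<bar> \<le> (real m + 1) * (2 / \<kappa>\<^sup>2 * dist q q')"
        by (elim order_trans) (intro mult_left_mono, auto)
      then show ?thesis
        unfolding h_def a_def[symmetric] b_def[symmetric] by (simp only: mult.assoc)
    qed
  qed
  then show ?thesis
  proof (rule AE_mp, intro AE_I2 impI)
    fix t assume "countable {q \<in> A \<inter> (\<Union>m. B m). h q = t}"
    then have "countable (pole_chart \<alpha> ` {q \<in> A \<inter> (\<Union>m. B m). h q = t})" by (rule countable_image)
    then show "countable {z. {z} \<in> components (pole_point \<alpha> -` (- D)) \<and> z \<noteq> p \<and> ln (dist p z) = t}"
    proof (rule countable_subset[rotated], safe)
      fix z assume z: "{z} \<in> components (pole_point \<alpha> -` (- D))" "z \<noteq> p" "t = ln (dist p z)"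
      obtain m :: nat where "1 / (real m + 1) < dist p z"
        using z(2) reals_Archimedean[of "dist p z"] by (auto simp: inverse_eq_divide add.commute)
      then have "pole_point \<alpha> z \<in> (\<Union>m. B m)" by (auto simp: B_def intro: less_imp_le)
      moreover have "pole_point \<alpha> z \<in> A" using mem z(1) by (simp add: E_def)
      moreover have "h (pole_point \<alpha> z) = ln (dist p z)" by (simp add: h_def)
      ultimately show "z \<in> pole_chart \<alpha> ` {q \<in> A \<inter> (\<Union>m. B m). h q = ln (dist p z)}"
        by (intro image_eqI[of _ _ "pole_point \<alpha> z"]) auto
    qed
  qed
qed

lemma domain_infinite:
  assumes "sph_domain D"
  shows "infinite D"
proof -
  obtain q where q: "q \<in> D" using assms by (auto simp: sph_domain_def)
  have "\<exists>\<alpha>. q \<noteq> Fin \<alpha>"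
    by (cases q) (use ext_complex.inject zero_neq_one in metis)+
  then obtain \<alpha> where \<alpha>: "q \<noteq> Fin \<alpha>" by blast
  have "open (pole_point \<alpha> -` D)"
    using assms by (intro open_pole_point_vimage) (simp add: sph_domain_def)
  moreover have "pole_chart \<alpha> q \<in> pole_point \<alpha> -` D"
    using pole_point_chart[OF \<alpha>] q by simp
  ultimately have "infinite (pole_point \<alpha> -` D)" using finite_imp_not_open by blast
  moreover have "inj (pole_point \<alpha>)" by (metis injI pole_chart_point)
  ultimately show ?thesis using finite_vimageI by blast
qed

theorem theorem1:
  fixes D \<Omega> :: "ext_complex set" and \<phi> :: "ext_complex \<Rightarrow> ext_complex"
  assumes "sph_domain \<Omega>"
    and "peano_compactum (frontier \<Omega>)"
    and "diameter summable_on nondegenerate_components (frontier \<Omega>)"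
    and "circle_domain D"
    and "sigma_finite_linear_measure (point_components (frontier D))"
    and "conformal_homeomorphism D \<Omega> \<phi>"
  shows "\<exists>\<phi>'. continuous_on (closure D) \<phi>' \<and> \<phi>' ` closure D \<subseteq> closure \<Omega> \<and> (\<forall>z\<in>D. \<phi>' z = \<phi> z)"
proof -
  obtain \<psi> where hom: "homeomorphism D \<Omega> \<phi> \<psi>" and holo: "sph_holomorphic_on \<phi> D"
    using assms(6) by (auto simp: conformal_homeomorphism_def)
  have D: "sph_domain D" using assms(4) by (simp add: circle_domain_def)
  have op: "open D" "open \<Omega>" using D assms(1) by (auto simp: sph_domain_def)
  \<comment> \<open>Excluding two points leaves a finite point with a finite image, so that both can
    serve as poles of affine coordinates.\<close>
  have "infinite (D - {Infty, \<psi> Infty})" using domain_infinite[OF D] by simp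
  then obtain q where q: "q \<in> D" "q \<noteq> Infty" "q \<noteq> \<psi> Infty"
    by (metis DiffE infinite_imp_nonempty ex_in_conv insertCI)
  obtain \<alpha> where \<alpha>: "q = Fin \<alpha>" using q(2) by (cases q) auto
  have "\<phi> q \<noteq> Infty" using hom q(1,3) unfolding homeomorphism_def by metis
  then obtain \<beta> where \<beta>: "\<phi> (Fin \<alpha>) = Fin \<beta>" using \<alpha> by (cases "\<phi> q") auto
  have \<alpha>D: "Fin \<alpha> \<in> D" using q \<alpha> by simp
  have \<beta>\<Omega>: "Fin \<beta> \<in> \<Omega>" using hom \<alpha>D \<beta> unfolding homeomorphism_def by (metis imageI)
  define E where "E = pole_point \<alpha> -` (- D)"
  define F where "F = pole_point \<beta> -` (- \<Omega>)"
  define f where "f = (\<lambda>z. pole_chart \<beta> (\<phi> (pole_point \<alpha> z)))"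
  define g where "g = (\<lambda>w. pole_chart \<alpha> (\<psi> (pole_point \<beta> w)))"
  interpret complement_homeo E F f g
    unfolding E_def F_def f_def g_def by (rule complement_homeo_transfer[OF D assms(1) hom \<alpha>D \<beta>])
  have nE: "- E = pole_point \<alpha> -` D" by (auto simp: E_def)
  have holf: "f holomorphic_on (- E)"
    unfolding nE f_def by (rule holomorphic_transfer[OF D hom holo \<alpha>D \<beta>])
  have lim: "\<exists>l. (\<phi> \<longlongrightarrow> l) (at x within D)" if x: "x \<in> closure D - D" for x
  proof -
    have "x \<in> frontier D" using x op(1) by (simp add: frontier_def interior_open)
    have xa: "x \<noteq> Fin \<alpha>" using x \<alpha>D by blast
    define p where "p = pole_chart \<alpha> x"
    have px: "pole_point \<alpha> p = x" using pole_point_chart[OF xa] by (simp add: p_def)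
    have p: "p \<in> frontier E"
      unfolding E_def frontier_pole_point_vimage[OF op(1) \<alpha>D] using px \<open>x \<in> frontier D\<close> by simp
    have "\<exists>l. (f \<longlongrightarrow> l) (at p within - E)"
    proof (rule boundary_limit_exists[OF holf _ _ _ p])
      show "\<exists>m \<rho>. 0 \<le> \<rho> \<and> K = cball m \<rho>" if "K \<in> components E" for K
        using circle_domain_components[OF assms(4) \<alpha>D] that by (simp add: E_def)
      show "peano_continuum M" if "M \<in> components (frontier F)" for M
        using peano_transfer[OF op(2) \<beta>\<Omega> assms(2)] that by (simp add: F_def)
      show "diameter summable_on components (frontier F)"
        using summable_transfer[OF op(2) \<beta>\<Omega> assms(3)] by (simp add: F_def)
      show "AE t in lborel. countable {z. {z} \<in> components E \<and> z \<noteq> p \<and> ln (dist p z) = t}"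
        using levels_transfer[OF op(1) \<alpha>D assms(5)] by (simp add: E_def)
    qed
    then obtain l where l: "(f \<longlongrightarrow> l) (at p within - E)" ..
    have "(pole_point \<beta> \<longlongrightarrow> pole_point \<beta> l) (at l)"
      using continuous_pole_point[of UNIV] by (simp add: continuous_on_def)
    then have 1: "((\<lambda>z. pole_point \<beta> (f z)) \<longlongrightarrow> pole_point \<beta> l) (at p within - E)"
      by (rule tendsto_compose[OF _ l])
    \<comment> \<open>The pole is taken out of \<open>D\<close> because the chart has a junk value
      there. It differs from \<open>x\<close>, so limits at \<open>x\<close> within \<open>D\<close>
      are unaffected.\<close>
    have "(pole_chart \<alpha> \<longlongrightarrow> p) (at x within D - {Fin \<alpha>})"
      using continuous_on_subset[OF continuous_pole_chart, of "insert x (D - {Fin \<alpha>})" \<alpha>] xa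
      unfolding continuous_on_def p_def by (force intro: tendsto_within_subset)
    moreover have "eventually (\<lambda>y. pole_chart \<alpha> y \<in> - E \<and> pole_chart \<alpha> y \<noteq> p) (at x within D - {Fin \<alpha>})"
      unfolding eventually_at_filter
    proof (rule always_eventually, intro allI impI conjI)
      fix y assume y: "y \<noteq> x" "y \<in> D - {Fin \<alpha>}"
      have "pole_point \<alpha> (pole_chart \<alpha> y) = y" using y by (intro pole_point_chart) auto
      then show "pole_chart \<alpha> y \<in> - E" "pole_chart \<alpha> y \<noteq> p" using y px by (auto simp: E_def)
    qed
    ultimately have "filterlim (pole_chart \<alpha>) (at p within - E) (at x within D - {Fin \<alpha>})"
      by (simp add: filterlim_at)
    from filterlim_compose[OF 1 this]
    have "((\<lambda>y. pole_point \<beta> (f (pole_chart \<alpha> y))) \<longlongrightarrow> pole_point \<beta> l) (at x within D - {Fin \<alpha>})" .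
    moreover have "eventually (\<lambda>y. pole_point \<beta> (f (pole_chart \<alpha> y)) = \<phi> y) (at x within D - {Fin \<alpha>})"
      unfolding eventually_at_filter
    proof (rule always_eventually, intro allI impI)
      fix y assume y: "y \<noteq> x" "y \<in> D - {Fin \<alpha>}"
      have "pole_point \<alpha> (pole_chart \<alpha> y) = y" using y by (intro pole_point_chart) auto
      then show "pole_point \<beta> (f (pole_chart \<alpha> y)) = \<phi> y"
        using continuous_transferred_map(2)[OF hom \<alpha>D \<beta>, of "pole_chart \<alpha> y"] y by (simp add: f_def)
    qed
    ultimately have "(\<phi> \<longlongrightarrow> pole_point \<beta> l) (at x within D - {Fin \<alpha>})"
      using tendsto_cong by force
    moreover have "at x within D - {Fin \<alpha>} = at x within D"
      using xa by (intro at_within_nhd[of _ "- {Fin \<alpha>}"]) auto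
    ultimately show ?thesis by auto
  qed
  have "continuous_on D \<phi>" using hom by (simp add: homeomorphism_def)
  then obtain \<phi>' where "continuous_on (closure D) \<phi>'" "\<phi>' ` closure D \<subseteq> closure (\<phi> ` D)" "\<And>x. x \<in> D \<Longrightarrow> \<phi>' x = \<phi> x"
    using continuous_extension_by_limits[OF _ lim] by metis
  moreover have "\<phi> ` D = \<Omega>" using hom by (simp add: homeomorphism_def)
  ultimately show ?thesis by auto
qed

end
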